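(* Let $P,A_I,A_O,B_I,B_O,F$ be finite-dimensional Hilbert spaces and let $U:P\otimes A_O\otimes B_O\to A_I\otimes B_I\otimes F$ be a unitary operator representing a pure quantum superchannel with two slots $A$ (input $A_I$, output $A_O$) and $B$ (input $B_I$, output $B_O$), global past $P$ and global future $F$. Then $U$ represents a direct sum of pure combs with two slots $A$ and $B$: there exist orthogonal decompositions $P=P^{A\prec B}\oplus P^{B\prec A}$ and $F=F^{A\prec B}\oplus F^{B\prec A}$ into subspaces, a unitary $U^{A\prec B}:P^{A\prec B}\otimes A_O\otimes B_O\to A_I\otimes B_I\otimes F^{A\prec B}$ representing a quantum comb of $A\prec B$, and a unitary $U^{B\prec A}:P^{B\prec A}\otimes A_O\otimes B_O\to A_I\otimes B_I\otimes F^{B\prec A}$ representing a quantum comb of $B\prec A$, such that $U=U^{A\prec B}\oplus U^{B\prec A}$ (i.e. $U$ restricted to $P^{A\prec B}\otimes A_O\otimes B_O$ equals $U^{A\prec B}$ and restricted to $P^{B\prec A}\otimes A_O\otimes B_O$ equals $U^{B\prec A}$).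
   Context: All Hilbert spaces are finite-dimensional. Choi operator of a map $\mathcal{E}:\mathcal{L}(\mathcal{H}_I)\to\mathcal{L}(\mathcal{H}_O)$: $E=\sum_{i,i'}|i\rangle\langle i'|\otimes\mathcal{E}(|i\rangle\langle i'|)$. Choi vector of an operator $X:\mathcal{H}_I\to\mathcal{H}_O$: $|X\rangle\rangle=\sum_i|i\rangle\otimes X|i\rangle$. Link product: $E*G=\mathrm{Tr}_1[(E\otimes 1_2)(1_0\otimes G^{T_1})]$ for $E\in\mathcal{L}(\mathcal{H}_0\otimes\mathcal{H}_1)$, $G\in\mathcal{L}(\mathcal{H}_1\otimes\mathcal{H}_2)$. A two-slot supermap $[\mathcal{L}(A_I)\to\mathcal{L}(A_O)]\otimes[\mathcal{L}(B_I)\to\mathcal{L}(B_O)]\to[\mathcal{L}(P)\to\mathcal{L}(F)]$ is given by a Choi operator $W\in\mathcal{L}(P\otimes A_I\otimes A_O\otimes B_I\otimes B_O\otimes F)$, acting on inputs (possibly with auxiliary spaces) by $W*(E_A\otimes E_B)$. It is a quantum superchannel if for all auxiliary spaces $A_I',A_O',B_I',B_O'$ and all CPTP maps $\mathcal{E}_A:\mathcal{L}(A_I\otimes A_I')\to\mathcal{L}(A_O\otimes A_O')$, $\mathcal{E}_B:\mathcal{L}(B_I\otimes B_I')\to\mathcal{L}(B_O\otimes B_O')$, $W*(E_A\otimes E_B)$ is the Choi operator of a CPTP map $\mathcal{L}(P\otimes A_I'\otimes B_I')\to\mathcal{L}(F\otimes A_O'\otimes B_O')$; it is pure if this output is a unitary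 channel whenever $\mathcal{E}_A,\mathcal{E}_B$ are unitary channels. A unitary $U:P\otimes A_O\otimes B_O\to A_I\otimes B_I\otimes F$ represents the supermap with Choi operator $W=|U\rangle\rangle\langle\langle U|$ (pure superchannels are exactly those represented this way). A quantum comb of $A\prec B$ is a two-slot superchannel realizable by a causally ordered circuit using slot $A$ before slot $B$; equivalently its Choi operator $W\ge0$ satisfies $\mathrm{Tr}_F W=1^{B_O}\otimes R_2$, $\mathrm{Tr}_{B_I}R_2=1^{A_O}\otimes R_1$, $\mathrm{Tr}_{A_I}R_1=1^{P}$ for some operators $R_2,R_1$. A quantum comb of $B\prec A$ is defined with the roles of $A$ and $B$ exchanged. *)

theory Defs
  imports "Jordan_Normal_Form.Schur_Decomposition"
begin

text \<open>A Hilbert space of dimension d is C^d with computational basis {0..<d}.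
  A tensor product of spaces of dimensions d1,...,dk is C^(d1*...*dk), and the
  basis vector |x1>...|xk> has the mixed-radix index enc [d1,...,dk] [x1,...,xk]
  (first factor most significant, i.e. the Kronecker-product convention).
  Operators are complex matrices (row index = output, column index = input).\<close>

definition enc :: "nat list \<Rightarrow> nat list \<Rightarrow> nat" where
  "enc ds xs = foldl (\<lambda>acc (d, x). acc * d + x) 0 (zip ds xs)"

fun dec :: "nat list \<Rightarrow> nat \<Rightarrow> nat list" where
  "dec [] r = []"
| "dec (d # ds) r = (r div prod_list ds) # dec ds (r mod prod_list ds)"

definition mtrace :: "complex mat \<Rightarrow> complex" where
  "mtrace M = (\<Sum>i<dim_row M. M $$ (i, i))"

definition kron :: "complex mat \<Rightarrow> complex mat \<Rightarrow> complex mat" where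
  "kron A B = mat (dim_row A * dim_row B) (dim_col A * dim_col B)
     (\<lambda>(i, j). A $$ (i div dim_row B, j div dim_col B) * B $$ (i mod dim_row B, j mod dim_col B))"

text \<open>Unitary operator (possibly between spaces presented with different
  factorisations; the two equations force the matrix to be square).\<close>
definition is_unitary :: "complex mat \<Rightarrow> bool" where
  "is_unitary M \<longleftrightarrow> mat_adjoint M * M = 1\<^sub>m (dim_col M) \<and> M * mat_adjoint M = 1\<^sub>m (dim_row M)"

text \<open>Isometry V : C^k -> C^n (orthonormal basis of the subspace range V).\<close>
definition is_isometry :: "complex mat \<Rightarrow> bool" where
  "is_isometry V \<longleftrightarrow> mat_adjoint V * V = 1\<^sub>m (dim_col V)"

definition psd :: "nat \<Rightarrow> complex mat \<Rightarrow> bool" where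
  "psd n M \<longleftrightarrow> M \<in> carrier_mat n n \<and>
     (\<forall>v \<in> carrier_vec n. Im (conjugate v \<bullet> (M *\<^sub>v v)) = 0 \<and> 0 \<le> Re (conjugate v \<bullet> (M *\<^sub>v v)))"

text \<open>Choi operator of E : L(C^n) -> L(C^m): the (n*m)x(n*m) matrix
  E = sum_{i,i'} |i><i'| (x) E(|i><i'|), i.e. entry (i*m+o, i'*m+o') = E(|i><i'|)_(o,o').
  The linear map with Choi operator C:\<close>
definition map_of_choi :: "nat \<Rightarrow> nat \<Rightarrow> complex mat \<Rightarrow> complex mat \<Rightarrow> complex mat" where
  "map_of_choi n m C X = mat m m (\<lambda>(q, q').
     \<Sum>i<n. \<Sum>i'<n. X $$ (i, i') * C $$ (i * m + q, i' * m + q'))"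

text \<open>id_k (x) E applied to an operator on C^k (x) C^n.\<close>
definition ampl_map_of_choi :: "nat \<Rightarrow> nat \<Rightarrow> nat \<Rightarrow> complex mat \<Rightarrow> complex mat \<Rightarrow> complex mat" where
  "ampl_map_of_choi k n m C X = mat (k * m) (k * m) (\<lambda>(r, c).
     \<Sum>i<n. \<Sum>i'<n. X $$ ((r div m) * n + i, (c div m) * n + i')
                     * C $$ (i * m + r mod m, i' * m + c mod m))"

definition is_CPTP_choi :: "nat \<Rightarrow> nat \<Rightarrow> complex mat \<Rightarrow> bool" where
  "is_CPTP_choi n m C \<longleftrightarrow> C \<in> carrier_mat (n * m) (n * m)
     \<and> (\<forall>k X. psd (k * n) X \<longrightarrow> psd (k * m) (ampl_map_of_choi k n m C X))
     \<and> (\<forall>X \<in> carrier_mat n n. mtrace (map_of_choi n m C X) = mtrace X)"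

text \<open>Choi vector |X>> = sum_i |i> (x) X|i> of X : C^n -> C^m, and |X>><<X|.\<close>
definition choi_vec :: "nat \<Rightarrow> nat \<Rightarrow> complex mat \<Rightarrow> complex vec" where
  "choi_vec n m X = vec (n * m) (\<lambda>r. X $$ (r mod m, r div m))"

definition choi_of_op :: "nat \<Rightarrow> nat \<Rightarrow> complex mat \<Rightarrow> complex mat" where
  "choi_of_op n m X = mat (n * m) (n * m)
     (\<lambda>(r, c). choi_vec n m X $ r * cnj (choi_vec n m X $ c))"

definition is_unitary_channel_choi :: "nat \<Rightarrow> nat \<Rightarrow> complex mat \<Rightarrow> bool" where
  "is_unitary_channel_choi n m C \<longleftrightarrow>
     (\<exists>V. V \<in> carrier_mat m n \<and> is_unitary V \<and> C = choi_of_op n m V)"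

text \<open>A two-slot supermap is given by its Choi operator W on
  P (x) A_I (x) A_O (x) B_I (x) B_O (x) F (in this order), dimensions
  dP dAI dAO dBI dBO dF.  Inputs: E_A, Choi operator of a map
  L(A_I (x) A_I') -> L(A_O (x) A_O') (index ordering A_I, A_I', A_O, A_O'),
  E_B likewise.  The link product W * (E_A (x) E_B) written out entrywise,
  its indices ordered as the Choi operator of a map
  L(P (x) A_I' (x) B_I') -> L(F (x) A_O' (x) B_O').\<close>
definition link_out ::
  "nat \<Rightarrow> nat \<Rightarrow> nat \<Rightarrow> nat \<Rightarrow> nat \<Rightarrow> nat \<Rightarrow> nat \<Rightarrow> nat \<Rightarrow> nat \<Rightarrow> nat
   \<Rightarrow> complex mat \<Rightarrow> complex mat \<Rightarrow> complex mat \<Rightarrow> complex mat" where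
  "link_out dP dAI dAO dBI dBO dF a1 a2 b1 b2 W EA EB =
    (let ds = [dP, a1, b1, dF, a2, b2]; N = dP * a1 * b1 * (dF * a2 * b2);
         dW = [dP, dAI, dAO, dBI, dBO, dF] in
     mat N N (\<lambda>(r, c). let x = dec ds r; y = dec ds c in
       \<Sum>ai<dAI. \<Sum>ai'<dAI. \<Sum>ao<dAO. \<Sum>ao'<dAO.
       \<Sum>bi<dBI. \<Sum>bi'<dBI. \<Sum>bo<dBO. \<Sum>bo'<dBO.
         W $$ (enc dW [x!0, ai, ao, bi, bo, x!3], enc dW [y!0, ai', ao', bi', bo', y!3])
       * EA $$ (enc [dAI, a1, dAO, a2] [ai, x!1, ao, x!4], enc [dAI, a1, dAO, a2] [ai', y!1, ao', y!4])
       * EB $$ (enc [dBI, b1, dBO, b2] [bi, x!2, bo, x!5], enc [dBI, b1, dBO, b2] [bi', y!2, bo', y!5])))"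

definition is_superchannel ::
  "nat \<Rightarrow> nat \<Rightarrow> nat \<Rightarrow> nat \<Rightarrow> nat \<Rightarrow> nat \<Rightarrow> complex mat \<Rightarrow> bool" where
  "is_superchannel dP dAI dAO dBI dBO dF W \<longleftrightarrow>
     (\<forall>a1 a2 b1 b2 EA EB.
        is_CPTP_choi (dAI * a1) (dAO * a2) EA \<and> is_CPTP_choi (dBI * b1) (dBO * b2) EB \<longrightarrow>
        is_CPTP_choi (dP * a1 * b1) (dF * a2 * b2) (link_out dP dAI dAO dBI dBO dF a1 a2 b1 b2 W EA EB))"

definition is_pure_supermap ::
  "nat \<Rightarrow> nat \<Rightarrow> nat \<Rightarrow> nat \<Rightarrow> nat \<Rightarrow> nat \<Rightarrow> complex mat \<Rightarrow> bool" where
  "is_pure_supermap dP dAI dAO dBI dBO dF W \<longleftrightarrow>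
     (\<forall>a1 a2 b1 b2 EA EB.
        is_unitary_channel_choi (dAI * a1) (dAO * a2) EA \<and> is_unitary_channel_choi (dBI * b1) (dBO * b2) EB \<longrightarrow>
        is_unitary_channel_choi (dP * a1 * b1) (dF * a2 * b2) (link_out dP dAI dAO dBI dBO dF a1 a2 b1 b2 W EA EB))"

text \<open>Choi operator W = |U>><<U| of the supermap represented by a unitary
  U : P (x) A_O (x) B_O -> A_I (x) B_I (x) F, with subsystems reordered to
  P, A_I, A_O, B_I, B_O, F.\<close>
definition supermap_choi ::
  "nat \<Rightarrow> nat \<Rightarrow> nat \<Rightarrow> nat \<Rightarrow> nat \<Rightarrow> nat \<Rightarrow> complex mat \<Rightarrow> complex mat" where
  "supermap_choi dP dAI dAO dBI dBO dF U =
    (let ds = [dP, dAI, dAO, dBI, dBO, dF]; N = prod_list ds;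
         u = (\<lambda>x. U $$ (enc [dAI, dBI, dF] [x!1, x!3, x!5], enc [dP, dAO, dBO] [x!0, x!2, x!4])) in
     mat N N (\<lambda>(r, c). u (dec ds r) * cnj (u (dec ds c))))"

text \<open>Comb of X \<prec> Y: w is the Choi operator given as a function of index tuples
  ordered (P, X_I, X_O, Y_I, Y_O, F).  Conditions: W \<ge> 0,
  Tr_F W = 1^{Y_O} (x) R2, Tr_{Y_I} R2 = 1^{X_O} (x) R1, Tr_{X_I} R1 = 1^P.\<close>
definition is_comb_fun ::
  "nat \<Rightarrow> nat \<Rightarrow> nat \<Rightarrow> nat \<Rightarrow> nat \<Rightarrow> nat \<Rightarrow> (nat list \<Rightarrow> nat list \<Rightarrow> complex) \<Rightarrow> bool" where
  "is_comb_fun dP dXI dXO dYI dYO dF w \<longleftrightarrow>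
    (let ds = [dP, dXI, dXO, dYI, dYO, dF]; N = prod_list ds in
     psd N (mat N N (\<lambda>(r, c). w (dec ds r) (dec ds c))) \<and>
     (\<exists>R2 R1 :: nat list \<Rightarrow> nat list \<Rightarrow> complex.
        (\<forall>p<dP. \<forall>p'<dP. \<forall>xi<dXI. \<forall>xi'<dXI. \<forall>xo<dXO. \<forall>xo'<dXO.
         \<forall>yi<dYI. \<forall>yi'<dYI. \<forall>yo<dYO. \<forall>yo'<dYO.
           (\<Sum>f<dF. w [p, xi, xo, yi, yo, f] [p', xi', xo', yi', yo', f])
             = (if yo = yo' then R2 [p, xi, xo, yi] [p', xi', xo', yi'] else 0)) \<and>
        (\<forall>p<dP. \<forall>p'<dP. \<forall>xi<dXI. \<forall>xi'<dXI. \<forall>xo<dXO. \<forall>xo'<dXO.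
           (\<Sum>yi<dYI. R2 [p, xi, xo, yi] [p', xi', xo', yi])
             = (if xo = xo' then R1 [p, xi] [p', xi'] else 0)) \<and>
        (\<forall>p<dP. \<forall>p'<dP.
           (\<Sum>xi<dXI. R1 [p, xi] [p', xi]) = (if p = p' then 1 else 0))))"

definition is_comb_AB ::
  "nat \<Rightarrow> nat \<Rightarrow> nat \<Rightarrow> nat \<Rightarrow> nat \<Rightarrow> nat \<Rightarrow> complex mat \<Rightarrow> bool" where
  "is_comb_AB dP dAI dAO dBI dBO dF W \<longleftrightarrow>
     is_comb_fun dP dAI dAO dBI dBO dF
       (\<lambda>x y. W $$ (enc [dP, dAI, dAO, dBI, dBO, dF] x, enc [dP, dAI, dAO, dBI, dBO, dF] y))"

definition swapAB :: "nat list \<Rightarrow> nat list" where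
  "swapAB x = [x!0, x!3, x!4, x!1, x!2, x!5]"

definition is_comb_BA ::
  "nat \<Rightarrow> nat \<Rightarrow> nat \<Rightarrow> nat \<Rightarrow> nat \<Rightarrow> nat \<Rightarrow> complex mat \<Rightarrow> bool" where
  "is_comb_BA dP dAI dAO dBI dBO dF W \<longleftrightarrow>
     is_comb_fun dP dBI dBO dAI dAO dF
       (\<lambda>x y. W $$ (enc [dP, dAI, dAO, dBI, dBO, dF] (swapAB x),
                    enc [dP, dAI, dAO, dBI, dBO, dF] (swapAB y)))"

end

theory Submission
  imports Defs
begin

text \<open>
  Testing trace preservation of the superchannel against measure-and-prepare channels without
  auxiliary systems, and polarising, shows that, in
  \<open>Tr\<^sub>F |U\<rangle>\<rangle>\<langle>\<langle>U|\<close>, a slot output never signals to the input of the same slot, and that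
  the part traceless on both \<open>A\<^sub>O\<close> and \<open>B\<^sub>O\<close> vanishes.

  In the Heisenberg picture \<open>U\<^sup>\<dagger> (X \<otimes> 1 \<otimes> 1) U\<close> therefore acts on \<open>P \<otimes> B\<^sub>O\<close> only, and
  \<open>U\<^sup>\<dagger> (1 \<otimes> Y \<otimes> 1) U\<close> on \<open>P \<otimes> A\<^sub>O\<close> only. Their matrix blocks with respect to \<open>B\<^sub>O\<close>, resp. \<open>A\<^sub>O\<close>,
  are two commuting self-adjoint families of operators on \<open>P\<close>. The combinations of blocks that witness
  signalling from \<open>B\<^sub>O\<close> to \<open>A\<^sub>I\<close> annihilate those that witness signalling from \<open>A\<^sub>O\<close> to \<open>B\<^sub>I\<close>, because
  their products are the doubly traceless part above. Hence \<open>P\<close> splits into two subspaces reducing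
  both families, with one direction of signalling absent on each. A projection on \<open>P\<close> commuting with
  both families is mapped by \<open>U\<close> to a projection of the form \<open>1 \<otimes> 1 \<otimes> Q\<close>, which gives the matching
  splitting of \<open>F\<close>.
\<close>

section \<open>Adjoints, isometries and projections\<close>

text \<open>Index 0 serves as the reference throughout. The test channels prepare basis state 0 on
  failure, so the part of a functional proportional to the identity on a slot output is read off at
  its 0 entry; positive dimensions make 0 a legal index.

  Unitarity enters decisively as \<open>U * mat_adjoint U = 1\<close>, which makes the Heisenberg
  evolution multiplicative. Hence a block of one family times a block of the other is a single block
  of the joint evolution of X and Y. This one identity gives both the commutation and the
  annihilation. It has to hold block by block, since commutation on P, \<open>A_O\<close> and
  \<open>B_O\<close> together would not by itself give subspaces of P alone.

  The splitting is asymmetric: the second subspace is the largest reducing one without signalling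
  from \<open>A_O\<close> to \<open>B_I\<close>, and its complement turns out to be free of the
  opposite signal. A part of P with no signalling at all therefore lands in the second subspace.

  Subspaces are carried as isometries, so that restriction is matrix multiplication and the zero
  subspace is an isometry without columns.\<close>

lemma dim_mat_adjoint [simp]:
  "dim_row (mat_adjoint A) = dim_col A" "dim_col (mat_adjoint A) = dim_row A"
  by (auto simp: mat_adjoint_def)

lemma mat_adjoint_carrier [simp, intro]:
  "A \<in> carrier_mat n m \<Longrightarrow> mat_adjoint A \<in> carrier_mat m n"
  by (intro carrier_matI) auto

lemma mat_adjoint_index [simp]:
  fixes A :: "complex mat"
  assumes "i < dim_col A" "j < dim_row A"
  shows "mat_adjoint A $$ (i, j) = cnj (A $$ (j, i))"
  using assms by (simp add: mat_adjoint_def mat_of_rows_def cols_def col_def)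

lemma mat_adjoint_adjoint [simp]: "mat_adjoint (mat_adjoint A) = (A :: complex mat)"
  by (rule eq_matI) auto

lemma mat_adjoint_one [simp]: "mat_adjoint (1\<^sub>m n) = (1\<^sub>m n :: complex mat)"
  by (rule eq_matI) auto

lemma mat_adjoint_mult:
  fixes A B :: "complex mat"
  assumes "A \<in> carrier_mat n m" "B \<in> carrier_mat m l"
  shows "mat_adjoint (A * B) = mat_adjoint B * mat_adjoint A"
  using assms by (intro eq_matI) (auto simp: scalar_prod_def ac_simps)

lemma mult_assoc_dim:
  fixes A B C :: "complex mat"
  assumes "dim_col A = dim_row B" "dim_col B = dim_row C"
  shows "A * B * C = A * (B * C)"
  using assms by (intro assoc_mult_mat[of _ "dim_row A" "dim_row B" _ "dim_row C" _ "dim_col C"]) auto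

lemma mult_index_sum:
  assumes "A \<in> carrier_mat n m" "B \<in> carrier_mat m l" "i < n" "j < l"
  shows "(A * B) $$ (i, j) = (\<Sum>k<m. A $$ (i, k) * B $$ (k, j))"
  using assms by (auto simp: scalar_prod_def lessThan_atLeast0)

text \<open>The projection \<open>Q = V * mat_adjoint V\<close> has trace \<open>k\<close>, by
  cyclicity. A diagonal entry of a projection is the squared norm of its row, hence at least its own
  square and so at most 1; the trace is therefore also at most \<open>n\<close>.\<close>

lemma isometry_dim_le:
  assumes V: "V \<in> carrier_mat n k" "is_isometry V"
  shows "k \<le> n"
proof -
  define Q where "Q = V * mat_adjoint V"
  have Qc: "Q \<in> carrier_mat n n" using V by (auto simp: Q_def)
  have VV: "mat_adjoint V * V = 1\<^sub>m k" using V by (auto simp: is_isometry_def)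
  have QQ: "Q * Q = Q"
  proof -
    have "Q * Q = V * (mat_adjoint V * V) * mat_adjoint V"
      unfolding Q_def using V(1) by (simp add: mult_assoc_dim)
    thus ?thesis using V by (simp add: VV Q_def)
  qed
  have Qa: "mat_adjoint Q = Q"
    using V by (auto simp: Q_def mat_adjoint_mult[of V n k _ n])
  have herm: "Q $$ (j, i) = cnj (Q $$ (i, j))" if "i < n" "j < n" for i j
    using that Qc by (subst Qa[symmetric]) auto
  have "Re (Q $$ (i, i)) \<le> 1" if i: "i < n" for i
  proof -
    have "Q $$ (i, i) = (\<Sum>j<n. Q $$ (i, j) * Q $$ (j, i))"
      using i Qc by (subst QQ[symmetric], subst mult_index_sum[of Q n n Q n]) auto
    also have "\<dots> = (\<Sum>j<n. of_real ((cmod (Q $$ (i, j)))\<^sup>2))"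
      using i by (intro sum.cong) (auto simp: herm[of i] complex_norm_square simp del: of_real_power)
    finally have eq: "Q $$ (i, i) = of_real (\<Sum>j<n. (cmod (Q $$ (i, j)))\<^sup>2)" by simp
    have "(cmod (Q $$ (i, i)))\<^sup>2 \<le> (\<Sum>j<n. (cmod (Q $$ (i, j)))\<^sup>2)"
      using i by (intro member_le_sum) auto
    also have "\<dots> = Re (Q $$ (i, i))" by (subst eq) simp
    also have "\<dots> \<le> cmod (Q $$ (i, i))" by (rule complex_Re_le_cmod)
    finally have sq: "cmod (Q $$ (i, i)) * cmod (Q $$ (i, i)) \<le> 1 * cmod (Q $$ (i, i))"
      by (simp add: power2_eq_square)
    have "cmod (Q $$ (i, i)) \<le> 1"
    proof (cases "Q $$ (i, i) = 0")
      case False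
      thus ?thesis by (intro mult_right_le_imp_le[OF sq]) simp
    qed simp
    thus ?thesis using complex_Re_le_cmod order.trans by blast
  qed
  hence "(\<Sum>i<n. Re (Q $$ (i, i))) \<le> real n"
    using sum_mono[of "{..<n}" "\<lambda>i. Re (Q $$ (i, i))" "\<lambda>_. 1"] by simp
  moreover have "(\<Sum>i<n. Q $$ (i, i)) = of_nat k"
  proof -
    have "(\<Sum>i<n. Q $$ (i, i)) = (\<Sum>i<n. \<Sum>j<k. V $$ (i, j) * cnj (V $$ (i, j)))"
      unfolding Q_def using V
      by (intro sum.cong refl, subst mult_index_sum[of _ n k _ n]) auto
    also have "\<dots> = (\<Sum>j<k. \<Sum>i<n. mat_adjoint V $$ (j, i) * V $$ (i, j))"
      using V by (subst sum.swap) (auto intro!: sum.cong)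
    also have "\<dots> = (\<Sum>j<k. (mat_adjoint V * V) $$ (j, j))"
      using V by (intro sum.cong refl, subst mult_index_sum[of _ k n _ k]) auto
    finally show ?thesis by (simp add: VV)
  qed
  hence "(\<Sum>i<n. Re (Q $$ (i, i))) = real k"
    by (simp flip: Re_sum)
  ultimately show ?thesis by simp
qed

text \<open>A maximal isometry into the subspace is onto: otherwise the normalised defect of an
  uncovered vector could be appended as a further column.\<close>
lemma subspace_isometry:
  fixes S :: "complex vec set"
  assumes S: "S \<subseteq> carrier_vec n"
    and zero: "0\<^sub>v n \<in> S"
    and add: "\<And>v w. v \<in> S \<Longrightarrow> w \<in> S \<Longrightarrow> v + w \<in> S"
    and smult: "\<And>c v. v \<in> S \<Longrightarrow> c \<cdot>\<^sub>v v \<in> S"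
  shows "\<exists>k. \<exists>V\<in>carrier_mat n k. is_isometry V \<and> (\<forall>v\<in>carrier_vec k. V *\<^sub>v v \<in> S)
    \<and> (\<forall>v\<in>S. V *\<^sub>v (mat_adjoint V *\<^sub>v v) = v)"
proof -
  define G where "G k \<longleftrightarrow> (\<exists>V\<in>carrier_mat n k. is_isometry V \<and> (\<forall>v\<in>carrier_vec k. V *\<^sub>v v \<in> S))" for k
  \<comment> \<open>The isometry without columns starts the search for the greatest
    \<open>k\<close>; it also covers the zero subspace.\<close>
  have "G 0"
    unfolding G_def
  proof (intro bexI conjI ballI)
    show "is_isometry (0\<^sub>m n 0 :: complex mat)"
      by (auto simp: is_isometry_def intro!: eq_matI)
    show "0\<^sub>m n 0 *\<^sub>v v \<in> S" if "v \<in> carrier_vec 0" for v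
    proof -
      have "0\<^sub>m n 0 *\<^sub>v v = 0\<^sub>v n" using that by (intro eq_vecI) (auto simp: scalar_prod_def)
      thus ?thesis using zero by simp
    qed
  qed auto
  moreover have "\<forall>k. G k \<longrightarrow> k \<le> n"
    unfolding G_def using isometry_dim_le by blast
  ultimately obtain k where k: "G k" "\<And>l. G l \<Longrightarrow> l \<le> k"
    using Nat.ex_has_greatest_nat[of G 0 n] by blast
  then obtain V where V: "V \<in> carrier_mat n k" "is_isometry V" "\<And>v. v \<in> carrier_vec k \<Longrightarrow> V *\<^sub>v v \<in> S"
    unfolding G_def by blast
  have VV: "mat_adjoint V * V = 1\<^sub>m k" using V by (auto simp: is_isometry_def)
  have "V *\<^sub>v (mat_adjoint V *\<^sub>v v) = v" if v: "v \<in> S" for v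
  proof (rule ccontr)
    assume neq: "V *\<^sub>v (mat_adjoint V *\<^sub>v v) \<noteq> v"
    define y where "y = mat_adjoint V *\<^sub>v v"
    define w where "w = v + (-1) \<cdot>\<^sub>v (V *\<^sub>v y)"
    have vc: "v \<in> carrier_vec n" using v S by auto
    have yc: "y \<in> carrier_vec k" unfolding y_def using V vc by (intro mult_mat_vec_carrier[of _ k n]) auto
    have wS: "w \<in> S" unfolding w_def using v yc V by (intro add smult) auto
    hence wc: "w \<in> carrier_vec n" using S by auto
    have Vy: "V *\<^sub>v y \<in> carrier_vec n" using V yc S by blast
    have wn: "w \<noteq> 0\<^sub>v n"
    proof
      assume w0: "w = 0\<^sub>v n"
      have "v = V *\<^sub>v y"
      proof (rule eq_vecI)
        fix i assume i: "i < dim_vec (V *\<^sub>v y)"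
        hence "w $ i = 0" using w0 V(1) by simp
        thus "v $ i = (V *\<^sub>v y) $ i"
          using i vc Vy unfolding w_def by auto
      qed (use vc V(1) in auto)
      with neq show False unfolding y_def by metis
    qed
    have aw: "mat_adjoint V *\<^sub>v w = 0\<^sub>v k"
    proof -
      have "mat_adjoint V *\<^sub>v w = mat_adjoint V *\<^sub>v v + mat_adjoint V *\<^sub>v ((-1) \<cdot>\<^sub>v (V *\<^sub>v y))"
        unfolding w_def using V vc Vy by (intro mult_add_distrib_mat_vec[of _ k n]) auto
      also have "mat_adjoint V *\<^sub>v ((-1) \<cdot>\<^sub>v (V *\<^sub>v y)) = (-1) \<cdot>\<^sub>v (mat_adjoint V *\<^sub>v (V *\<^sub>v y))"
        using V Vy by (intro mult_mat_vec[of _ k n]) auto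
      also have "mat_adjoint V *\<^sub>v (V *\<^sub>v y) = y"
        using V yc by (subst assoc_mult_mat_vec[symmetric, of _ k n _ k]) (auto simp: VV)
      finally show ?thesis using yc by (auto simp: y_def[symmetric])
    qed
    define N where "N = (\<Sum>i<n. (cmod (w $ i))\<^sup>2)"
    have "N \<noteq> 0"
    proof
      assume "N = 0"
      hence "\<forall>i<n. w $ i = 0" unfolding N_def by (subst (asm) sum_nonneg_eq_0_iff) auto
      with wn wc show False by (auto intro!: eq_vecI)
    qed
    moreover have "N \<ge> 0" unfolding N_def by (intro sum_nonneg) auto
    ultimately have Npos: "N > 0" by simp
    define c where "c = complex_of_real (1 / sqrt N)"
    define V' where "V' = mat n (Suc k) (\<lambda>(i, j). if j < k then V $$ (i, j) else c * w $ i)"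
    have V'c: "V' \<in> carrier_mat n (Suc k)" by (simp add: V'_def)
    have orth: "(\<Sum>i<n. cnj (V $$ (i, j)) * w $ i) = 0" if j: "j < k" for j
    proof -
      have "(\<Sum>i<n. cnj (V $$ (i, j)) * w $ i) = (mat_adjoint V *\<^sub>v w) $ j"
        using j V wc by (auto simp: scalar_prod_def lessThan_atLeast0 intro!: sum.cong)
      thus ?thesis using aw j by simp
    qed
    have orth': "(\<Sum>i<n. cnj (w $ i) * V $$ (i, j)) = 0" if j: "j < k" for j
    proof -
      have "(\<Sum>i<n. cnj (w $ i) * V $$ (i, j)) = cnj (\<Sum>i<n. cnj (V $$ (i, j)) * w $ i)"
        by (simp add: mult.commute)
      thus ?thesis by (simp only: orth[OF j]) simp
    qed
    have ww: "(\<Sum>i<n. cnj (w $ i) * w $ i) = of_real N"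
      by (simp add: N_def complex_norm_square mult.commute del: of_real_power)
    have "is_isometry V'"
      unfolding is_isometry_def
    proof (rule eq_matI)
      fix a b assume "a < dim_row (1\<^sub>m (dim_col V') :: complex mat)" "b < dim_col (1\<^sub>m (dim_col V') :: complex mat)"
      hence ab: "a < Suc k" "b < Suc k" by (auto simp: V'_def)
      have eq: "(mat_adjoint V' * V') $$ (a, b) = (\<Sum>i<n. cnj (V' $$ (i, a)) * V' $$ (i, b))"
        using ab V'c by (subst mult_index_sum[of _ "Suc k" n _ "Suc k"]) (auto intro!: sum.cong)
      have "(\<Sum>i<n. cnj (V' $$ (i, a)) * V' $$ (i, b)) = (if a = b then 1 else 0)"
      proof (cases "a < k")
        case a: True
        show ?thesis
        proof (cases "b < k")
          case True
          have "(\<Sum>i<n. cnj (V' $$ (i, a)) * V' $$ (i, b)) = (\<Sum>i<n. mat_adjoint V $$ (a, i) * V $$ (i, b))"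
            using a True ab V by (auto simp: V'_def intro!: sum.cong)
          also have "\<dots> = (mat_adjoint V * V) $$ (a, b)"
            using a True V by (subst mult_index_sum[of _ k n _ k]) auto
          finally show ?thesis using a True by (simp add: VV)
        next
          case False
          have "(\<Sum>i<n. cnj (V' $$ (i, a)) * V' $$ (i, b)) = c * (\<Sum>i<n. cnj (V $$ (i, a)) * w $ i)"
            using a False ab by (auto simp: V'_def sum_distrib_left intro!: sum.cong)
          thus ?thesis using orth[OF a] a False by simp
        qed
      next
        case a: False
        show ?thesis
        proof (cases "b < k")
          case True
          have "(\<Sum>i<n. cnj (V' $$ (i, a)) * V' $$ (i, b)) = cnj c * (\<Sum>i<n. cnj (w $ i) * V $$ (i, b))"
            using a True ab by (auto simp: V'_def sum_distrib_left intro!: sum.cong)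
          thus ?thesis using orth'[OF True] a True by simp
        next
          case False
          have "(\<Sum>i<n. cnj (V' $$ (i, a)) * V' $$ (i, b)) = cnj c * c * (\<Sum>i<n. cnj (w $ i) * w $ i)"
            using a False ab by (auto simp: V'_def sum_distrib_left intro!: sum.cong)
          also have "\<dots> = of_real (1 / sqrt N * (1 / sqrt N) * N)"
            unfolding ww c_def complex_cnj_complex_of_real by (simp only: of_real_mult)
          also have "1 / sqrt N * (1 / sqrt N) * N = 1"
            using Npos by (simp add: field_simps)
          finally show ?thesis using a False ab by simp
        qed
      qed
      thus "(mat_adjoint V' * V') $$ (a, b) = (1\<^sub>m (dim_col V')) $$ (a, b)"
        using ab eq by (simp add: V'_def)
    qed (auto simp: V'_def)
    moreover have "V' *\<^sub>v x \<in> S" if x: "x \<in> carrier_vec (Suc k)" for x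
    proof -
      define x' where "x' = vec k (\<lambda>i. x $ i)"
      have "V' *\<^sub>v x = V *\<^sub>v x' + (x $ k * c) \<cdot>\<^sub>v w"
        using x V wc by (intro eq_vecI) (auto simp: V'_def x'_def scalar_prod_def intro!: sum.cong)
      moreover have "V *\<^sub>v x' \<in> S" by (intro V) (simp add: x'_def)
      ultimately show ?thesis using add smult wS by simp
    qed
    ultimately have "G (Suc k)" unfolding G_def using V'c by blast
    with k(2) show False by force
  qed
  with V show ?thesis by blast
qed

lemma mat_eq_mult_vecI:
  fixes A B :: "complex mat"
  assumes "A \<in> carrier_mat n m" "B \<in> carrier_mat n m"
    "\<And>v. v \<in> carrier_vec m \<Longrightarrow> A *\<^sub>v v = B *\<^sub>v v"
  shows "A = B"
proof (rule eq_matI)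
  fix i j assume ij: "i < dim_row B" "j < dim_col B"
  hence "(A *\<^sub>v unit_vec m j) $ i = (B *\<^sub>v unit_vec m j) $ i"
    using assms(3)[of "unit_vec m j"] by simp
  thus "A $$ (i, j) = B $$ (i, j)" using ij assms(1,2) by simp
qed (use assms in auto)

text \<open>The columns of \<open>V\<close> form an orthonormal basis of the fixed space of
  \<open>Q\<close>. The projections \<open>R = V * mat_adjoint V\<close> and \<open>Q\<close> absorb
  each other, and self-adjointness then makes them equal.\<close>

lemma projection_isometry:
  fixes Q :: "complex mat"
  assumes Q: "Q \<in> carrier_mat n n" "mat_adjoint Q = Q" "Q * Q = Q"
  obtains k V where "V \<in> carrier_mat n k" "is_isometry V" "V * mat_adjoint V = Q"
proof -
  define S where "S = {v \<in> carrier_vec n. Q *\<^sub>v v = v}"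
  have add: "v + w \<in> S" if "v \<in> S" "w \<in> S" for v w
    using that Q mult_add_distrib_mat_vec[of Q n n v w] by (auto simp: S_def)
  have smult: "c \<cdot>\<^sub>v v \<in> S" if "v \<in> S" for c v
    using that Q mult_mat_vec[of Q n n v c] by (auto simp: S_def)
  have "Q *\<^sub>v 0\<^sub>v n = 0\<^sub>v n" using Q by (intro eq_vecI) auto
  hence zero: "0\<^sub>v n \<in> S" by (auto simp: S_def)
  have SC: "S \<subseteq> carrier_vec n" by (auto simp: S_def)
  obtain k V where V: "V \<in> carrier_mat n k" "is_isometry V"
    "\<forall>v\<in>carrier_vec k. V *\<^sub>v v \<in> S" "\<forall>v\<in>S. V *\<^sub>v (mat_adjoint V *\<^sub>v v) = v"
    using subspace_isometry[of S n, OF SC zero] add smult by blast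
  define R where "R = V * mat_adjoint V"
  have Rc: "R \<in> carrier_mat n n" using V by (auto simp: R_def)
  have Ra: "mat_adjoint R = R" using V by (auto simp: R_def mat_adjoint_mult[of V n k _ n])
  have QV: "Q * V = V"
  proof (rule mat_eq_mult_vecI[of _ n k])
    fix v :: "complex vec" assume v: "v \<in> carrier_vec k"
    show "Q * V *\<^sub>v v = V *\<^sub>v v"
      using V(1,3) Q v by (subst assoc_mult_mat_vec[of Q n n V k]) (auto simp: S_def)
  qed (use V Q in auto)
  have RQ: "R * Q = Q"
  proof (rule mat_eq_mult_vecI[of _ n n])
    fix v :: "complex vec" assume v: "v \<in> carrier_vec n"
    have "Q *\<^sub>v v \<in> S" using v Q by (auto simp: S_def assoc_mult_mat_vec[of Q n n Q n v, symmetric])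
    moreover have "R * Q *\<^sub>v v = V *\<^sub>v (mat_adjoint V *\<^sub>v (Q *\<^sub>v v))"
      using v Q V Rc unfolding R_def
      by (subst assoc_mult_mat_vec[of _ n n Q n], auto)
         (subst assoc_mult_mat_vec[of V n k _ n], auto)
    ultimately show "R * Q *\<^sub>v v = Q *\<^sub>v v" using V(4) by simp
  qed (use Rc Q in auto)
  have QR: "Q * R = R" unfolding R_def
    using Q V QV assoc_mult_mat[of Q n n V k "mat_adjoint V" n] by auto
  \<comment> \<open>Adjoints turn \<open>R * Q = Q\<close> into \<open>Q * R = Q\<close>, to be
    compared with \<open>Q * R = R\<close>.\<close>
  have "Q = mat_adjoint (R * Q)" using RQ Q by simp
  also have "\<dots> = Q * R" using Q Rc Ra by (simp add: mat_adjoint_mult[of R n n Q n])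
  finally have "R = Q" using QR by simp
  with V(1,2) show ?thesis unfolding R_def by (rule that)
qed

section \<open>Reducing subspaces\<close>

text \<open>Monomials in elements of \<open>B\<close>. Letters are appended on the right, so a
  vector killed by all \<open>t * w\<close> stays so after an element of \<open>B\<close> is applied
  to it: that element is absorbed into the word.\<close>

inductive_set words :: "nat \<Rightarrow> complex mat set \<Rightarrow> complex mat set" for n B where
  one: "1\<^sub>m n \<in> words n B"
| mult: "w \<in> words n B \<Longrightarrow> b \<in> B \<Longrightarrow> w * b \<in> words n B"

lemma words_carrier:
  assumes "w \<in> words n B" "B \<subseteq> carrier_mat n n"
  shows "w \<in> carrier_mat n n"
  using assms by (induction rule: words.induct) auto

lemma words_commute:
  assumes "w \<in> words n B" "B \<subseteq> carrier_mat n n" "x \<in> carrier_mat n n"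
    "\<And>b. b \<in> B \<Longrightarrow> x * b = b * x"
  shows "x * w = w * x"
  using assms
proof (induction rule: words.induct)
  case (mult w b)
  have c: "w \<in> carrier_mat n n" "b \<in> carrier_mat n n"
    using words_carrier mult by auto
  have "x * (w * b) = (x * w) * b" using c mult.prems(2) by (simp add: mult_assoc_dim)
  also have "x * w = w * x" using mult by blast
  also have "w * x * b = w * (x * b)" using c mult.prems(2) by (simp add: mult_assoc_dim)
  also have "x * b = b * x" using mult by blast
  also have "w * (b * x) = w * b * x" using c mult.prems(2) by (simp add: mult_assoc_dim)
  finally show ?case .
qed simp

text \<open>The second summand is the largest \<open>B\<close>-invariant subspace annihilated by \<open>SB\<close>.\<close>
lemma reducing_decomposition:
  fixes A B SA SB :: "complex mat set"
  assumes carr: "A \<subseteq> carrier_mat n n" "B \<subseteq> carrier_mat n n" "SA \<subseteq> carrier_mat n n" "SB \<subseteq> carrier_mat n n"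
    and adj: "\<And>x. x \<in> A \<Longrightarrow> mat_adjoint x \<in> A" "\<And>x. x \<in> B \<Longrightarrow> mat_adjoint x \<in> B"
      "\<And>x. x \<in> SA \<Longrightarrow> mat_adjoint x \<in> SA"
    and AB: "\<And>a b. a \<in> A \<Longrightarrow> b \<in> B \<Longrightarrow> a * b = b * a"
    and SAB: "\<And>s b. s \<in> SA \<Longrightarrow> b \<in> B \<Longrightarrow> s * b = b * s"
    and SBA: "\<And>t a. t \<in> SB \<Longrightarrow> a \<in> A \<Longrightarrow> t * a = a * t"
    and SS: "\<And>s t. s \<in> SA \<Longrightarrow> t \<in> SB \<Longrightarrow> t * s = 0\<^sub>m n n"
  shows "\<exists>k l. \<exists>V1\<in>carrier_mat n k. \<exists>V2\<in>carrier_mat n l. is_isometry V1 \<and> is_isometry V2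
     \<and> V1 * mat_adjoint V1 + V2 * mat_adjoint V2 = 1\<^sub>m n
     \<and> (\<forall>x\<in>A \<union> B. V1 * mat_adjoint V1 * x = x * (V1 * mat_adjoint V1))
     \<and> (\<forall>x\<in>A \<union> B. V2 * mat_adjoint V2 * x = x * (V2 * mat_adjoint V2))
     \<and> (\<forall>s\<in>SA. s * V1 = 0\<^sub>m n k) \<and> (\<forall>t\<in>SB. t * V2 = 0\<^sub>m n l)"
proof -
  \<comment> \<open>Words over \<open>B\<close> suffice: invariance under \<open>A\<close> is
    automatic, because elements of \<open>A\<close> commute past the words and past
    \<open>SB\<close>.\<close>
  define S where "S = {v \<in> carrier_vec n. \<forall>t\<in>SB. \<forall>w\<in>words n B. (t * w) *\<^sub>v v = 0\<^sub>v n}"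
  have wc: "w \<in> carrier_mat n n" if "w \<in> words n B" for w using words_carrier that carr by blast
  have twc: "t * w \<in> carrier_mat n n" if "w \<in> words n B" "t \<in> SB" for t w
    using wc that carr by (meson mult_carrier_mat subsetD)
  have SC: "S \<subseteq> carrier_vec n" by (auto simp: S_def)
  have zero: "0\<^sub>v n \<in> S"
  proof -
    have "(t * w) *\<^sub>v 0\<^sub>v n = 0\<^sub>v n" if "w \<in> words n B" "t \<in> SB" for t w
      using carrier_matD[OF twc[OF that]]
      by (intro eq_vecI) (auto simp: scalar_prod_def simp del: index_mult_mat(2,3))
    thus ?thesis by (auto simp: S_def)
  qed
  have add: "v + v' \<in> S" if "v \<in> S" "v' \<in> S" for v v'
    using that mult_add_distrib_mat_vec[OF twc, of _ _ v v'] by (auto simp: S_def)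
  have smult: "c \<cdot>\<^sub>v v \<in> S" if "v \<in> S" for c v
    using that mult_mat_vec[OF twc, of _ _ v c] by (auto simp: S_def)
  obtain l V2 where V2: "V2 \<in> carrier_mat n l" "is_isometry V2"
    "\<forall>v\<in>carrier_vec l. V2 *\<^sub>v v \<in> S" "\<forall>v\<in>S. V2 *\<^sub>v (mat_adjoint V2 *\<^sub>v v) = v"
    using subspace_isometry[of S n, OF SC zero] add smult by blast
  define R where "R = V2 * mat_adjoint V2"
  have Rc: "R \<in> carrier_mat n n" using V2 by (auto simp: R_def)
  have Ra: "mat_adjoint R = R" using V2 by (auto simp: R_def mat_adjoint_mult[of V2 n l _ n])
  have VV: "mat_adjoint V2 * V2 = 1\<^sub>m l" using V2 by (auto simp: is_isometry_def)
  have RR: "R * R = R"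
  proof -
    have "R * R = V2 * (mat_adjoint V2 * V2) * mat_adjoint V2"
      unfolding R_def using V2(1) by (simp add: mult_assoc_dim)
    thus ?thesis using V2(1) by (simp add: VV R_def)
  qed
  have RS: "R *\<^sub>v v = v" if v: "v \<in> S" for v
  proof -
    have "R *\<^sub>v v = V2 *\<^sub>v (mat_adjoint V2 *\<^sub>v v)"
      unfolding R_def using V2(1) SC v by (intro assoc_mult_mat_vec[of _ n l _ n]) auto
    thus ?thesis using V2(4) v by simp
  qed
  have inv: "x *\<^sub>v v \<in> S" if x: "x \<in> A \<union> B" and v: "v \<in> S" for x v
  proof -
    have xc: "x \<in> carrier_mat n n" and vc: "v \<in> carrier_vec n" using x v carr SC by auto
    have "(t * w) *\<^sub>v (x *\<^sub>v v) = 0\<^sub>v n" if t: "t \<in> SB" and w: "w \<in> words n B" for t w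
    proof -
      have tc: "t \<in> carrier_mat n n" using t carr by auto
      have *: "(t * w) *\<^sub>v (x *\<^sub>v v) = (t * w * x) *\<^sub>v v"
        using twc[OF w t] xc vc by (intro assoc_mult_mat_vec[symmetric, of _ n n _ n])
      show ?thesis
      proof (cases "x \<in> B")
        case True
        have "t * w * x = t * (w * x)" using tc wc[OF w] xc by (simp add: mult_assoc_dim)
        thus ?thesis using * v t words.mult[OF w True] by (simp add: S_def)
      next
        case False
        hence xA: "x \<in> A" using x by auto
        have "t * w * x = t * (x * w)"
          using words_commute[OF w carr(2) xc] AB xA tc wc[OF w] xc by (simp add: mult_assoc_dim)
        also have "\<dots> = t * x * w" using tc wc[OF w] xc by (simp add: mult_assoc_dim)
        also have "\<dots> = x * (t * w)" unfolding SBA[OF t xA] using tc wc[OF w] xc by (simp add: mult_assoc_dim)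
        finally have "(t * w * x) *\<^sub>v v = (x * (t * w)) *\<^sub>v v" by simp
        also have "\<dots> = x *\<^sub>v ((t * w) *\<^sub>v v)"
          using twc[OF w t] xc vc by (intro assoc_mult_mat_vec[of _ n n _ n])
        also have "(t * w) *\<^sub>v v = 0\<^sub>v n" using v t w by (simp add: S_def)
        also have "x *\<^sub>v 0\<^sub>v n = 0\<^sub>v n" using xc by (intro eq_vecI) auto
        finally show ?thesis using * by simp
      qed
    qed
    thus ?thesis using xc vc by (simp add: S_def)
  qed
  \<comment> \<open>Invariance of \<open>S\<close> in terms of its projection: \<open>x\<close> maps
    the range of \<open>R\<close> into \<open>S\<close>, which \<open>R\<close> fixes.\<close>
  have RxV: "R * x * R = x * R" if x: "x \<in> A \<union> B" for x
  proof (rule mat_eq_mult_vecI[of _ n n])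
    have xc: "x \<in> carrier_mat n n" using x carr by auto
    thus "R * x * R \<in> carrier_mat n n" "x * R \<in> carrier_mat n n" using Rc by auto
    fix v :: "complex vec" assume v: "v \<in> carrier_vec n"
    have "R *\<^sub>v v = V2 *\<^sub>v (mat_adjoint V2 *\<^sub>v v)"
      unfolding R_def using V2(1) v by (intro assoc_mult_mat_vec[of _ n l _ n]) auto
    also have "mat_adjoint V2 *\<^sub>v v \<in> carrier_vec l"
      using V2(1) v by (intro mult_mat_vec_carrier[of _ l n]) auto
    hence "V2 *\<^sub>v (mat_adjoint V2 *\<^sub>v v) \<in> S" using V2(3) by blast
    finally have RvS: "R *\<^sub>v v \<in> S" .
    have "x * R *\<^sub>v v = x *\<^sub>v (R *\<^sub>v v)" using xc Rc v by (intro assoc_mult_mat_vec[of _ n n _ n])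
    moreover have "R * x * R *\<^sub>v v = R *\<^sub>v (x * R *\<^sub>v v)"
    proof -
      have "R * x * R = R * (x * R)" using xc Rc by (simp add: mult_assoc_dim)
      thus ?thesis using xc Rc v by (simp add: assoc_mult_mat_vec[of _ n n "x * R" n])
    qed
    ultimately show "R * x * R *\<^sub>v v = x * R *\<^sub>v v"
      using RS[OF inv[OF x RvS]] by simp
  qed
  \<comment> \<open>\<open>S\<close> is also invariant under \<open>mat_adjoint x\<close>; the
    adjoint of that statement is \<open>R * x * R = R * x\<close>, and together with
    \<open>RxV\<close> the invariant subspace becomes reducing.\<close>
  have comm: "R * x = x * R" if x: "x \<in> A \<union> B" for x
  proof -
    have xc: "x \<in> carrier_mat n n" using x carr by auto
    have "mat_adjoint x \<in> A \<union> B" using x adj by auto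
    from RxV[OF this] have "mat_adjoint (R * mat_adjoint x * R) = mat_adjoint (mat_adjoint x * R)" by simp
    moreover have "mat_adjoint (mat_adjoint x * R) = R * x"
      using xc Rc Ra by (subst mat_adjoint_mult[of _ n n _ n]) auto
    moreover have "mat_adjoint (R * mat_adjoint x * R) = R * (x * R)"
      using xc Rc Ra by (subst mat_adjoint_mult[of _ n n _ n], (auto)[2], subst mat_adjoint_mult[of _ n n _ n]) auto
    ultimately have "R * (x * R) = R * x" by simp
    moreover have "R * (x * R) = x * R" using RxV[OF x] xc Rc by (simp add: mult_assoc_dim)
    ultimately show ?thesis by simp
  qed
  have tV2: "t * V2 = 0\<^sub>m n l" if t: "t \<in> SB" for t
  proof (rule mat_eq_mult_vecI[of _ n l])
    have tc: "t \<in> carrier_mat n n" using t carr by auto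
    thus "t * V2 \<in> carrier_mat n l" using V2 by auto
    fix v :: "complex vec" assume v: "v \<in> carrier_vec l"
    hence "V2 *\<^sub>v v \<in> S" using V2 by auto
    hence "(t * 1\<^sub>m n) *\<^sub>v (V2 *\<^sub>v v) = 0\<^sub>v n" using t words.one unfolding S_def by blast
    hence "t * V2 *\<^sub>v v = 0\<^sub>v n"
      using tc V2(1) v by (subst assoc_mult_mat_vec[of _ n n _ l]) auto
    also have "0\<^sub>v n = 0\<^sub>m n l *\<^sub>v v" using v by (intro eq_vecI) auto
    finally show "t * V2 *\<^sub>v v = 0\<^sub>m n l *\<^sub>v v" .
  qed simp
  \<comment> \<open>The range of \<open>s\<close> lies in \<open>S\<close>: \<open>s\<close> moves
    past every word to meet \<open>t\<close>, and \<open>t * s = 0\<close>.\<close>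
  have Rs: "R * s = s" if s: "s \<in> SA" for s
  proof (rule mat_eq_mult_vecI[of _ n n])
    have sc: "s \<in> carrier_mat n n" using s carr by auto
    thus "R * s \<in> carrier_mat n n" "s \<in> carrier_mat n n" using Rc by auto
    fix v :: "complex vec" assume v: "v \<in> carrier_vec n"
    have "(t * w) *\<^sub>v (s *\<^sub>v v) = 0\<^sub>v n" if t: "t \<in> SB" and w: "w \<in> words n B" for t w
    proof -
      have tc: "t \<in> carrier_mat n n" using t carr by auto
      have "(t * w) *\<^sub>v (s *\<^sub>v v) = (t * w * s) *\<^sub>v v"
        using twc[OF w t] sc v by (intro assoc_mult_mat_vec[symmetric, of _ n n _ n])
      also have "t * w * s = t * (s * w)"
        using words_commute[OF w carr(2) sc] SAB s tc wc[OF w] sc by (simp add: mult_assoc_dim)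
      also have "\<dots> = t * s * w" using tc wc[OF w] sc by (simp add: mult_assoc_dim)
      also have "\<dots> = 0\<^sub>m n n" using SS[OF s t] wc[OF w] by simp
      also have "0\<^sub>m n n *\<^sub>v v = 0\<^sub>v n" using v by (intro eq_vecI) auto
      finally show ?thesis .
    qed
    hence "s *\<^sub>v v \<in> S" using sc v by (simp add: S_def)
    from RS[OF this] show "R * s *\<^sub>v v = s *\<^sub>v v"
      using Rc sc v by (simp add: assoc_mult_mat_vec[of _ n n _ n])
  qed
  \<comment> \<open>Applying \<open>Rs\<close> to \<open>mat_adjoint s\<close> and taking adjoints
    shows that \<open>s\<close> vanishes on the orthogonal complement of \<open>S\<close>.\<close>
  have sR: "s * R = s" if s: "s \<in> SA" for s
  proof -
    have sc: "s \<in> carrier_mat n n" using s carr by auto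
    have "mat_adjoint (R * mat_adjoint s) = mat_adjoint (mat_adjoint s)"
      using Rs[OF adj(3)[OF s]] by simp
    thus ?thesis using sc Rc Ra by (simp add: mat_adjoint_mult[of _ n n _ n])
  qed
  define R' where "R' = 1\<^sub>m n - R"
  have R'c: "R' \<in> carrier_mat n n" using Rc by (auto simp: R'_def minus_carrier_mat)
  have "mat_adjoint R' = R'"
  proof (rule eq_matI)
    fix i j assume "i < dim_row R'" "j < dim_col R'"
    hence ij: "i < n" "j < n" using R'c by auto
    have "mat_adjoint R $$ (i, j) = R $$ (i, j)" using Ra by simp
    thus "mat_adjoint R' $$ (i, j) = R' $$ (i, j)"
      using ij Rc by (auto simp: R'_def)
  qed (use R'c in auto)
  moreover have "R' * R' = R'"
  proof -
    have "R' * R' = 1\<^sub>m n * R' - R * R'"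
      unfolding R'_def using Rc by (intro minus_mult_distrib_mat) (auto intro: minus_carrier_mat)
    also have "R * R' = R * 1\<^sub>m n - R * R"
      unfolding R'_def using Rc by (intro mult_minus_distrib_mat) auto
    also have "\<dots> = 0\<^sub>m n n" using Rc RR by simp
    finally show ?thesis using R'c by (intro eq_matI) auto
  qed
  ultimately obtain k V1 where V1: "V1 \<in> carrier_mat n k" "is_isometry V1" "V1 * mat_adjoint V1 = R'"
    using projection_isometry[of R' n] R'c by blast
  have V1V1: "mat_adjoint V1 * V1 = 1\<^sub>m k" using V1 by (auto simp: is_isometry_def)
  have "R' + R = 1\<^sub>m n" using Rc by (intro eq_matI) (auto simp: R'_def)
  moreover have "R' * x = x * R'" if x: "x \<in> A \<union> B" for x
  proof -
    have xc: "x \<in> carrier_mat n n" using x carr by auto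
    have "R' * x = 1\<^sub>m n * x - R * x"
      unfolding R'_def using Rc xc by (intro minus_mult_distrib_mat) auto
    moreover have "x * R' = x * 1\<^sub>m n - x * R"
      unfolding R'_def using Rc xc by (intro mult_minus_distrib_mat) auto
    ultimately show ?thesis using comm[OF x] xc by simp
  qed
  moreover have "s * V1 = 0\<^sub>m n k" if s: "s \<in> SA" for s
  proof -
    have sc: "s \<in> carrier_mat n n" using s carr by auto
    have "s * R' = s * 1\<^sub>m n - s * R"
      unfolding R'_def using Rc sc by (intro mult_minus_distrib_mat) auto
    also have "\<dots> = 0\<^sub>m n n" using sR[OF s] sc by simp
    finally have "s * R' = 0\<^sub>m n n" .
    moreover have "s * V1 = s * R' * V1"
      using V1(1) sc V1V1 unfolding V1(3)[symmetric] by (simp add: mult_assoc_dim)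
    ultimately show ?thesis using V1 by simp
  qed
  ultimately show ?thesis
    using V1 V2(1,2) comm tV2
    by (intro exI[of _ k] exI[of _ l] bexI[of _ V1] bexI[of _ V2]) (auto simp: R_def[symmetric])
qed

section \<open>Kronecker products and index tuples\<close>

lemma sum_lessThan_mult:
  fixes g :: "nat \<Rightarrow> 'a :: comm_monoid_add"
  shows "(\<Sum>i<m * n. g i) = (\<Sum>a<m. \<Sum>b<n. g (a * n + b))"
proof -
  have "(\<Sum>i<m * n. g i) = (\<Sum>a<m. sum g {a * n..<a * n + n})"
    by (rule sum.nat_group[symmetric])
  also have "\<dots> = (\<Sum>a<m. \<Sum>b<n. g (a * n + b))"
  proof (rule sum.cong)
    show "sum g {a * n..<a * n + n} = (\<Sum>b<n. g (a * n + b))" for a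
      by (rule sum.reindex_bij_witness[of _ "\<lambda>b. a * n + b" "\<lambda>i. i - a * n"]) auto
  qed simp
  finally show ?thesis .
qed

lemma index_less_mult:
  fixes a b m n :: nat
  assumes "a < m" "b < n"
  shows "a * n + b < m * n"
proof -
  have "a * n + b < Suc a * n" using assms by simp
  also have "\<dots> \<le> m * n" using assms by (intro mult_right_mono) auto
  finally show ?thesis .
qed

lemma index_eq_iff:
  fixes a b m n :: nat
  assumes "b < n" "d < n"
  shows "a * n + b = c * n + d \<longleftrightarrow> a = c \<and> b = d"
proof
  assume eq: "a * n + b = c * n + d"
  have "(a * n + b) div n = (c * n + d) div n" "(a * n + b) mod n = (c * n + d) mod n" using eq by auto
  thus "a = c \<and> b = d" using assms by simp
qed auto

lemma dim_kron [simp]: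
  "dim_row (kron A B) = dim_row A * dim_row B" "dim_col (kron A B) = dim_col A * dim_col B"
  by (auto simp: kron_def)

lemma kron_carrier [simp, intro]:
  "A \<in> carrier_mat n m \<Longrightarrow> B \<in> carrier_mat n' m' \<Longrightarrow> kron A B \<in> carrier_mat (n * n') (m * m')"
  by (intro carrier_matI) auto

lemma kron_index:
  assumes "A \<in> carrier_mat n m" "B \<in> carrier_mat n' m'" "i < n" "j < m" "k < n'" "l < m'"
  shows "kron A B $$ (i * n' + k, j * m' + l) = A $$ (i, j) * B $$ (k, l)"
  using assms index_less_mult[of i n k n'] index_less_mult[of j m l m'] by (auto simp: kron_def)

lemma mat_eq_blockI:
  assumes "A \<in> carrier_mat (n * n') (m * m')" "B \<in> carrier_mat (n * n') (m * m')"
    "\<And>i j k l. i < n \<Longrightarrow> k < n' \<Longrightarrow> j < m \<Longrightarrow> l < m' \<Longrightarrow> A $$ (i * n' + k, j * m' + l) = B $$ (i * n' + k, j * m' + l)"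
  shows "A = B"
proof (rule eq_matI)
  fix x y assume "x < dim_row B" "y < dim_col B"
  hence xy: "x < n * n'" "y < m * m'" using assms by auto
  hence "n' > 0" "m' > 0" by (auto intro!: Nat.gr0I)
  hence "A $$ (x div n' * n' + x mod n', y div m' * m' + y mod m') = B $$ (x div n' * n' + x mod n', y div m' * m' + y mod m')"
    using xy by (intro assms(3)) (auto simp: less_mult_imp_div_less)
  thus "A $$ (x, y) = B $$ (x, y)" by simp
qed (use assms in auto)

lemma kron_one [simp]: "kron (1\<^sub>m n) (1\<^sub>m m) = 1\<^sub>m (n * m)"
proof (rule mat_eq_blockI[of _ n m n m])
  fix i j k l assume a: "i < n" "k < m" "j < n" "l < m"
  show "kron (1\<^sub>m n) (1\<^sub>m m) $$ (i * m + k, j * m + l) = 1\<^sub>m (n * m) $$ (i * m + k, j * m + l)"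
    using a index_less_mult[of i n k m] index_less_mult[of j n l m] index_eq_iff[of k m l i j]
    by (subst kron_index[of _ n n _ m m]) auto
qed auto

lemma kron_mult:
  assumes "A \<in> carrier_mat n m" "B \<in> carrier_mat n' m'" "C \<in> carrier_mat m l" "D \<in> carrier_mat m' l'"
  shows "kron A B * kron C D = kron (A * C) (B * D)"
proof (rule mat_eq_blockI[of _ n n' l l'])
  fix i j k r assume a: "i < n" "k < n'" "j < l" "r < l'"
  have "(kron A B * kron C D) $$ (i * n' + k, j * l' + r) =
      (\<Sum>x<m. \<Sum>y<m'. kron A B $$ (i * n' + k, x * m' + y) * kron C D $$ (x * m' + y, j * l' + r))"
    unfolding sum_lessThan_mult[symmetric, where g = "\<lambda>z. kron A B $$ (i * n' + k, z) * kron C D $$ (z, j * l' + r)"]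
    using a assms index_less_mult by (intro mult_index_sum[of _ "n * n'" "m * m'" _ "l * l'"]) auto
  also have "\<dots> = (\<Sum>x<m. \<Sum>y<m'. (A $$ (i, x) * C $$ (x, j)) * (B $$ (k, y) * D $$ (y, r)))"
    using a assms by (intro sum.cong refl) (auto simp: kron_index[of _ n m _ n' m'] kron_index[of _ m l _ m' l'])
  also have "\<dots> = (A * C) $$ (i, j) * (B * D) $$ (k, r)"
    using a by (simp only: mult_index_sum[OF assms(1,3)] mult_index_sum[OF assms(2,4)] sum_product)
  also have "\<dots> = kron (A * C) (B * D) $$ (i * n' + k, j * l' + r)"
    using a assms by (subst kron_index[of _ n l _ n' l']) auto
  finally show "(kron A B * kron C D) $$ (i * n' + k, j * l' + r) = kron (A * C) (B * D) $$ (i * n' + k, j * l' + r)" .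
qed (use assms in auto)

lemma kron_adjoint:
  assumes "A \<in> carrier_mat n m" "B \<in> carrier_mat n' m'"
  shows "mat_adjoint (kron A B) = kron (mat_adjoint A) (mat_adjoint B)"
proof (rule mat_eq_blockI[of _ m m' n n'])
  fix i j k l assume a: "i < m" "k < m'" "j < n" "l < n'"
  show "mat_adjoint (kron A B) $$ (i * m' + k, j * n' + l) = kron (mat_adjoint A) (mat_adjoint B) $$ (i * m' + k, j * n' + l)"
    using a assms index_less_mult[of i m k m'] index_less_mult[of j n l n']
    by (subst kron_index[of _ m n _ m' n']) (auto simp: kron_index[of A n m B n' m'])
qed (use assms in auto)

text \<open>The accumulator is generalised for the induction. It acts as one more leading digit,
  which lets \<open>enc\<close> be unfolded from the most significant end, as \<open>dec\<close>
  is.\<close>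

lemma enc_foldl:
  assumes "length xs = length ds"
  shows "foldl (\<lambda>acc (d, x). acc * d + x) z (zip ds xs) = z * prod_list ds + enc ds xs"
  using assms unfolding enc_def
proof (induction ds arbitrary: xs z)
  case (Cons d ds)
  then obtain x ys where xs: "xs = x # ys" "length ys = length ds" by (cases xs) auto
  show ?case
    using Cons.IH[OF xs(2), of "z * d + x"] Cons.IH[OF xs(2), of x] by (simp add: xs algebra_simps)
qed simp

lemma enc_Cons:
  assumes "length xs = length ds"
  shows "enc (d # ds) (x # xs) = x * prod_list ds + enc ds xs"
  using enc_foldl[OF assms, of x] by (simp add: enc_def)

lemma enc_less_dec_enc:
  assumes "list_all2 (<) xs ds"
  shows "enc ds xs < prod_list ds \<and> dec ds (enc ds xs) = xs"
  using assms
proof (induction rule: list_all2_induct)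
  case (Cons x xs d ds)
  have "length xs = length ds" using Cons.hyps(2) by (rule list_all2_lengthD)
  moreover have "prod_list ds \<noteq> 0" using Cons.IH by linarith
  ultimately show ?case
    using Cons index_less_mult[of x d "enc ds xs" "prod_list ds"] by (simp add: enc_Cons)
qed (simp add: enc_def)

lemma dec_less_enc_dec:
  assumes "r < prod_list ds"
  shows "list_all2 (<) (dec ds r) ds \<and> enc ds (dec ds r) = r"
  using assms
proof (induction ds arbitrary: r)
  case (Cons d ds)
  have pos: "prod_list ds > 0" using Cons.prems by (auto intro!: Nat.gr0I)
  have IH: "list_all2 (<) (dec ds (r mod prod_list ds)) ds" "enc ds (dec ds (r mod prod_list ds)) = r mod prod_list ds"
    using Cons.IH[of "r mod prod_list ds"] pos by auto
  have "length (dec ds (r mod prod_list ds)) = length ds" using IH(1) by (rule list_all2_lengthD)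
  thus ?case using IH Cons.prems by (simp add: enc_Cons less_mult_imp_div_less)
qed (simp add: enc_def)

section \<open>Measure-and-prepare channels\<close>

lemma quadratic_form_sum:
  fixes M :: "complex mat"
  assumes "M \<in> carrier_mat n n" "v \<in> carrier_vec n"
  shows "conjugate v \<bullet> (M *\<^sub>v v) = (\<Sum>i<n. \<Sum>j<n. cnj (v $ i) * M $$ (i, j) * v $ j)"
  using assms by (auto simp: scalar_prod_def lessThan_atLeast0 sum_distrib_left mult.assoc intro!: sum.cong)

lemma psd_sum:
  assumes "\<And>k. k < r \<Longrightarrow> psd n (Y k)" "Z \<in> carrier_mat n n"
    "\<And>i j. i < n \<Longrightarrow> j < n \<Longrightarrow> Z $$ (i, j) = (\<Sum>k<r. Y k $$ (i, j))"
  shows "psd n Z"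
  unfolding psd_def
proof (intro conjI ballI)
  fix v :: "complex vec" assume v: "v \<in> carrier_vec n"
  have "conjugate v \<bullet> (Z *\<^sub>v v) = (\<Sum>i<n. \<Sum>j<n. \<Sum>k<r. cnj (v $ i) * Y k $$ (i, j) * v $ j)"
    using assms(2,3) v by (simp add: quadratic_form_sum[of _ n] sum_distrib_left sum_distrib_right)
  also have "\<dots> = (\<Sum>i<n. \<Sum>k<r. \<Sum>j<n. cnj (v $ i) * Y k $$ (i, j) * v $ j)"
    by (intro sum.cong refl sum.swap)
  also have "\<dots> = (\<Sum>k<r. \<Sum>i<n. \<Sum>j<n. cnj (v $ i) * Y k $$ (i, j) * v $ j)"
    by (rule sum.swap)
  also have "\<dots> = (\<Sum>k<r. conjugate v \<bullet> (Y k *\<^sub>v v))"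
    using assms(1) v by (intro sum.cong refl) (auto simp: quadratic_form_sum[of _ n] psd_def)
  finally have eq: "conjugate v \<bullet> (Z *\<^sub>v v) = (\<Sum>k<r. conjugate v \<bullet> (Y k *\<^sub>v v))" .
  show "Im (conjugate v \<bullet> (Z *\<^sub>v v)) = 0" "0 \<le> Re (conjugate v \<bullet> (Z *\<^sub>v v))"
    unfolding eq using assms(1) v by (auto simp: psd_def intro!: sum_nonneg)
qed fact

lemma psd_congruence:
  assumes X: "psd n X" and L: "L \<in> carrier_mat m n"
  shows "psd m (L * X * mat_adjoint L)"
  unfolding psd_def
proof (intro conjI ballI)
  have Xc: "X \<in> carrier_mat n n" using X by (simp add: psd_def)
  thus c: "L * X * mat_adjoint L \<in> carrier_mat m m" using L by auto
  fix v :: "complex vec" assume v: "v \<in> carrier_vec m"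
  define w where "w = mat_adjoint L *\<^sub>v v"
  have wc: "w \<in> carrier_vec n" unfolding w_def using L v by (intro mult_mat_vec_carrier[of _ n m]) auto
  define y where "y = X *\<^sub>v w"
  have Xw: "y \<in> carrier_vec n" unfolding y_def using Xc wc by (intro mult_mat_vec_carrier[of _ n n])
  have "L * X * mat_adjoint L *\<^sub>v v = L * X *\<^sub>v w"
    unfolding w_def using L Xc v by (intro assoc_mult_mat_vec[of _ m n _ m]) auto
  also have "\<dots> = L *\<^sub>v y" unfolding y_def using L Xc wc by (intro assoc_mult_mat_vec[of _ m n _ n]) auto
  finally have 1: "L * X * mat_adjoint L *\<^sub>v v = L *\<^sub>v y" .
  have "conjugate v \<bullet> (L *\<^sub>v y) = (\<Sum>i<m. \<Sum>j<n. cnj (v $ i) * (L $$ (i, j) * y $ j))"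
    using v L Xw by (auto simp: scalar_prod_def lessThan_atLeast0 sum_distrib_left intro!: sum.cong)
  also have "\<dots> = (\<Sum>j<n. \<Sum>i<m. cnj (v $ i) * (L $$ (i, j) * y $ j))" by (rule sum.swap)
  also have "\<dots> = (\<Sum>j<n. cnj (w $ j) * y $ j)"
    unfolding w_def using v L
    by (intro sum.cong refl)
       (auto simp: scalar_prod_def lessThan_atLeast0 sum_distrib_right sum_distrib_left ac_simps intro!: sum.cong)
  also have "\<dots> = conjugate w \<bullet> y"
    using wc Xw by (auto simp: scalar_prod_def lessThan_atLeast0 intro!: sum.cong)
  finally have 2: "conjugate v \<bullet> (L * X * mat_adjoint L *\<^sub>v v) = conjugate w \<bullet> (X *\<^sub>v w)" using 1 by (simp add: y_def)
  show "Im (conjugate v \<bullet> (L * X * mat_adjoint L *\<^sub>v v)) = 0"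
    "0 \<le> Re (conjugate v \<bullet> (L * X * mat_adjoint L *\<^sub>v v))"
    unfolding 2 using X wc by (auto simp: psd_def)
qed

lemma psd_rank_one:
  "psd n (mat n n (\<lambda>(i, j). g i * cnj (g j)))"
  unfolding psd_def
proof (intro conjI ballI)
  fix v :: "complex vec" assume v: "v \<in> carrier_vec n"
  define z where "z = (\<Sum>i<n. cnj (v $ i) * g i)"
  have "conjugate v \<bullet> (mat n n (\<lambda>(i, j). g i * cnj (g j)) *\<^sub>v v)
      = (\<Sum>i<n. \<Sum>j<n. (cnj (v $ i) * g i) * (v $ j * cnj (g j)))"
    using v by (subst quadratic_form_sum[of _ n]) (auto simp: ac_simps intro!: sum.cong)
  also have "\<dots> = z * cnj z" by (simp add: z_def sum_product)
  also have "\<dots> = of_real ((cmod z)\<^sup>2)" by (simp only: complex_norm_square)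
  finally have eq: "conjugate v \<bullet> (mat n n (\<lambda>(i, j). g i * cnj (g j)) *\<^sub>v v) = of_real ((cmod z)\<^sup>2)" .
  show "Im (conjugate v \<bullet> (mat n n (\<lambda>(i, j). g i * cnj (g j)) *\<^sub>v v)) = 0"
    "0 \<le> Re (conjugate v \<bullet> (mat n n (\<lambda>(i, j). g i * cnj (g j)) *\<^sub>v v))"
    unfolding eq by simp_all
qed simp

text \<open>In Kraus form the amplified map is a sum of congruences by
  \<open>kron (1\<^sub>m d) (Km k)\<close>, and both congruences and sums preserve positivity. Trace
  preservation only needs the partial trace of the Choi operator over the output, given by
  \<open>tp\<close>.\<close>

lemma kraus_CPTP:
  assumes C: "C \<in> carrier_mat (n * m) (n * m)"
    and kraus: "\<And>i q i' q'. i < n \<Longrightarrow> q < m \<Longrightarrow> i' < n \<Longrightarrow> q' < m \<Longrightarrow>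
        C $$ (i * m + q, i' * m + q') = (\<Sum>k<r. K k q i * cnj (K k q' i'))"
    and tp: "\<And>i i'. i < n \<Longrightarrow> i' < n \<Longrightarrow> (\<Sum>q<m. C $$ (i * m + q, i' * m + q)) = (if i = i' then 1 else 0)"
  shows "is_CPTP_choi n m C"
  unfolding is_CPTP_choi_def
proof (intro conjI allI impI ballI)
  fix d X assume X: "psd (d * n) X"
  have Xc: "X \<in> carrier_mat (d * n) (d * n)" using X by (simp add: psd_def)
  define Km where "Km k = mat m n (\<lambda>(q, i). K k q i)" for k
  define L where "L k = kron (1\<^sub>m d) (Km k)" for k
  have Kc: "Km k \<in> carrier_mat m n" for k by (simp add: Km_def)
  have Lc: "L k \<in> carrier_mat (d * m) (d * n)" for k unfolding L_def using Kc by auto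
  \<comment> \<open>\<open>L k\<close> is block diagonal in the ancilla, so only the block
    \<open>s\<close> survives. The function \<open>g\<close> is left open because the formula is
    used on the left factor and, after conjugation, on the adjoint factor.\<close>
  have Lsum: "(\<Sum>z<d * n. L k $$ (s * m + q, z) * g z) = (\<Sum>i<n. K k q i * g (s * n + i))"
    if "s < d" "q < m" for k s q g
  proof -
    have "(\<Sum>z<d * n. L k $$ (s * m + q, z) * g z)
        = (\<Sum>s'<d. \<Sum>i<n. if s = s' then K k q i * g (s' * n + i) else 0)"
      unfolding sum_lessThan_mult L_def using that
      by (intro sum.cong refl, subst kron_index[OF one_carrier_mat Kc]) (auto simp: Km_def)
    also have "\<dots> = (\<Sum>s'<d. if s = s' then (\<Sum>i<n. K k q i * g (s' * n + i)) else 0)"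
      by (intro sum.cong refl) auto
    finally show ?thesis using that by (simp add: sum.delta)
  qed
  show "psd (d * m) (ampl_map_of_choi d n m C X)"
  proof (rule psd_sum)
    show "psd (d * m) (L k * X * mat_adjoint (L k))" for k
      using X Lc by (rule psd_congruence)
    show "ampl_map_of_choi d n m C X \<in> carrier_mat (d * m) (d * m)" by (simp add: ampl_map_of_choi_def)
    fix x y assume xy: "x < d * m" "y < d * m"
    hence m: "m > 0" by (auto intro!: Nat.gr0I)
    define s q s' q' where "s = x div m" and "q = x mod m" and "s' = y div m" and "q' = y mod m"
    have b: "s < d" "q < m" "s' < d" "q' < m" using xy m by (auto simp: s_def q_def s'_def q'_def less_mult_imp_div_less)
    have x: "x = s * m + q" and y: "y = s' * m + q'" by (auto simp: s_def q_def s'_def q'_def)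
    have "ampl_map_of_choi d n m C X $$ (x, y) = (\<Sum>i<n. \<Sum>i'<n. X $$ (s * n + i, s' * n + i') * (\<Sum>k<r. K k q i * cnj (K k q' i')))"
      unfolding ampl_map_of_choi_def using xy b by (simp add: kraus flip: s_def q_def s'_def q'_def)
    also have "\<dots> = (\<Sum>i<n. \<Sum>k<r. \<Sum>i'<n. X $$ (s * n + i, s' * n + i') * (K k q i * cnj (K k q' i')))"
      unfolding sum_distrib_left by (intro sum.cong refl sum.swap)
    also have "\<dots> = (\<Sum>k<r. \<Sum>i<n. \<Sum>i'<n. X $$ (s * n + i, s' * n + i') * (K k q i * cnj (K k q' i')))"
      by (rule sum.swap)
    also have "\<dots> = (\<Sum>k<r. (L k * X * mat_adjoint (L k)) $$ (x, y))"
    proof (intro sum.cong refl)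
      fix k
      have "(L k * X * mat_adjoint (L k)) $$ (x, y) = (L k * (X * mat_adjoint (L k))) $$ (x, y)"
        using Lc[of k] Xc by (simp add: mult_assoc_dim)
      also have "\<dots> = (\<Sum>z<d * n. L k $$ (x, z) * (X * mat_adjoint (L k)) $$ (z, y))"
        using Lc[of k] Xc xy by (intro mult_index_sum[of _ "d * m" "d * n" _ "d * m"]) auto
      also have "\<dots> = (\<Sum>i<n. K k q i * (X * mat_adjoint (L k)) $$ (s * n + i, y))"
        unfolding x by (rule Lsum[OF b(1,2)])
      also have "\<dots> = (\<Sum>i<n. K k q i * (\<Sum>i'<n. cnj (K k q' i') * X $$ (s * n + i, s' * n + i')))"
      proof (intro sum.cong refl, goal_cases)
        case (1 i)
        hence i: "s * n + i < d * n" using b index_less_mult by auto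
        have "(X * mat_adjoint (L k)) $$ (s * n + i, y) = (\<Sum>z<d * n. X $$ (s * n + i, z) * mat_adjoint (L k) $$ (z, y))"
          using Lc[of k] Xc xy i by (intro mult_index_sum[of _ "d * n" "d * n" _ "d * m"]) auto
        also have "\<dots> = (\<Sum>z<d * n. cnj (L k $$ (s' * m + q', z) * cnj (X $$ (s * n + i, z))))"
          using carrier_matD[OF Lc[of k]] xy by (intro sum.cong refl) (auto simp: y[symmetric])
        also have "\<dots> = cnj (\<Sum>z<d * n. L k $$ (s' * m + q', z) * cnj (X $$ (s * n + i, z)))" by simp
        also have "\<dots> = (\<Sum>i'<n. cnj (K k q' i') * X $$ (s * n + i, s' * n + i'))"
          using Lsum b by simp
        finally show ?case by simp
      qed
      finally show "(\<Sum>i<n. \<Sum>i'<n. X $$ (s * n + i, s' * n + i') * (K k q i * cnj (K k q' i')))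
          = (L k * X * mat_adjoint (L k)) $$ (x, y)"
        by (simp add: sum_distrib_left ac_simps)
    qed
    finally show "ampl_map_of_choi d n m C X $$ (x, y) = (\<Sum>k<r. (L k * X * mat_adjoint (L k)) $$ (x, y))" .
  qed
next
  fix X :: "complex mat" assume X: "X \<in> carrier_mat n n"
  have "mtrace (map_of_choi n m C X) = (\<Sum>q<m. \<Sum>i<n. \<Sum>i'<n. X $$ (i, i') * C $$ (i * m + q, i' * m + q))"
    by (simp add: mtrace_def map_of_choi_def)
  also have "\<dots> = (\<Sum>i<n. \<Sum>q<m. \<Sum>i'<n. X $$ (i, i') * C $$ (i * m + q, i' * m + q))" by (rule sum.swap)
  also have "\<dots> = (\<Sum>i<n. \<Sum>i'<n. \<Sum>q<m. X $$ (i, i') * C $$ (i * m + q, i' * m + q))"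
    by (intro sum.cong refl sum.swap)
  also have "\<dots> = (\<Sum>i<n. \<Sum>i'<n. if i = i' then X $$ (i, i') else 0)"
    using tp by (intro sum.cong refl) (auto simp flip: sum_distrib_left)
  also have "\<dots> = mtrace X" using X by (simp add: mtrace_def)
  finally show "mtrace (map_of_choi n m C X) = mtrace X" .
qed fact

text \<open>In Dirac notation this is \<open>|x><x|\<close> tensor \<open>(|u><u| - |0><0|)\<close>
  plus the identity tensor \<open>|0><0|\<close>, a shape in which the dependence on
  \<open>x\<close> and \<open>u\<close> sits in a single quadratic term.\<close>

definition measure_prepare :: "nat \<Rightarrow> nat \<Rightarrow> (nat \<Rightarrow> complex) \<Rightarrow> (nat \<Rightarrow> complex) \<Rightarrow> complex mat" where
  "measure_prepare n m x u = mat (n * m) (n * m) (\<lambda>(r, c).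
     x (r div m) * cnj (x (c div m)) * (u (r mod m) * cnj (u (c mod m)) - (if r mod m = 0 \<and> c mod m = 0 then 1 else 0))
     + (if r div m = c div m \<and> r mod m = 0 \<and> c mod m = 0 then 1 else 0))"

lemma measure_prepare_index:
  assumes "i < n" "i' < n" "q < m" "q' < m"
  shows "measure_prepare n m x u $$ (i * m + q, i' * m + q') =
    x i * cnj (x i') * (u q * cnj (u q') - (if q = 0 \<and> q' = 0 then 1 else 0))
    + (if i = i' \<and> q = 0 \<and> q' = 0 then 1 else 0)"
  using assms index_less_mult[of i n q m] index_less_mult[of i' n q' m] by (simp add: measure_prepare_def)

text \<open>The channel measures the projector onto the conjugate of \<open>x\<close> and prepares \<open>u\<close> on success,
  the basis state 0 otherwise.\<close>
lemma measure_prepare_CPTP: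
  assumes m: "m > 0" and x: "(\<Sum>i<n. x i * cnj (x i)) = 1" and u: "(\<Sum>q<m. u q * cnj (u q)) = 1"
  shows "is_CPTP_choi n m (measure_prepare n m x u)"
proof (rule kraus_CPTP)
  show "measure_prepare n m x u \<in> carrier_mat (n * m) (n * m)" by (simp add: measure_prepare_def)
  fix i i' assume i: "i < n" "i' < n"
  have "(\<Sum>q<m. measure_prepare n m x u $$ (i * m + q, i' * m + q)) =
      (\<Sum>q<m. x i * cnj (x i') * (u q * cnj (u q)) - (if q = 0 then x i * cnj (x i') else 0) + (if q = 0 then (if i = i' then 1 else 0) else 0))"
    using i by (intro sum.cong refl, subst measure_prepare_index) (auto simp: algebra_simps)
  also have "\<dots> = (if i = i' then 1 else 0)"
    using m u by (simp add: sum.distrib sum_subtractf flip: sum_distrib_left)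
  finally show "(\<Sum>q<m. measure_prepare n m x u $$ (i * m + q, i' * m + q)) = (if i = i' then 1 else 0)" .
next
  \<comment> \<open>With \<open>y\<close> the conjugate of \<open>x\<close>, these are the Kraus
    operators \<open>|0><k| (1 - |y><y|)\<close> for \<open>k < n\<close> and \<open>|u><y|\<close>
    for \<open>k = n\<close>; hence \<open>Suc n\<close> of them.\<close>
  define K where "K k q i = (if k < n then (if q = 0 then (if k = i then 1 else 0) - cnj (x k) * x i else 0)
      else x i * u q)" for k q i :: nat
  fix i q i' q' assume b: "i < n" "q < m" "i' < n" "q' < m"
  have "(\<Sum>k<n. ((if k = i then 1 else 0) - cnj (x k) * x i) * ((if k = i' then 1 else 0) - x k * cnj (x i')))
      = (\<Sum>k<n. (if k = i then (if i = i' then 1 else 0) else 0) - (if k = i then x k * cnj (x i') else 0)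
          - (if k = i' then cnj (x k) * x i else 0) + (x k * cnj (x k)) * (x i * cnj (x i')))"
    by (intro sum.cong refl) (auto simp: algebra_simps)
  also have "\<dots> = (if i = i' then 1 else 0) - x i * cnj (x i')"
    using b x by (simp add: sum.distrib sum_subtractf flip: sum_distrib_right)
  finally have "(\<Sum>k<n. K k q i * cnj (K k q' i')) = (if q = 0 \<and> q' = 0 then (if i = i' then 1 else 0) - x i * cnj (x i') else 0)"
    by (auto simp: K_def if_distrib[of cnj] cong: if_cong)
  hence "(\<Sum>k<Suc n. K k q i * cnj (K k q' i')) = (if q = 0 \<and> q' = 0 then (if i = i' then 1 else 0) - x i * cnj (x i') else 0)
      + x i * u q * (cnj (x i') * cnj (u q'))"
    by (simp add: K_def)
  thus "measure_prepare n m x u $$ (i * m + q, i' * m + q') = (\<Sum>k<Suc n. K k q i * cnj (K k q' i'))"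
    using b by (subst measure_prepare_index) (auto simp: algebra_simps)
qed

section \<open>Functionals that are constant on channels\<close>

lemma polarization:
  fixes h :: "nat \<Rightarrow> nat \<Rightarrow> complex"
  assumes zero: "\<And>u. (\<Sum>i<n. u i * cnj (u i)) = 1 \<Longrightarrow> (\<Sum>i<n. \<Sum>j<n. u i * cnj (u j) * h i j) = 0"
    and ij: "i < n" "j < n"
  shows "h i j = 0"
proof -
  \<comment> \<open>The form is homogeneous, so rescaling removes the restriction to unit vectors;
    only the zero vector needs a separate case.\<close>
  have gen: "(\<Sum>i<n. \<Sum>j<n. u i * cnj (u j) * h i j) = 0" for u
  proof -
    define N where "N = (\<Sum>i<n. (cmod (u i))\<^sup>2)"
    show ?thesis
    proof (cases "N = 0")
      case True
      hence "\<forall>i<n. u i = 0" unfolding N_def by (subst (asm) sum_nonneg_eq_0_iff) auto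
      thus ?thesis by simp
    next
      case False
      moreover have "N \<ge> 0" by (auto simp: N_def intro!: sum_nonneg)
      ultimately have N: "N > 0" by simp
      define c where "c = complex_of_real (1 / sqrt N)"
      have cc: "c * cnj c = of_real (1 / N)"
      proof -
        have "c * cnj c = of_real (1 / sqrt N * (1 / sqrt N))"
          unfolding c_def complex_cnj_complex_of_real by (simp only: of_real_mult)
        also have "1 / sqrt N * (1 / sqrt N) = 1 / N" using N by simp
        finally show ?thesis .
      qed
      have "(\<Sum>i<n. (c * u i) * cnj (c * u i)) = c * cnj c * (\<Sum>i<n. u i * cnj (u i))"
        by (simp add: sum_distrib_left ac_simps)
      also have "(\<Sum>i<n. u i * cnj (u i)) = of_real N"
        by (simp add: N_def complex_norm_square del: of_real_power)
      also have "c * cnj c * of_real N = 1" using N unfolding cc by (simp flip: of_real_mult)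
      finally have "(\<Sum>i<n. \<Sum>j<n. (c * u i) * cnj (c * u j) * h i j) = 0" by (rule zero)
      also have "(\<Sum>i<n. \<Sum>j<n. (c * u i) * cnj (c * u j) * h i j)
          = c * cnj c * (\<Sum>i<n. \<Sum>j<n. u i * cnj (u j) * h i j)"
        by (simp add: sum_distrib_left ac_simps)
      finally show ?thesis unfolding cc using N by simp
    qed
  qed
  have expand: "\<alpha> * cnj \<alpha> * h i i + \<alpha> * cnj \<beta> * h i j + \<beta> * cnj \<alpha> * h j i + \<beta> * cnj \<beta> * h j j = 0" for \<alpha> \<beta>
  proof -
    define u where "u k = (if k = i then \<alpha> else 0) + (if k = j then \<beta> else 0)" for k
    have d: "(\<Sum>k<n. u k * g k) = \<alpha> * g i + \<beta> * g j" for g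
    proof -
      have "(\<Sum>k<n. u k * g k) = (\<Sum>k<n. (if k = i then \<alpha> * g k else 0) + (if k = j then \<beta> * g k else 0))"
        by (intro sum.cong refl) (auto simp: u_def algebra_simps)
      thus ?thesis using ij by (simp add: sum.distrib)
    qed
    have d': "(\<Sum>k<n. cnj (u k) * g k) = cnj \<alpha> * g i + cnj \<beta> * g j" for g
    proof -
      have "(\<Sum>k<n. cnj (u k) * g k) = cnj (\<Sum>k<n. u k * cnj (g k))" by simp
      thus ?thesis unfolding d by simp
    qed
    have "0 = (\<Sum>k<n. u k * (\<Sum>l<n. cnj (u l) * h k l))"
      using gen[of u] by (simp add: sum_distrib_left ac_simps)
    also have "\<dots> = \<alpha> * (cnj \<alpha> * h i i + cnj \<beta> * h i j) + \<beta> * (cnj \<alpha> * h j i + cnj \<beta> * h j j)"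
      unfolding d d' by simp
    finally show ?thesis by (simp add: algebra_simps)
  qed
  \<comment> \<open>Once the diagonal entries vanish, the coefficients (1, 1) give
    \<open>h i j + h j i = 0\<close> and (1, \<open>\<i>\<close>) give
    \<open>h i j = h j i\<close>.\<close>
  have "h i i = 0" "h j j = 0" using expand[of 1 0] expand[of 0 1] by auto
  moreover have "h i j + h j i + h i i + h j j = 0" using expand[of 1 1] by (simp add: algebra_simps)
  moreover have "- \<i> * h i j + \<i> * h j i + h i i + h j j = 0" using expand[of 1 \<i>] by (simp add: algebra_simps)
  ultimately have "h i j + h j i = 0" "\<i> * (h j i - h i j) = 0" by (auto simp: algebra_simps)
  thus ?thesis by (simp add: add_eq_0_iff)
qed

text \<open>The conclusions say that the functional is an operator on the input tensor the identity
  on the output, with input trace \<open>z\<close>. Comparing the preparation of \<open>u\<close>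
  with that of the reference state isolates the quadratic forms in \<open>x\<close> and
  \<open>u\<close>, and polarisation turns these into matrix entries.\<close>

lemma constant_on_channels:
  fixes \<kappa> :: "nat \<Rightarrow> nat \<Rightarrow> nat \<Rightarrow> nat \<Rightarrow> complex"
  assumes n: "n > 0" and m: "m > 0"
    and const: "\<And>E. is_CPTP_choi n m E \<Longrightarrow>
      (\<Sum>i<n. \<Sum>i'<n. \<Sum>q<m. \<Sum>q'<m. \<kappa> i i' q q' * E $$ (i * m + q, i' * m + q')) = z"
  shows "\<And>i i' q q'. i < n \<Longrightarrow> i' < n \<Longrightarrow> q < m \<Longrightarrow> q' < m \<Longrightarrow> \<kappa> i i' q q' = (if q = q' then \<kappa> i i' 0 0 else 0)"
    and "\<And>q q'. q < m \<Longrightarrow> q' < m \<Longrightarrow> (\<Sum>i<n. \<kappa> i i q q') = (if q = q' then z else 0)"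
proof -
  have val: "(\<Sum>i<n. \<Sum>i'<n. \<Sum>q<m. \<Sum>q'<m. x i * cnj (x i') * (u q * cnj (u q')) * \<kappa> i i' q q')
      - (\<Sum>i<n. \<Sum>i'<n. x i * cnj (x i') * \<kappa> i i' 0 0) + (\<Sum>i<n. \<kappa> i i 0 0) = z"
    if x: "(\<Sum>i<n. x i * cnj (x i)) = 1" and u: "(\<Sum>q<m. u q * cnj (u q)) = 1" for x u
  proof -
    have "z = (\<Sum>i<n. \<Sum>i'<n. \<Sum>q<m. \<Sum>q'<m. \<kappa> i i' q q' * measure_prepare n m x u $$ (i * m + q, i' * m + q'))"
      using const[OF measure_prepare_CPTP[OF m x u]] by simp
    also have "\<dots> = (\<Sum>i<n. \<Sum>i'<n. \<Sum>q<m. \<Sum>q'<m. x i * cnj (x i') * (u q * cnj (u q')) * \<kappa> i i' q q'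
        - (if q' = 0 then (if q = 0 then x i * cnj (x i') * \<kappa> i i' q q' else 0) else 0)
        + (if q' = 0 then (if q = 0 then (if i = i' then \<kappa> i i' q q' else 0) else 0) else 0))"
      by (intro sum.cong refl, subst measure_prepare_index) (auto simp: algebra_simps)
    also have "\<dots> = (\<Sum>i<n. \<Sum>i'<n. \<Sum>q<m. \<Sum>q'<m. x i * cnj (x i') * (u q * cnj (u q')) * \<kappa> i i' q q')
      - (\<Sum>i<n. \<Sum>i'<n. x i * cnj (x i') * \<kappa> i i' 0 0) + (\<Sum>i<n. \<kappa> i i 0 0)"
      using m by (simp add: sum.distrib sum_subtractf)
    finally show ?thesis by simp
  qed
  \<comment> \<open>For \<open>u = e\<close> both outcomes prepare the reference state and the
    channel ignores its input. The two terms containing \<open>x\<close> then cancel, which leaves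
    the trace.\<close>
  define e :: "nat \<Rightarrow> complex" where "e k = (if k = 0 then 1 else 0)" for k
  have e: "(\<Sum>i<k. e i * cnj (e i)) = 1" if "k > 0" for k
  proof -
    have "(\<Sum>i<k. e i * cnj (e i)) = (\<Sum>i<k. if i = 0 then 1 else 0)" by (intro sum.cong) (auto simp: e_def)
    thus ?thesis using that by simp
  qed
  have val_e: "(\<Sum>i<n. \<Sum>i'<n. \<Sum>q<m. \<Sum>q'<m. x i * cnj (x i') * (e q * cnj (e q')) * \<kappa> i i' q q')
      = (\<Sum>i<n. \<Sum>i'<n. x i * cnj (x i') * \<kappa> i i' 0 0)" for x
  proof -
    have "(\<Sum>i<n. \<Sum>i'<n. \<Sum>q<m. \<Sum>q'<m. x i * cnj (x i') * (e q * cnj (e q')) * \<kappa> i i' q q')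
      = (\<Sum>i<n. \<Sum>i'<n. \<Sum>q<m. \<Sum>q'<m. if q' = 0 then (if q = 0 then x i * cnj (x i') * \<kappa> i i' q q' else 0) else 0)"
      by (intro sum.cong refl) (auto simp: e_def)
    thus ?thesis using m by simp
  qed
  have tr: "(\<Sum>i<n. \<kappa> i i 0 0) = z"
    using val[OF e[OF n] e[OF m]] val_e[of e] by simp
  have quad: "(\<Sum>i<n. \<Sum>i'<n. \<Sum>q<m. \<Sum>q'<m. x i * cnj (x i') * (u q * cnj (u q')) * \<kappa> i i' q q')
      = (\<Sum>i<n. \<Sum>i'<n. x i * cnj (x i') * \<kappa> i i' 0 0)"
    if x: "(\<Sum>i<n. x i * cnj (x i)) = 1" and u: "(\<Sum>q<m. u q * cnj (u q)) = 1" for x u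
    using val[OF that] tr by simp
  show first: "\<kappa> i i' q q' = (if q = q' then \<kappa> i i' 0 0 else 0)"
    if b: "i < n" "i' < n" "q < m" "q' < m" for i i' q q'
  proof -
    have "\<kappa> i i' q q' - (if q = q' then \<kappa> i i' 0 0 else 0) = 0"
    \<comment> \<open>Polarisation is applied twice: outside in the measured vector
      \<open>x\<close>, inside in the prepared vector \<open>u\<close> with \<open>x\<close>
      fixed.\<close>
    proof (rule polarization[where n = n and h = "\<lambda>i i'. \<kappa> i i' q q' - (if q = q' then \<kappa> i i' 0 0 else 0)"])
      fix x :: "nat \<Rightarrow> complex" assume x: "(\<Sum>i<n. x i * cnj (x i)) = 1"
      define S where "S q q' = (\<Sum>i<n. \<Sum>i'<n. x i * cnj (x i') * \<kappa> i i' q q')" for q q'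
      have "S q q' - (if q = q' then S 0 0 else 0) = 0"
      proof (rule polarization[where n = m and h = "\<lambda>q q'. S q q' - (if q = q' then S 0 0 else 0)"])
        fix u :: "nat \<Rightarrow> complex" assume u: "(\<Sum>q<m. u q * cnj (u q)) = 1"
        have "(\<Sum>q<m. \<Sum>q'<m. u q * cnj (u q') * S q q')
            = (\<Sum>q<m. \<Sum>q'<m. \<Sum>i<n. \<Sum>i'<n. x i * cnj (x i') * (u q * cnj (u q')) * \<kappa> i i' q q')"
          by (simp add: S_def sum_distrib_left ac_simps)
        also have "\<dots> = (\<Sum>q<m. \<Sum>i<n. \<Sum>q'<m. \<Sum>i'<n. x i * cnj (x i') * (u q * cnj (u q')) * \<kappa> i i' q q')"
          by (rule sum.cong[OF refl], rule sum.swap)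
        also have "\<dots> = (\<Sum>i<n. \<Sum>q<m. \<Sum>q'<m. \<Sum>i'<n. x i * cnj (x i') * (u q * cnj (u q')) * \<kappa> i i' q q')"
          by (rule sum.swap)
        also have "\<dots> = (\<Sum>i<n. \<Sum>q<m. \<Sum>i'<n. \<Sum>q'<m. x i * cnj (x i') * (u q * cnj (u q')) * \<kappa> i i' q q')"
          by (rule sum.cong[OF refl], rule sum.cong[OF refl], rule sum.swap)
        also have "\<dots> = (\<Sum>i<n. \<Sum>i'<n. \<Sum>q<m. \<Sum>q'<m. x i * cnj (x i') * (u q * cnj (u q')) * \<kappa> i i' q q')"
          by (rule sum.cong[OF refl], rule sum.swap)
        also have "\<dots> = S 0 0" unfolding S_def by (rule quad[OF x u])
        finally have 1: "(\<Sum>q<m. \<Sum>q'<m. u q * cnj (u q') * S q q') = S 0 0" .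
        have "(\<Sum>q<m. \<Sum>q'<m. u q * cnj (u q') * (S q q' - (if q = q' then S 0 0 else 0)))
           = (\<Sum>q<m. \<Sum>q'<m. u q * cnj (u q') * S q q' - (if q' = q then u q * cnj (u q') * S 0 0 else 0))"
          by (intro sum.cong refl) (auto simp: algebra_simps)
        also have "\<dots> = S 0 0 - (\<Sum>q<m. u q * cnj (u q)) * S 0 0"
          by (simp add: sum_subtractf 1 sum_distrib_right)
        finally show "(\<Sum>q<m. \<Sum>q'<m. u q * cnj (u q') * (S q q' - (if q = q' then S 0 0 else 0))) = 0"
          by (simp add: u)
      qed (use b in auto)
      hence "S q q' - (if q = q' then S 0 0 else 0) = 0" .
      moreover have "(\<Sum>i<n. \<Sum>j<n. x i * cnj (x j) * (\<kappa> i j q q' - (if q = q' then \<kappa> i j 0 0 else 0)))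
          = S q q' - (if q = q' then S 0 0 else 0)"
        by (auto simp: S_def algebra_simps sum_subtractf)
      ultimately show "(\<Sum>i<n. \<Sum>j<n. x i * cnj (x j) * (\<kappa> i j q q' - (if q = q' then \<kappa> i j 0 0 else 0))) = 0"
        by simp
    qed (use b in auto)
    thus ?thesis by simp
  qed
  show "(\<Sum>i<n. \<kappa> i i q q') = (if q = q' then z else 0)" if "q < m" "q' < m" for q q'
  proof -
    have "(\<Sum>i<n. \<kappa> i i q q') = (\<Sum>i<n. if q = q' then \<kappa> i i 0 0 else 0)"
      using first that by (intro sum.cong refl) blast
    thus ?thesis using tr by auto
  qed
qed

section \<open>Consequences of trace preservation\<close>

text \<open>The matrix elements of \<open>Tr\<^sub>F |U\<rangle>\<rangle>\<langle>\<langle>U|\<close>, with \<open>p, a, s, b, t\<close> indexing \<open>P, A\<^sub>I, A\<^sub>O, B\<^sub>I, B\<^sub>O\<close>.\<close>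
definition reduced_choi :: "nat \<Rightarrow> nat \<Rightarrow> nat \<Rightarrow> nat \<Rightarrow> complex mat \<Rightarrow> nat \<Rightarrow> nat \<Rightarrow> nat \<Rightarrow> nat \<Rightarrow> nat \<Rightarrow> nat \<Rightarrow> nat \<Rightarrow> nat \<Rightarrow> nat \<Rightarrow> nat \<Rightarrow> complex" where
  "reduced_choi dAO dBI dBO dF U p p' a a' s s' b b' t t' =
    (\<Sum>f<dF. U $$ ((a * dBI + b) * dF + f, (p * dAO + s) * dBO + t)
      * cnj (U $$ ((a' * dBI + b') * dF + f, (p' * dAO + s') * dBO + t')))"

lemma supermap_choi_index:
  assumes "list_all2 (<) x [dP, dAI, dAO, dBI, dBO, dF]" "list_all2 (<) y [dP, dAI, dAO, dBI, dBO, dF]"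
  shows "supermap_choi dP dAI dAO dBI dBO dF U $$ (enc [dP, dAI, dAO, dBI, dBO, dF] x, enc [dP, dAI, dAO, dBI, dBO, dF] y)
    = U $$ ((x ! 1 * dBI + x ! 3) * dF + x ! 5, (x ! 0 * dAO + x ! 2) * dBO + x ! 4)
      * cnj (U $$ ((y ! 1 * dBI + y ! 3) * dF + y ! 5, (y ! 0 * dAO + y ! 2) * dBO + y ! 4))"
proof -
  have e: "enc [d1, d2, d3] [z1, z2, z3] = (z1 * d2 + z2) * d3 + z3" for d1 d2 d3 z1 z2 z3
    by (simp add: enc_def)
  note x = enc_less_dec_enc[OF assms(1)] and y = enc_less_dec_enc[OF assms(2)]
  show ?thesis
    unfolding supermap_choi_def Let_def index_mat(1)[OF x[THEN conjunct1] y[THEN conjunct1]] prod.case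
      x[THEN conjunct2] y[THEN conjunct2] e ..
qed

text \<open>This is trace preservation of the output map on the matrix unit \<open>|p><p'|\<close>.
  All auxiliary spaces have dimension 1, so the link product reduces to a contraction over the slot
  indices.\<close>

lemma superchannel_contract:
  assumes super: "is_superchannel dP dAI dAO dBI dBO dF (supermap_choi dP dAI dAO dBI dBO dF U)"
    and EA: "is_CPTP_choi dAI dAO EA" and EB: "is_CPTP_choi dBI dBO EB"
    and p: "p < dP" "p' < dP"
  shows "(\<Sum>a<dAI. \<Sum>a'<dAI. \<Sum>s<dAO. \<Sum>s'<dAO. \<Sum>b<dBI. \<Sum>b'<dBI. \<Sum>t<dBO. \<Sum>t'<dBO.
     reduced_choi dAO dBI dBO dF U p p' a a' s s' b b' t t' * EA $$ (a * dAO + s, a' * dAO + s')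
       * EB $$ (b * dBO + t, b' * dBO + t')) = (if p = p' then 1 else 0)"
proof -
  define W where "W = supermap_choi dP dAI dAO dBI dBO dF U"
  define out where "out = link_out dP dAI dAO dBI dBO dF 1 1 1 1 W EA EB"
  have "is_CPTP_choi (dP * 1 * 1) (dF * 1 * 1) out"
    using super EA EB unfolding is_superchannel_def out_def W_def by (metis mult.right_neutral)
  hence tr: "mtrace (map_of_choi dP dF out X) = mtrace X" if "X \<in> carrier_mat dP dP" for X
    using that by (simp add: is_CPTP_choi_def)
  define X :: "complex mat" where "X = mat dP dP (\<lambda>(i, j). if i = p \<and> j = p' then 1 else 0)"
  have "(\<Sum>f<dF. out $$ (p * dF + f, p' * dF + f))
      = (\<Sum>f<dF. \<Sum>i<dP. \<Sum>j<dP. X $$ (i, j) * out $$ (i * dF + f, j * dF + f))"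
  proof (rule sum.cong)
    fix f
    have "(\<Sum>i<dP. \<Sum>j<dP. X $$ (i, j) * out $$ (i * dF + f, j * dF + f))
        = (\<Sum>i<dP. \<Sum>j<dP. if j = p' then (if i = p then out $$ (i * dF + f, j * dF + f) else 0) else 0)"
      by (intro sum.cong refl) (auto simp: X_def)
    thus "out $$ (p * dF + f, p' * dF + f) = (\<Sum>i<dP. \<Sum>j<dP. X $$ (i, j) * out $$ (i * dF + f, j * dF + f))"
      using p by simp
  qed simp
  also have "\<dots> = mtrace (map_of_choi dP dF out X)" by (simp add: mtrace_def map_of_choi_def)
  also have "\<dots> = mtrace X" by (rule tr) (simp add: X_def)
  also have "\<dots> = (\<Sum>i<dP. if i = p then (if p = p' then 1 else 0) else 0)"
    unfolding mtrace_def by (rule sum.cong) (auto simp: X_def)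
  also have "\<dots> = (if p = p' then 1 else 0)" using p by simp
  finally have 1: "(\<Sum>f<dF. out $$ (p * dF + f, p' * dF + f)) = (if p = p' then 1 else 0)" .
  define G where "G f a a' s s' b b' t t' = U $$ ((a * dBI + b) * dF + f, (p * dAO + s) * dBO + t)
      * cnj (U $$ ((a' * dBI + b') * dF + f, (p' * dAO + s') * dBO + t'))
      * EA $$ (a * dAO + s, a' * dAO + s') * EB $$ (b * dBO + t, b' * dBO + t')" for f a a' s s' b b' t t'
  have out: "out $$ (p * dF + f, p' * dF + f) = (\<Sum>a<dAI. \<Sum>a'<dAI. \<Sum>s<dAO. \<Sum>s'<dAO. \<Sum>b<dBI. \<Sum>b'<dBI. \<Sum>t<dBO. \<Sum>t'<dBO.
      G f a a' s s' b b' t t')" if f: "f < dF" for f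
  proof -
    have d: "dec [dP, 1, 1, dF, 1, 1] (z * dF + f) = [z, 0, 0, f, 0, 0]" if "z < dP" for z
      using enc_less_dec_enc[of "[z, 0, 0, f, 0, 0]" "[dP, 1, 1, dF, 1, 1]"] that f by (simp add: enc_def)
    have b: "z * dF + f < dP * 1 * 1 * (dF * 1 * 1)" if "z < dP" for z
      using index_less_mult[OF that f] by simp
    have e: "enc [d1, Suc 0, d3, Suc 0] [z1, 0, z3, 0] = z1 * d3 + z3" for d1 d3 z1 z3
      by (simp add: enc_def)
    show ?thesis
      unfolding out_def link_out_def Let_def G_def index_mat(1)[OF b[OF p(1)] b[OF p(2)]] prod.case d[OF p(1)] d[OF p(2)]
      using p f by (intro sum.cong refl) (simp add: W_def supermap_choi_index e)
  qed
  have "(\<Sum>f<dF. out $$ (p * dF + f, p' * dF + f)) = (\<Sum>f<dF. \<Sum>a<dAI. \<Sum>a'<dAI. \<Sum>s<dAO. \<Sum>s'<dAO. \<Sum>b<dBI. \<Sum>b'<dBI. \<Sum>t<dBO. \<Sum>t'<dBO.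
      G f a a' s s' b b' t t')" using out by simp
  \<comment> \<open>The sum over \<open>f\<close> is pushed inside the eight slot sums, one exchange
    at a time, so that it becomes the trace over F in \<open>reduced_choi\<close>.\<close>
  also have "\<dots> = (\<Sum>a<dAI. \<Sum>a'<dAI. \<Sum>s<dAO. \<Sum>s'<dAO. \<Sum>b<dBI. \<Sum>b'<dBI. \<Sum>t<dBO. \<Sum>t'<dBO. \<Sum>f<dF.
      G f a a' s s' b b' t t')"
    by ((rule trans[OF sum.swap], rule sum.cong[OF refl])+) simp
  finally show ?thesis
    unfolding 1 by (simp add: G_def reduced_choi_def sum_distrib_right)
qed

text \<open>\<open>constant_on_channels\<close> is applied to one slot at a time: with
  \<open>EB\<close> fixed the contraction is a functional of \<open>EA\<close>, and the resulting
  equations are again functionals of \<open>EB\<close>. If \<open>D\<close> denotes replacing the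
  dependence on a slot output by a Kronecker delta times the 0 entry, the parts are the vanishing of
  \<open>(1 - D_A) (1 - D_B)\<close> on all of \<open>\<tau>\<close>, of \<open>1 - D_A\<close>
  after tracing \<open>B_I\<close>, and of \<open>1 - D_B\<close> after tracing
  \<open>A_I\<close>.\<close>

lemma superchannel_no_loop:
  assumes super: "is_superchannel dP dAI dAO dBI dBO dF (supermap_choi dP dAI dAO dBI dBO dF U)"
    and dims: "0 < dAI" "0 < dAO" "0 < dBI" "0 < dBO"
    and r: "p < dP" "p' < dP" "s < dAO" "s' < dAO" "t < dBO" "t' < dBO"
  defines "\<tau> \<equiv> reduced_choi dAO dBI dBO dF U p p'"
  shows "\<And>a a' b b'. a < dAI \<Longrightarrow> a' < dAI \<Longrightarrow> b < dBI \<Longrightarrow> b' < dBI \<Longrightarrow>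
      \<tau> a a' s s' b b' t t' - (if s = s' then \<tau> a a' 0 0 b b' t t' else 0)
      - (if t = t' then \<tau> a a' s s' b b' 0 0 - (if s = s' then \<tau> a a' 0 0 b b' 0 0 else 0) else 0) = 0"
    and "\<And>a a'. a < dAI \<Longrightarrow> a' < dAI \<Longrightarrow>
      (\<Sum>b<dBI. \<tau> a a' s s' b b t t') = (if s = s' then \<Sum>b<dBI. \<tau> a a' 0 0 b b t t' else 0)"
    and "\<And>b b'. b < dBI \<Longrightarrow> b' < dBI \<Longrightarrow>
      (\<Sum>a<dAI. \<tau> a a s s' b b' t t') = (if t = t' then \<Sum>a<dAI. \<tau> a a s s' b b' 0 0 else 0)"
proof -
  define z :: complex where "z = (if p = p' then 1 else 0)"
  define \<kappa> where "\<kappa> EB a a' s s' = (\<Sum>b<dBI. \<Sum>b'<dBI. \<Sum>t<dBO. \<Sum>t'<dBO. \<tau> a a' s s' b b' t t' * EB $$ (b * dBO + t, b' * dBO + t'))"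
    for EB :: "complex mat" and a a' s s'
  have const: "(\<Sum>a<dAI. \<Sum>a'<dAI. \<Sum>s<dAO. \<Sum>s'<dAO. \<kappa> EB a a' s s' * EA $$ (a * dAO + s, a' * dAO + s')) = z"
    if "is_CPTP_choi dBI dBO EB" "is_CPTP_choi dAI dAO EA" for EA EB
    using superchannel_contract[OF super that(2,1) r(1,2)]
    by (simp add: \<kappa>_def \<tau>_def z_def sum_distrib_left sum_distrib_right ac_simps)
  have A1: "\<kappa> EB a a' s s' = (if s = s' then \<kappa> EB a a' 0 0 else 0)"
    if "is_CPTP_choi dBI dBO EB" "a < dAI" "a' < dAI" for EB a a'
    using constant_on_channels(1)[OF dims(1,2), of "\<kappa> EB" z] const[OF that(1)] that r by blast
  have A2: "(\<Sum>a<dAI. \<kappa> EB a a s s') = (if s = s' then z else 0)"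
    if "is_CPTP_choi dBI dBO EB" for EB
    using constant_on_channels(2)[OF dims(1,2), of "\<kappa> EB" z] const[OF that(1)] that r by blast
  {
    fix a a' assume a: "a < dAI" "a' < dAI"
    \<comment> \<open>The defect of \<open>A1\<close> before contraction with \<open>EB\<close>.
      Contracted with any channel it gives 0, so it is a functional with constant value 0.\<close>
    define H where "H b b' t t' = \<tau> a a' s s' b b' t t' - (if s = s' then \<tau> a a' 0 0 b b' t t' else 0)" for b b' t t'
    have H: "(\<Sum>b<dBI. \<Sum>b'<dBI. \<Sum>t<dBO. \<Sum>t'<dBO. H b b' t t' * EB $$ (b * dBO + t, b' * dBO + t')) = 0"
      if EB: "is_CPTP_choi dBI dBO EB" for EB
    proof -
      have "(\<Sum>b<dBI. \<Sum>b'<dBI. \<Sum>t<dBO. \<Sum>t'<dBO. H b b' t t' * EB $$ (b * dBO + t, b' * dBO + t'))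
         = \<kappa> EB a a' s s' - (if s = s' then \<kappa> EB a a' 0 0 else 0)"
        by (auto simp: \<kappa>_def H_def left_diff_distrib sum_subtractf)
      thus ?thesis using A1[OF EB a] by simp
    qed
    have "H b b' t t' = (if t = t' then H b b' 0 0 else 0)" if "b < dBI" "b' < dBI" for b b'
      using constant_on_channels(1)[OF dims(3,4), of H 0] H that r by blast
    thus "\<tau> a a' s s' b b' t t' - (if s = s' then \<tau> a a' 0 0 b b' t t' else 0)
      - (if t = t' then \<tau> a a' s s' b b' 0 0 - (if s = s' then \<tau> a a' 0 0 b b' 0 0 else 0) else 0) = 0"
      if "b < dBI" "b' < dBI" for b b' using that unfolding H_def by simp
    have "(\<Sum>b<dBI. H b b t t') = (if t = t' then 0 else 0)"
      using constant_on_channels(2)[OF dims(3,4), of H 0] H r by blast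
    hence "(\<Sum>b<dBI. H b b t t') = 0" by simp
    thus "(\<Sum>b<dBI. \<tau> a a' s s' b b t t') = (if s = s' then \<Sum>b<dBI. \<tau> a a' 0 0 b b t t' else 0)"
      unfolding H_def by (auto simp: sum_subtractf split: if_splits)
  }
  fix b b' assume b: "b < dBI" "b' < dBI"
  \<comment> \<open>By \<open>A2\<close> this functional of \<open>EB\<close> has the constant value
    \<open>z\<close> for \<open>s = s'\<close> and 0 otherwise.\<close>
  define H where "H b b' t t' = (\<Sum>a<dAI. \<tau> a a s s' b b' t t')" for b b' t t'
  have H: "(\<Sum>b<dBI. \<Sum>b'<dBI. \<Sum>t<dBO. \<Sum>t'<dBO. H b b' t t' * EB $$ (b * dBO + t, b' * dBO + t')) = (if s = s' then z else 0)"
    if EB: "is_CPTP_choi dBI dBO EB" for EB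
  proof -
    have "(\<Sum>a<dAI. \<kappa> EB a a s s') = (\<Sum>b<dBI. \<Sum>b'<dBI. \<Sum>t<dBO. \<Sum>t'<dBO. \<Sum>a<dAI. \<tau> a a s s' b b' t t' * EB $$ (b * dBO + t, b' * dBO + t'))"
      unfolding \<kappa>_def by ((rule trans[OF sum.swap], rule sum.cong[OF refl])+) simp
    thus ?thesis using A2[OF EB] by (simp add: H_def sum_distrib_right)
  qed
  have "H b b' t t' = (if t = t' then H b b' 0 0 else 0)"
    using constant_on_channels(1)[OF dims(3,4), of H] H b r by blast
  thus "(\<Sum>a<dAI. \<tau> a a s s' b b' t t') = (if t = t' then \<Sum>a<dAI. \<tau> a a s s' b b' 0 0 else 0)"
    unfolding H_def .
qed

section \<open>Heisenberg picture\<close>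

lemma sum_const_if:
  "(\<Sum>x\<in>S. if P then g x else 0) = (if P then sum g S else (0 :: 'a :: comm_monoid_add))"
  by auto

lemma index3_less:
  fixes x y z :: nat
  assumes "x < n1" "y < n2" "z < n3"
  shows "(x * n2 + y) * n3 + z < n1 * n2 * n3"
  using assms by (intro index_less_mult)

lemma index3_cases:
  fixes i :: nat
  assumes "i < n1 * n2 * n3"
  obtains x y z where "x < n1" "y < n2" "z < n3" "i = (x * n2 + y) * n3 + z"
proof
  have pos: "n2 > 0" "n3 > 0" using assms by (auto intro!: Nat.gr0I)
  have "i div n3 < n1 * n2" using assms by (simp add: less_mult_imp_div_less)
  thus "i div n3 div n2 < n1" by (rule less_mult_imp_div_less)
  show "i div n3 mod n2 < n2" "i mod n3 < n3" using pos by auto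
  show "i = (i div n3 div n2 * n2 + i div n3 mod n2) * n3 + i mod n3" by simp
qed

lemma kron3_index:
  assumes "X \<in> carrier_mat n1 m1" "Y \<in> carrier_mat n2 m2" "Z \<in> carrier_mat n3 m3"
    "x < n1" "y < n2" "z < n3" "x' < m1" "y' < m2" "z' < m3"
  shows "kron (kron X Y) Z $$ ((x * n2 + y) * n3 + z, (x' * m2 + y') * m3 + z') = X $$ (x, x') * Y $$ (y, y') * Z $$ (z, z')"
  using assms index_less_mult[of x n1 y n2] index_less_mult[of x' m1 y' m2]
  by (simp add: kron_index[of _ "n1 * n2" "m1 * m2" _ n3 m3] kron_index[of _ n1 m1 _ n2 m2])

lemma kron3_mult:
  assumes "X \<in> carrier_mat n1 m1" "Y \<in> carrier_mat n2 m2" "Z \<in> carrier_mat n3 m3"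
    "X' \<in> carrier_mat m1 l1" "Y' \<in> carrier_mat m2 l2" "Z' \<in> carrier_mat m3 l3"
  shows "kron (kron X Y) Z * kron (kron X' Y') Z' = kron (kron (X * X') (Y * Y')) (Z * Z')"
  using assms by (simp add: kron_mult[of _ "n1 * n2" "m1 * m2" _ n3 m3 _ "l1 * l2" _ l3] kron_mult[of _ n1 m1 _ n2 m2 _ l1 _ l2])

lemma kron3_adjoint:
  assumes "X \<in> carrier_mat n1 m1" "Y \<in> carrier_mat n2 m2" "Z \<in> carrier_mat n3 m3"
  shows "mat_adjoint (kron (kron X Y) Z) = kron (kron (mat_adjoint X) (mat_adjoint Y)) (mat_adjoint Z)"
  using assms by (simp add: kron_adjoint[of _ "n1 * n2" "m1 * m2" _ n3 m3] kron_adjoint[of _ n1 m1 _ n2 m2])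

lemma mult_index_sum3:
  assumes "A \<in> carrier_mat n (n1 * n2 * n3)" "B \<in> carrier_mat (n1 * n2 * n3) l" "i < n" "j < l"
  shows "(A * B) $$ (i, j) = (\<Sum>x<n1. \<Sum>y<n2. \<Sum>z<n3. A $$ (i, (x * n2 + y) * n3 + z) * B $$ ((x * n2 + y) * n3 + z, j))"
  by (simp add: mult_index_sum[OF assms] sum_lessThan_mult)

definition matrix_unit :: "nat \<Rightarrow> nat \<Rightarrow> nat \<Rightarrow> complex mat" where
  "matrix_unit n i j = mat n n (\<lambda>(x, y). if x = i \<and> y = j then 1 else 0)"

lemma matrix_unit_carrier [simp]: "matrix_unit n i j \<in> carrier_mat n n"
  by (simp add: matrix_unit_def)

lemma matrix_unit_index: "x < n \<Longrightarrow> y < n \<Longrightarrow> matrix_unit n i j $$ (x, y) = (if x = i \<and> y = j then 1 else 0)"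
  by (simp add: matrix_unit_def)

definition heisenberg :: "nat \<Rightarrow> complex mat \<Rightarrow> complex mat \<Rightarrow> complex mat \<Rightarrow> complex mat" where
  "heisenberg dF U X Y = mat_adjoint U * (kron (kron X Y) (1\<^sub>m dF) * U)"

lemma heisenberg_carrier:
  assumes "U \<in> carrier_mat (dAI * dBI * dF) N" "X \<in> carrier_mat dAI dAI" "Y \<in> carrier_mat dBI dBI"
  shows "heisenberg dF U X Y \<in> carrier_mat N N"
  unfolding heisenberg_def using assms by auto

text \<open>The conjugated entries of \<open>U\<close> come from the adjoint on the left, so primed
  indices label rows. This is why operators on P are indexed by \<open>(p', p)\<close> and why
  \<open>matrix_unit dAI a' a\<close> goes with the arguments \<open>a a'\<close> of
  \<open>reduced_choi\<close>.\<close>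

lemma heisenberg_index:
  assumes U: "U \<in> carrier_mat (dAI * dBI * dF) (dP * dAO * dBO)"
    and X: "X \<in> carrier_mat dAI dAI" and Y: "Y \<in> carrier_mat dBI dBI"
    and r: "p < dP" "p' < dP" "s < dAO" "s' < dAO" "t < dBO" "t' < dBO"
  shows "heisenberg dF U X Y $$ ((p' * dAO + s') * dBO + t', (p * dAO + s) * dBO + t)
    = (\<Sum>a'<dAI. \<Sum>b'<dBI. \<Sum>a<dAI. \<Sum>b<dBI. X $$ (a', a) * Y $$ (b', b) * reduced_choi dAO dBI dBO dF U p p' a a' s s' b b' t t')"
proof -
  define j j' where "j = (p * dAO + s) * dBO + t" and "j' = (p' * dAO + s') * dBO + t'"
  have j: "j < dP * dAO * dBO" "j' < dP * dAO * dBO" unfolding j_def j'_def using r by (auto intro!: index3_less)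
  define K where "K = kron (kron X Y) (1\<^sub>m dF)"
  have Kc: "K \<in> carrier_mat (dAI * dBI * dF) (dAI * dBI * dF)" unfolding K_def using X Y by auto
  have KU: "(K * U) $$ ((a' * dBI + b') * dF + f', j) = (\<Sum>a<dAI. \<Sum>b<dBI. X $$ (a', a) * Y $$ (b', b) * U $$ ((a * dBI + b) * dF + f', j))"
    if "a' < dAI" "b' < dBI" "f' < dF" for a' b' f'
  proof -
    have "(K * U) $$ ((a' * dBI + b') * dF + f', j) = (\<Sum>a<dAI. \<Sum>b<dBI. \<Sum>f<dF. K $$ ((a' * dBI + b') * dF + f', (a * dBI + b) * dF + f) * U $$ ((a * dBI + b) * dF + f, j))"
      using Kc U j that by (intro mult_index_sum3) (auto intro!: index3_less)
    also have "\<dots> = (\<Sum>a<dAI. \<Sum>b<dBI. \<Sum>f<dF. if f = f' then X $$ (a', a) * Y $$ (b', b) * U $$ ((a * dBI + b) * dF + f, j) else 0)"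
      unfolding K_def using X Y that by (intro sum.cong refl, subst kron3_index) auto
    finally show ?thesis using that by simp
  qed
  have "heisenberg dF U X Y $$ (j', j) = (\<Sum>a'<dAI. \<Sum>b'<dBI. \<Sum>f<dF. mat_adjoint U $$ (j', (a' * dBI + b') * dF + f) * (K * U) $$ ((a' * dBI + b') * dF + f, j))"
    unfolding heisenberg_def K_def[symmetric] using Kc U j by (intro mult_index_sum3) auto
  also have "\<dots> = (\<Sum>a'<dAI. \<Sum>b'<dBI. \<Sum>f<dF. \<Sum>a<dAI. \<Sum>b<dBI. X $$ (a', a) * Y $$ (b', b) * (U $$ ((a * dBI + b) * dF + f, j) * cnj (U $$ ((a' * dBI + b') * dF + f, j'))))"
  proof (intro sum.cong refl, goal_cases)
    case (1 a' b' f)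
    have "mat_adjoint U $$ (j', (a' * dBI + b') * dF + f) = cnj (U $$ ((a' * dBI + b') * dF + f, j'))"
      using 1 U j by (intro mat_adjoint_index) (auto intro!: index3_less)
    moreover have "(K * U) $$ ((a' * dBI + b') * dF + f, j) = (\<Sum>a<dAI. \<Sum>b<dBI. X $$ (a', a) * Y $$ (b', b) * U $$ ((a * dBI + b) * dF + f, j))"
      using 1 by (intro KU) auto
    ultimately show ?case
      by (simp only: sum_distrib_left) (intro sum.cong refl, simp only: ac_simps)
  qed
  also have "\<dots> = (\<Sum>a'<dAI. \<Sum>b'<dBI. \<Sum>a<dAI. \<Sum>b<dBI. \<Sum>f<dF. X $$ (a', a) * Y $$ (b', b) * (U $$ ((a * dBI + b) * dF + f, j) * cnj (U $$ ((a' * dBI + b') * dF + f, j'))))"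
    by (rule sum.cong[OF refl], rule sum.cong[OF refl], (rule trans[OF sum.swap], rule sum.cong[OF refl])+) simp
  finally show ?thesis unfolding j_def j'_def by (simp add: reduced_choi_def sum_distrib_left)
qed

lemma heisenberg_matrix_unit_index:
  assumes U: "U \<in> carrier_mat (dAI * dBI * dF) (dP * dAO * dBO)"
    and r: "p < dP" "p' < dP" "s < dAO" "s' < dAO" "t < dBO" "t' < dBO"
    and a: "a < dAI" "a' < dAI" and b: "b < dBI" "b' < dBI"
  shows "heisenberg dF U (matrix_unit dAI a' a) (matrix_unit dBI b' b) $$ ((p' * dAO + s') * dBO + t', (p * dAO + s) * dBO + t)
    = reduced_choi dAO dBI dBO dF U p p' a a' s s' b b' t t'"
proof -
  let ?\<tau> = "\<lambda>x x' y y'. reduced_choi dAO dBI dBO dF U p p' x x' s s' y y' t t'"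
  have "heisenberg dF U (matrix_unit dAI a' a) (matrix_unit dBI b' b) $$ ((p' * dAO + s') * dBO + t', (p * dAO + s) * dBO + t) =
     (\<Sum>x'<dAI. \<Sum>y'<dBI. \<Sum>x<dAI. \<Sum>y<dBI. matrix_unit dAI a' a $$ (x', x) * matrix_unit dBI b' b $$ (y', y) * ?\<tau> x x' y y')"
    using r by (intro heisenberg_index[OF U]) auto
  also have "\<dots> = (\<Sum>x'<dAI. \<Sum>y'<dBI. \<Sum>x<dAI. \<Sum>y<dBI. if y = b then (if x = a then (if y' = b' then (if x' = a' then ?\<tau> x x' y y' else 0) else 0) else 0) else 0)"
    by (intro sum.cong refl) (auto simp: matrix_unit_index)
  also have "\<dots> = ?\<tau> a a' b b'"
    using a b by (simp add: sum_const_if)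
  finally show ?thesis .
qed

text \<open>\<open>U * mat_adjoint U\<close> cancels between the two factors. For an isometry that
  is not onto, a range projection would remain there.\<close>

lemma heisenberg_mult:
  assumes U: "U \<in> carrier_mat (dAI * dBI * dF) N" "U * mat_adjoint U = 1\<^sub>m (dAI * dBI * dF)"
    and X: "X \<in> carrier_mat dAI dAI" "X' \<in> carrier_mat dAI dAI" and Y: "Y \<in> carrier_mat dBI dBI" "Y' \<in> carrier_mat dBI dBI"
  shows "heisenberg dF U X Y * heisenberg dF U X' Y' = heisenberg dF U (X * X') (Y * Y')"
proof -
  define K K' where "K = kron (kron X Y) (1\<^sub>m dF)" and "K' = kron (kron X' Y') (1\<^sub>m dF)"
  have Kc: "K \<in> carrier_mat (dAI * dBI * dF) (dAI * dBI * dF)" "K' \<in> carrier_mat (dAI * dBI * dF) (dAI * dBI * dF)"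
    unfolding K_def K'_def using X Y by auto
  have "heisenberg dF U X Y * heisenberg dF U X' Y' = mat_adjoint U * (K * (U * mat_adjoint U) * (K' * U))"
    unfolding heisenberg_def K_def[symmetric] K'_def[symmetric] using Kc carrier_matD[OF U(1)] by (simp add: mult_assoc_dim)
  also have "\<dots> = mat_adjoint U * ((K * K') * U)"
    unfolding U(2) using Kc carrier_matD[OF U(1)] by (simp add: mult_assoc_dim)
  also have "K * K' = kron (kron (X * X') (Y * Y')) (1\<^sub>m dF)"
    unfolding K_def K'_def using kron3_mult[OF X(1) Y(1) one_carrier_mat X(2) Y(2) one_carrier_mat] by simp
  finally show ?thesis by (simp add: heisenberg_def)
qed

section \<open>Operator blocks on P and their signalling parts\<close>

locale two_slot =
  fixes dP dAI dAO dBI dBO dF :: nat and U :: "complex mat"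
  assumes dims: "0 < dP" "0 < dAI" "0 < dAO" "0 < dBI" "0 < dBO" "0 < dF"
    and U_carrier: "U \<in> carrier_mat (dAI * dBI * dF) (dP * dAO * dBO)"
    and U_unitary: "is_unitary U"
    and super: "is_superchannel dP dAI dAO dBI dBO dF (supermap_choi dP dAI dAO dBI dBO dF U)"
begin

abbreviation \<tau> where "\<tau> \<equiv> reduced_choi dAO dBI dBO dF U"

lemma UaU: "mat_adjoint U * U = 1\<^sub>m (dP * dAO * dBO)" and UUa: "U * mat_adjoint U = 1\<^sub>m (dAI * dBI * dF)"
  using U_unitary carrier_matD[OF U_carrier] by (auto simp: is_unitary_def)

text \<open>The blocks on \<open>P\<close> of the Heisenberg evolutions of \<open>|a'\<rangle>\<langle>a|\<close> on \<open>A\<^sub>I\<close> and \<open>|b'\<rangle>\<langle>b|\<close> on \<open>B\<^sub>I\<close>.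
  By no-signalling the \<open>A\<^sub>O\<close>, resp. \<open>B\<^sub>O\<close>, index does not matter, so it is set to 0.\<close>
definition sliceA :: "nat \<Rightarrow> nat \<Rightarrow> nat \<Rightarrow> nat \<Rightarrow> complex mat" where
  "sliceA a a' t t' = mat dP dP (\<lambda>(p', p). \<Sum>b<dBI. \<tau> p p' a a' 0 0 b b t t')"

definition sliceB :: "nat \<Rightarrow> nat \<Rightarrow> nat \<Rightarrow> nat \<Rightarrow> complex mat" where
  "sliceB b b' s s' = mat dP dP (\<lambda>(p', p). \<Sum>a<dAI. \<tau> p p' a a s s' b b' 0 0)"

definition reduced_choi_mat :: "nat \<Rightarrow> nat \<Rightarrow> nat \<Rightarrow> nat \<Rightarrow> nat \<Rightarrow> nat \<Rightarrow> nat \<Rightarrow> nat \<Rightarrow> complex mat" where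
  "reduced_choi_mat a a' s s' b b' t t' = mat dP dP (\<lambda>(p', p). \<tau> p p' a a' s s' b b' t t')"

lemma slice_carrier [simp]: "sliceA a a' t t' \<in> carrier_mat dP dP" "sliceB b b' s s' \<in> carrier_mat dP dP"
  "reduced_choi_mat a a' s s' b b' t t' \<in> carrier_mat dP dP"
  by (auto simp: sliceA_def sliceB_def reduced_choi_mat_def)

abbreviation "HA a a' \<equiv> heisenberg dF U (matrix_unit dAI a' a) (1\<^sub>m dBI)"
abbreviation "HB b b' \<equiv> heisenberg dF U (1\<^sub>m dAI) (matrix_unit dBI b' b)"

lemma H_carrier: "HA a a' \<in> carrier_mat (dP * dAO * dBO) (dP * dAO * dBO)"
  "HB b b' \<in> carrier_mat (dP * dAO * dBO) (dP * dAO * dBO)"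
  using U_carrier by (auto intro: heisenberg_carrier)

text \<open>The identity on \<open>B_I\<close> traces that system out of the reduced Choi operator;
  the absence of a loop from \<open>A_O\<close> to \<open>A_I\<close> then makes the evolved
  operator the identity on \<open>A_O\<close>.\<close>

lemma HA_index:
  assumes r: "p < dP" "p' < dP" "s < dAO" "s' < dAO" "t < dBO" "t' < dBO" and a: "a < dAI" "a' < dAI"
  shows "HA a a' $$ ((p' * dAO + s') * dBO + t', (p * dAO + s) * dBO + t) = (if s = s' then sliceA a a' t t' $$ (p', p) else 0)"
proof -
  have "HA a a' $$ ((p' * dAO + s') * dBO + t', (p * dAO + s) * dBO + t) =
     (\<Sum>x'<dAI. \<Sum>b'<dBI. \<Sum>x<dAI. \<Sum>b<dBI. matrix_unit dAI a' a $$ (x', x) * 1\<^sub>m dBI $$ (b', b) * \<tau> p p' x x' s s' b b' t t')"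
    using r by (intro heisenberg_index[OF U_carrier]) auto
  also have "\<dots> = (\<Sum>x'<dAI. \<Sum>b'<dBI. \<Sum>x<dAI. \<Sum>b<dBI. if b = b' then (if x = a then (if x' = a' then \<tau> p p' x x' s s' b b' t t' else 0) else 0) else 0)"
    by (intro sum.cong refl) (auto simp: matrix_unit_index)
  also have "\<dots> = (\<Sum>b<dBI. \<tau> p p' a a' s s' b b t t')"
    using a by (simp add: sum_const_if)
  also have "\<dots> = (if s = s' then \<Sum>b<dBI. \<tau> p p' a a' 0 0 b b t t' else 0)"
    using superchannel_no_loop(2)[OF super dims(2-5) r a] .
  finally show ?thesis using r by (simp add: sliceA_def)
qed

lemma HB_index:
  assumes r: "p < dP" "p' < dP" "s < dAO" "s' < dAO" "t < dBO" "t' < dBO" and b: "b < dBI" "b' < dBI"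
  shows "HB b b' $$ ((p' * dAO + s') * dBO + t', (p * dAO + s) * dBO + t) = (if t = t' then sliceB b b' s s' $$ (p', p) else 0)"
proof -
  have "HB b b' $$ ((p' * dAO + s') * dBO + t', (p * dAO + s) * dBO + t) =
     (\<Sum>a'<dAI. \<Sum>x'<dBI. \<Sum>a<dAI. \<Sum>x<dBI. 1\<^sub>m dAI $$ (a', a) * matrix_unit dBI b' b $$ (x', x) * \<tau> p p' a a' s s' x x' t t')"
    using r by (intro heisenberg_index[OF U_carrier]) auto
  also have "\<dots> = (\<Sum>a'<dAI. \<Sum>x'<dBI. \<Sum>a<dAI. \<Sum>x<dBI. if x = b then (if a = a' then (if x' = b' then \<tau> p p' a a' s s' x x' t t' else 0) else 0) else 0)"
    by (intro sum.cong refl) (auto simp: matrix_unit_index)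
  also have "\<dots> = (\<Sum>a<dAI. \<tau> p p' a a s s' b b' t t')"
    using b by (simp add: sum_const_if)
  also have "\<dots> = (if t = t' then \<Sum>a<dAI. \<tau> p p' a a s s' b b' 0 0 else 0)"
    using superchannel_no_loop(3)[OF super dims(2-5) r b] .
  finally show ?thesis using r by (simp add: sliceB_def)
qed

text \<open>The observables sit on different tensor factors, so either order multiplies to the joint
  one.\<close>

lemma HA_HB: "HA a a' * HB b b' = heisenberg dF U (matrix_unit dAI a' a) (matrix_unit dBI b' b)"
  "HB b b' * HA a a' = heisenberg dF U (matrix_unit dAI a' a) (matrix_unit dBI b' b)"
  using heisenberg_mult[OF U_carrier UUa, of "matrix_unit dAI a' a" "1\<^sub>m dAI" "1\<^sub>m dBI" "matrix_unit dBI b' b"]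
    heisenberg_mult[OF U_carrier UUa, of "1\<^sub>m dAI" "matrix_unit dAI a' a" "matrix_unit dBI b' b" "1\<^sub>m dBI"]
  by (auto simp: left_mult_one_mat[OF matrix_unit_carrier] right_mult_one_mat[OF matrix_unit_carrier])

text \<open>\<open>HA\<close> is the identity on \<open>A_O\<close> and \<open>HB\<close> the
  identity on \<open>B_O\<close>. In the block product the intermediate \<open>A_O\<close> index is
  therefore fixed by \<open>HA\<close> and the intermediate \<open>B_O\<close> index by
  \<open>HB\<close>, so a single pair of blocks survives and commutation descends from the full
  operators to individual blocks.\<close>

lemma slice_mult:
  assumes r: "s < dAO" "s' < dAO" "t < dBO" "t' < dBO"
    and a: "a < dAI" "a' < dAI" and b: "b < dBI" "b' < dBI"
  shows "sliceA a a' t t' * sliceB b b' s s' = reduced_choi_mat a a' s s' b b' t t'"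
    and "sliceB b b' s s' * sliceA a a' t t' = reduced_choi_mat a a' s s' b b' t t'"
proof -
  have idx: "(sliceA a a' t t' * sliceB b b' s s') $$ (p', p) = \<tau> p p' a a' s s' b b' t t'"
     "(sliceB b b' s s' * sliceA a a' t t') $$ (p', p) = \<tau> p p' a a' s s' b b' t t'"
    if p: "p < dP" "p' < dP" for p p'
  proof -
    let ?i = "(p' * dAO + s') * dBO + t'" and ?j = "(p * dAO + s) * dBO + t"
    have ij: "?i < dP * dAO * dBO" "?j < dP * dAO * dBO" using p r by (auto intro!: index3_less)
    have "\<tau> p p' a a' s s' b b' t t' = (HA a a' * HB b b') $$ (?i, ?j)"
      unfolding HA_HB using heisenberg_matrix_unit_index[OF U_carrier p r a b] by simp
    also have "\<dots> = (\<Sum>x<dP. \<Sum>y<dAO. \<Sum>z<dBO. HA a a' $$ (?i, (x * dAO + y) * dBO + z) * HB b b' $$ ((x * dAO + y) * dBO + z, ?j))"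
      using H_carrier ij by (intro mult_index_sum3) auto
    also have "\<dots> = (\<Sum>x<dP. \<Sum>y<dAO. \<Sum>z<dBO. if z = t then (if y = s' then sliceA a a' z t' $$ (p', x) * sliceB b b' s y $$ (x, p) else 0) else 0)"
      using r p a b by (intro sum.cong refl) (auto simp: HA_index HB_index)
    also have "\<dots> = (\<Sum>x<dP. sliceA a a' t t' $$ (p', x) * sliceB b b' s s' $$ (x, p))"
      using r by simp
    also have "\<dots> = (sliceA a a' t t' * sliceB b b' s s') $$ (p', p)"
      using p by (intro mult_index_sum[symmetric, of _ dP]) auto
    finally show "(sliceA a a' t t' * sliceB b b' s s') $$ (p', p) = \<tau> p p' a a' s s' b b' t t'" ..
    have "\<tau> p p' a a' s s' b b' t t' = (HB b b' * HA a a') $$ (?i, ?j)"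
      unfolding HA_HB using heisenberg_matrix_unit_index[OF U_carrier p r a b] by simp
    also have "\<dots> = (\<Sum>x<dP. \<Sum>y<dAO. \<Sum>z<dBO. HB b b' $$ (?i, (x * dAO + y) * dBO + z) * HA a a' $$ ((x * dAO + y) * dBO + z, ?j))"
      using H_carrier ij by (intro mult_index_sum3) auto
    also have "\<dots> = (\<Sum>x<dP. \<Sum>y<dAO. \<Sum>z<dBO. if z = t' then (if y = s then sliceB b b' y s' $$ (p', x) * sliceA a a' t z $$ (x, p) else 0) else 0)"
      using r p a b by (intro sum.cong refl) (auto simp: HA_index HB_index)
    also have "\<dots> = (\<Sum>x<dP. sliceB b b' s s' $$ (p', x) * sliceA a a' t t' $$ (x, p))"
      using r by simp
    also have "\<dots> = (sliceB b b' s s' * sliceA a a' t t') $$ (p', p)"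
      using p by (intro mult_index_sum[symmetric, of _ dP]) auto
    finally show "(sliceB b b' s s' * sliceA a a' t t') $$ (p', p) = \<tau> p p' a a' s s' b b' t t'" ..
  qed
  have d: "dim_row (sliceA a a' t t') = dP" "dim_col (sliceB b b' s s') = dP" "dim_row (sliceB b b' s s') = dP"
    "dim_col (sliceA a a' t t') = dP" by (auto simp: sliceA_def sliceB_def)
  show "sliceA a a' t t' * sliceB b b' s s' = reduced_choi_mat a a' s s' b b' t t'"
    using idx d by (intro eq_matI) (auto simp: reduced_choi_mat_def simp del: index_mult_mat(1))
  show "sliceB b b' s s' * sliceA a a' t t' = reduced_choi_mat a a' s s' b b' t t'"
    using idx d by (intro eq_matI) (auto simp: reduced_choi_mat_def simp del: index_mult_mat(1))
qed

text \<open>All \<open>signalA\<close> vanish iff \<open>B\<^sub>O\<close> does not signal to \<open>A\<^sub>I\<close>, and all \<open>signalB\<close> iff \<open>A\<^sub>O\<close> does not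
  signal to \<open>B\<^sub>I\<close>.\<close>
definition signalA :: "nat \<Rightarrow> nat \<Rightarrow> nat \<Rightarrow> nat \<Rightarrow> complex mat" where
  "signalA a a' t t' = sliceA a a' t t' - (if t = t' then 1 else 0) \<cdot>\<^sub>m sliceA a a' 0 0"

definition signalB :: "nat \<Rightarrow> nat \<Rightarrow> nat \<Rightarrow> nat \<Rightarrow> complex mat" where
  "signalB b b' s s' = sliceB b b' s s' - (if s = s' then 1 else 0) \<cdot>\<^sub>m sliceB b b' 0 0"

lemma signal_carrier [simp]: "signalA a a' t t' \<in> carrier_mat dP dP" "signalB b b' s s' \<in> carrier_mat dP dP"
  by (auto simp: signalA_def signalB_def intro!: minus_carrier_mat)

lemma signalA_mult_left:
  assumes "X \<in> carrier_mat n dP"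
  shows "X * signalA a a' t t' = X * sliceA a a' t t' - (if t = t' then 1 else 0) \<cdot>\<^sub>m (X * sliceA a a' 0 0)"
  unfolding signalA_def using assms
  by (subst mult_minus_distrib_mat[of _ n dP _ dP]) (auto simp: mult_smult_distrib[of _ n dP _ dP])

lemma signalA_mult_right:
  assumes "X \<in> carrier_mat dP n"
  shows "signalA a a' t t' * X = sliceA a a' t t' * X - (if t = t' then 1 else 0) \<cdot>\<^sub>m (sliceA a a' 0 0 * X)"
  unfolding signalA_def using assms
  by (subst minus_mult_distrib_mat[of _ dP dP _ _ n]) (auto simp: mult_smult_assoc_mat[of _ dP dP _ n])

lemma signalB_mult_left:
  assumes "X \<in> carrier_mat n dP"
  shows "X * signalB b b' s s' = X * sliceB b b' s s' - (if s = s' then 1 else 0) \<cdot>\<^sub>m (X * sliceB b b' 0 0)"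
  unfolding signalB_def using assms
  by (subst mult_minus_distrib_mat[of _ n dP _ dP]) (auto simp: mult_smult_distrib[of _ n dP _ dP])

lemma signalB_mult_right:
  assumes "X \<in> carrier_mat dP n"
  shows "signalB b b' s s' * X = sliceB b b' s s' * X - (if s = s' then 1 else 0) \<cdot>\<^sub>m (sliceB b b' 0 0 * X)"
  unfolding signalB_def using assms
  by (subst minus_mult_distrib_mat[of _ dP dP _ _ n]) (auto simp: mult_smult_assoc_mat[of _ dP dP _ n])

lemma slice_adjoint:
  "mat_adjoint (sliceA a a' t t') = sliceA a' a t' t" "mat_adjoint (sliceB b b' s s') = sliceB b' b s' s"
  by (auto intro!: eq_matI sum.cong simp: sliceA_def sliceB_def reduced_choi_def)

lemma signalA_adjoint: "mat_adjoint (signalA a a' t t') = signalA a' a t' t"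
proof (rule eq_matI)
  fix i j assume "i < dim_row (signalA a' a t' t)" "j < dim_col (signalA a' a t' t)"
  hence ij: "i < dP" "j < dP" by (auto simp: signalA_def sliceA_def)
  have "cnj (sliceA x x' z z' $$ (j, i)) = sliceA x' x z' z $$ (i, j)" for x x' z z'
    using ij slice_adjoint(1)[of x x' z z'] mat_adjoint_index[of i "sliceA x x' z z'" j]
      carrier_matD[OF slice_carrier(1)[of x x' z z']] by simp
  thus "mat_adjoint (signalA a a' t t') $$ (i, j) = signalA a' a t' t $$ (i, j)"
    using ij carrier_matD[OF signal_carrier(1)[of a a' t t']] carrier_matD[OF slice_carrier(1)] by (simp add: signalA_def)
qed (auto simp: carrier_matD[OF signal_carrier(1)])

lemma signalB_signalA_zero:
  assumes r: "s < dAO" "s' < dAO" "t < dBO" "t' < dBO"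
    and a: "a < dAI" "a' < dAI" and b: "b < dBI" "b' < dBI"
  shows "signalB b b' s s' * signalA a a' t t' = 0\<^sub>m dP dP"
proof (rule eq_matI)
  fix i j assume "i < dim_row (0\<^sub>m dP dP)" "j < dim_col (0\<^sub>m dP dP)"
  hence ij: "i < dP" "j < dP" by auto
  \<comment> \<open>The four terms of the expanded product form exactly the combination in the first
    part of \<open>superchannel_no_loop\<close>.\<close>
  have "signalB b b' s s' * signalA a a' t t' = 
      (reduced_choi_mat a a' s s' b b' t t' - (if s = s' then 1 else 0) \<cdot>\<^sub>m reduced_choi_mat a a' 0 0 b b' t t')
       - (if t = t' then 1 else 0) \<cdot>\<^sub>m (reduced_choi_mat a a' s s' b b' 0 0 - (if s = s' then 1 else 0) \<cdot>\<^sub>m reduced_choi_mat a a' 0 0 b b' 0 0)"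
    using slice_mult(2) r a b dims by (simp add: signalA_mult_left[of _ dP] signalB_mult_right[of _ dP])
  also have "\<dots> $$ (i, j) = 0"
    using superchannel_no_loop(1)[OF super dims(2-5) ij(2,1) r a b] ij by (auto simp: reduced_choi_mat_def)
  finally show "(signalB b b' s s' * signalA a a' t t') $$ (i, j) = 0\<^sub>m dP dP $$ (i, j)" using ij by simp
qed (auto simp: carrier_matD[OF signal_carrier(1)] carrier_matD[OF signal_carrier(2)])

text \<open>\<open>reducing_decomposition\<close> with the slices as the commuting families and the
  signals as the annihilating combinations. The range of \<open>V1\<close> is meant for A before B,
  since nothing reaches \<open>A_I\<close> from \<open>B_O\<close> there, and that of
  \<open>V2\<close> for the opposite order.\<close>

lemma P_decomposition:
  "\<exists>k l. \<exists>V1\<in>carrier_mat dP k. \<exists>V2\<in>carrier_mat dP l. is_isometry V1 \<and> is_isometry V2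
     \<and> V1 * mat_adjoint V1 + V2 * mat_adjoint V2 = 1\<^sub>m dP
     \<and> (\<forall>a<dAI. \<forall>a'<dAI. \<forall>t<dBO. \<forall>t'<dBO. V1 * mat_adjoint V1 * sliceA a a' t t' = sliceA a a' t t' * (V1 * mat_adjoint V1))
     \<and> (\<forall>b<dBI. \<forall>b'<dBI. \<forall>s<dAO. \<forall>s'<dAO. V1 * mat_adjoint V1 * sliceB b b' s s' = sliceB b b' s s' * (V1 * mat_adjoint V1))
     \<and> (\<forall>a<dAI. \<forall>a'<dAI. \<forall>t<dBO. \<forall>t'<dBO. V2 * mat_adjoint V2 * sliceA a a' t t' = sliceA a a' t t' * (V2 * mat_adjoint V2))
     \<and> (\<forall>b<dBI. \<forall>b'<dBI. \<forall>s<dAO. \<forall>s'<dAO. V2 * mat_adjoint V2 * sliceB b b' s s' = sliceB b b' s s' * (V2 * mat_adjoint V2))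
     \<and> (\<forall>a<dAI. \<forall>a'<dAI. \<forall>t<dBO. \<forall>t'<dBO. signalA a a' t t' * V1 = 0\<^sub>m dP k)
     \<and> (\<forall>b<dBI. \<forall>b'<dBI. \<forall>s<dAO. \<forall>s'<dAO. signalB b b' s s' * V2 = 0\<^sub>m dP l)"
proof -
  define A where "A = {sliceA a a' t t' | a a' t t'. a < dAI \<and> a' < dAI \<and> t < dBO \<and> t' < dBO}"
  define B where "B = {sliceB b b' s s' | b b' s s'. b < dBI \<and> b' < dBI \<and> s < dAO \<and> s' < dAO}"
  define SA where "SA = {signalA a a' t t' | a a' t t'. a < dAI \<and> a' < dAI \<and> t < dBO \<and> t' < dBO}"
  define SB where "SB = {signalB b b' s s' | b b' s s'. b < dBI \<and> b' < dBI \<and> s < dAO \<and> s' < dAO}"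
  have "\<exists>k l. \<exists>V1\<in>carrier_mat dP k. \<exists>V2\<in>carrier_mat dP l. is_isometry V1 \<and> is_isometry V2
     \<and> V1 * mat_adjoint V1 + V2 * mat_adjoint V2 = 1\<^sub>m dP
     \<and> (\<forall>x\<in>A \<union> B. V1 * mat_adjoint V1 * x = x * (V1 * mat_adjoint V1))
     \<and> (\<forall>x\<in>A \<union> B. V2 * mat_adjoint V2 * x = x * (V2 * mat_adjoint V2))
     \<and> (\<forall>s\<in>SA. s * V1 = 0\<^sub>m dP k) \<and> (\<forall>t\<in>SB. t * V2 = 0\<^sub>m dP l)"
  proof (rule reducing_decomposition)
    show "A \<subseteq> carrier_mat dP dP" "B \<subseteq> carrier_mat dP dP" "SA \<subseteq> carrier_mat dP dP" "SB \<subseteq> carrier_mat dP dP"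
      by (auto simp: A_def B_def SA_def SB_def simp del: carrier_matD)
    show "mat_adjoint x \<in> A" if "x \<in> A" for x using that by (fastforce simp: A_def slice_adjoint)
    show "mat_adjoint x \<in> B" if "x \<in> B" for x using that by (fastforce simp: B_def slice_adjoint)
    show "mat_adjoint x \<in> SA" if "x \<in> SA" for x using that by (fastforce simp: SA_def signalA_adjoint)
    show "x * y = y * x" if "x \<in> A" "y \<in> B" for x y
      using that by (auto simp: A_def B_def slice_mult)
    show "x * y = y * x" if "x \<in> SA" "y \<in> B" for x y
      using that dims by (auto simp: SA_def B_def slice_mult signalA_mult_left[of _ dP] signalA_mult_right[of _ dP])
    show "x * y = y * x" if "x \<in> SB" "y \<in> A" for x y
      using that dims by (auto simp: SB_def A_def slice_mult signalB_mult_left[of _ dP] signalB_mult_right[of _ dP])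
    show "y * x = 0\<^sub>m dP dP" if "x \<in> SA" "y \<in> SB" for x y
      using that by (auto simp: SA_def SB_def signalB_signalA_zero)
  qed
  then obtain k l V1 V2 where V: "V1 \<in> carrier_mat dP k" "V2 \<in> carrier_mat dP l" "is_isometry V1" "is_isometry V2"
     "V1 * mat_adjoint V1 + V2 * mat_adjoint V2 = 1\<^sub>m dP"
     and c: "\<forall>x\<in>A \<union> B. V1 * mat_adjoint V1 * x = x * (V1 * mat_adjoint V1)"
     "\<forall>x\<in>A \<union> B. V2 * mat_adjoint V2 * x = x * (V2 * mat_adjoint V2)"
     and z: "\<forall>s\<in>SA. s * V1 = 0\<^sub>m dP k" "\<forall>t\<in>SB. t * V2 = 0\<^sub>m dP l" by blast
  have A: "sliceA a a' t t' \<in> A \<union> B" "signalA a a' t t' \<in> SA" if "a < dAI" "a' < dAI" "t < dBO" "t' < dBO" for a a' t t'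
    using that unfolding A_def SA_def by blast+
  have B: "sliceB b b' s s' \<in> A \<union> B" "signalB b b' s s' \<in> SB" if "b < dBI" "b' < dBI" "s < dAO" "s' < dAO" for b b' s s'
    using that unfolding B_def SB_def by blast+
  show ?thesis
    using V c z A B by (intro exI[of _ k] exI[of _ l] bexI[of _ V1] bexI[of _ V2]) (simp_all del: Un_iff)
qed

end

section \<open>Sectors\<close>

lemma lift_mult_left_index:
  assumes V: "V \<in> carrier_mat n m" and Y: "Y \<in> carrier_mat (m * d2 * d3) l"
    and r: "p < n" "s < d2" "t < d3" "j < l"
  shows "(kron (kron V (1\<^sub>m d2)) (1\<^sub>m d3) * Y) $$ ((p * d2 + s) * d3 + t, j) = (\<Sum>q<m. V $$ (p, q) * Y $$ ((q * d2 + s) * d3 + t, j))"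
proof -
  have "(kron (kron V (1\<^sub>m d2)) (1\<^sub>m d3) * Y) $$ ((p * d2 + s) * d3 + t, j)
    = (\<Sum>x<m. \<Sum>y<d2. \<Sum>z<d3. kron (kron V (1\<^sub>m d2)) (1\<^sub>m d3) $$ ((p * d2 + s) * d3 + t, (x * d2 + y) * d3 + z) * Y $$ ((x * d2 + y) * d3 + z, j))"
    using assms by (intro mult_index_sum3[of _ "n * d2 * d3"]) (auto intro!: index3_less)
  also have "\<dots> = (\<Sum>x<m. \<Sum>y<d2. \<Sum>z<d3. if z = t then (if y = s then V $$ (p, x) * Y $$ ((x * d2 + y) * d3 + z, j) else 0) else 0)"
    using assms by (intro sum.cong refl, subst kron3_index) auto
  finally show ?thesis using r by simp
qed

lemma lift_mult_right_index:
  assumes V: "V \<in> carrier_mat n m" and Y: "Y \<in> carrier_mat l (n * d2 * d3)"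
    and r: "p < m" "s < d2" "t < d3" "i < l"
  shows "(Y * kron (kron V (1\<^sub>m d2)) (1\<^sub>m d3)) $$ (i, (p * d2 + s) * d3 + t) = (\<Sum>q<n. Y $$ (i, (q * d2 + s) * d3 + t) * V $$ (q, p))"
proof -
  have "(Y * kron (kron V (1\<^sub>m d2)) (1\<^sub>m d3)) $$ (i, (p * d2 + s) * d3 + t)
    = (\<Sum>x<n. \<Sum>y<d2. \<Sum>z<d3. Y $$ (i, (x * d2 + y) * d3 + z) * kron (kron V (1\<^sub>m d2)) (1\<^sub>m d3) $$ ((x * d2 + y) * d3 + z, (p * d2 + s) * d3 + t))"
    using assms by (intro mult_index_sum3[of _ l _ _ _ _ "m * d2 * d3"]) (auto intro!: index3_less)
  also have "\<dots> = (\<Sum>x<n. \<Sum>y<d2. \<Sum>z<d3. if z = t then (if y = s then Y $$ (i, (x * d2 + y) * d3 + z) * V $$ (x, p) else 0) else 0)"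
    using assms by (intro sum.cong refl, subst kron3_index) auto
  finally show ?thesis using r by simp
qed

text \<open>\<open>kron (kron R (1\<^sub>m d2)) (1\<^sub>m d3)\<close> acts on each block of
  \<open>Y\<close> separately, so it is enough that \<open>R\<close> commutes with every block. The
  existential over \<open>X\<close> allows a zero block to be matched by the zero matrix.\<close>

lemma lift_commute:
  assumes R: "R \<in> carrier_mat n n" and Y: "Y \<in> carrier_mat (n * d2 * d3) (n * d2 * d3)"
    and B: "\<And>s s' t t'. s < d2 \<Longrightarrow> s' < d2 \<Longrightarrow> t < d3 \<Longrightarrow> t' < d3 \<Longrightarrow> \<exists>X\<in>carrier_mat n n. R * X = X * R
      \<and> (\<forall>p<n. \<forall>p'<n. Y $$ ((p' * d2 + s') * d3 + t', (p * d2 + s) * d3 + t) = X $$ (p', p))"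
  shows "kron (kron R (1\<^sub>m d2)) (1\<^sub>m d3) * Y = Y * kron (kron R (1\<^sub>m d2)) (1\<^sub>m d3)"
proof (rule eq_matI)
  fix i j assume "i < dim_row (Y * kron (kron R (1\<^sub>m d2)) (1\<^sub>m d3))" "j < dim_col (Y * kron (kron R (1\<^sub>m d2)) (1\<^sub>m d3))"
  hence ij: "i < n * d2 * d3" "j < n * d2 * d3" using Y R by auto
  obtain p' s' t' where i: "p' < n" "s' < d2" "t' < d3" "i = (p' * d2 + s') * d3 + t'"
    using ij(1) by (rule index3_cases)
  obtain p s t where j: "p < n" "s < d2" "t < d3" "j = (p * d2 + s) * d3 + t"
    using ij(2) by (rule index3_cases)
  obtain X where X: "X \<in> carrier_mat n n" "R * X = X * R"
    "\<forall>p<n. \<forall>p'<n. Y $$ ((p' * d2 + s') * d3 + t', (p * d2 + s) * d3 + t) = X $$ (p', p)"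
    using B[of s s' t t'] i j by blast
  have "(kron (kron R (1\<^sub>m d2)) (1\<^sub>m d3) * Y) $$ (i, j) = (\<Sum>q<n. R $$ (p', q) * X $$ (q, p))"
    unfolding i(4) using lift_mult_left_index[OF R Y i(1-3) ij(2)] X(3) j by simp
  also have "\<dots> = (R * X) $$ (p', p)" using R X(1) i j by (intro mult_index_sum[symmetric, of _ n n _ n]) auto
  also have "\<dots> = (X * R) $$ (p', p)" by (simp only: X(2))
  also have "\<dots> = (\<Sum>q<n. X $$ (p', q) * R $$ (q, p))" using R X(1) i j by (intro mult_index_sum[of _ n n _ n]) auto
  also have "\<dots> = (Y * kron (kron R (1\<^sub>m d2)) (1\<^sub>m d3)) $$ (i, j)"
    unfolding j(4) using lift_mult_right_index[OF R Y j(1-3) ij(1)] X(3) i by simp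
  finally show "(kron (kron R (1\<^sub>m d2)) (1\<^sub>m d3) * Y) $$ (i, j) = (Y * kron (kron R (1\<^sub>m d2)) (1\<^sub>m d3)) $$ (i, j)" .
qed (use Y R in auto)

text \<open>One entry of the commutator with \<open>|x'><0|\<close> suffices: multiplied on the
  right this unit brings in the column block \<open>x'\<close>, multiplied on the left it brings in
  the row block 0 if \<open>x = x'\<close> and nothing otherwise.\<close>

lemma commute_matrix_unit_first:
  assumes Z: "Z \<in> carrier_mat (n1 * n2 * n3) (n1 * n2 * n3)"
    and comm: "\<And>i j. i < n1 \<Longrightarrow> j < n1 \<Longrightarrow> Z * kron (kron (matrix_unit n1 i j) (1\<^sub>m n2)) (1\<^sub>m n3) = kron (kron (matrix_unit n1 i j) (1\<^sub>m n2)) (1\<^sub>m n3) * Z"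
    and r: "x < n1" "y < n2" "z < n3" "x' < n1" "y' < n2" "z' < n3"
  shows "Z $$ ((x * n2 + y) * n3 + z, (x' * n2 + y') * n3 + z') =
    (if x = x' then Z $$ ((0 * n2 + y) * n3 + z, (0 * n2 + y') * n3 + z') else 0)"
proof -
  define E where "E = matrix_unit n1 x' 0"
  have Ec: "E \<in> carrier_mat n1 n1" by (simp add: E_def)
  have n1: "0 < n1" using r by simp
  let ?i = "(x * n2 + y) * n3 + z" and ?j = "(0 * n2 + y') * n3 + z'"
  have ij: "?i < n1 * n2 * n3" "?j < n1 * n2 * n3" 
    by (rule index3_less[OF r(1-3)], rule index3_less[OF n1 r(5,6)])
  have "(Z * kron (kron E (1\<^sub>m n2)) (1\<^sub>m n3)) $$ (?i, ?j) = (\<Sum>q<n1. Z $$ (?i, (q * n2 + y') * n3 + z') * E $$ (q, 0))"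
    using lift_mult_right_index[OF Ec Z n1 r(5,6) ij(1)] .
  also have "\<dots> = (\<Sum>q<n1. if q = x' then Z $$ (?i, (q * n2 + y') * n3 + z') else 0)"
    using n1 by (intro sum.cong refl) (auto simp: E_def matrix_unit_index)
  also have "\<dots> = Z $$ (?i, (x' * n2 + y') * n3 + z')" using r by simp
  finally have 1: "(Z * kron (kron E (1\<^sub>m n2)) (1\<^sub>m n3)) $$ (?i, ?j) = Z $$ (?i, (x' * n2 + y') * n3 + z')" .
  have "(kron (kron E (1\<^sub>m n2)) (1\<^sub>m n3) * Z) $$ (?i, ?j) = (\<Sum>q<n1. E $$ (x, q) * Z $$ ((q * n2 + y) * n3 + z, ?j))"
    using lift_mult_left_index[OF Ec Z r(1-3) ij(2)] .
  also have "\<dots> = (\<Sum>q<n1. if q = 0 then (if x = x' then Z $$ ((q * n2 + y) * n3 + z, ?j) else 0) else 0)"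
    using r by (intro sum.cong refl) (auto simp: E_def matrix_unit_index)
  also have "\<dots> = (if x = x' then Z $$ ((0 * n2 + y) * n3 + z, ?j) else 0)" using n1 by simp
  finally show ?thesis using 1 comm[OF r(4) n1] unfolding E_def by simp
qed

lemma commute_matrix_unit_second:
  assumes Z: "Z \<in> carrier_mat (n1 * n2 * n3) (n1 * n2 * n3)"
    and comm: "\<And>i j. i < n2 \<Longrightarrow> j < n2 \<Longrightarrow> Z * kron (kron (1\<^sub>m n1) (matrix_unit n2 i j)) (1\<^sub>m n3) = kron (kron (1\<^sub>m n1) (matrix_unit n2 i j)) (1\<^sub>m n3) * Z"
    and r: "x < n1" "y < n2" "z < n3" "x' < n1" "y' < n2" "z' < n3"
  shows "Z $$ ((x * n2 + y) * n3 + z, (x' * n2 + y') * n3 + z') =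
    (if y = y' then Z $$ ((x * n2 + 0) * n3 + z, (x' * n2 + 0) * n3 + z') else 0)"
proof -
  define E where "E = matrix_unit n2 y' 0"
  have Ec: "E \<in> carrier_mat n2 n2" by (simp add: E_def)
  have n2: "0 < n2" using r by simp
  define K where "K = kron (kron (1\<^sub>m n1) E) (1\<^sub>m n3)"
  have Kc: "K \<in> carrier_mat (n1 * n2 * n3) (n1 * n2 * n3)" using Ec by (auto simp: K_def)
  let ?i = "(x * n2 + y) * n3 + z" and ?j = "(x' * n2 + 0) * n3 + z'"
  have ij: "?i < n1 * n2 * n3" "?j < n1 * n2 * n3" 
    by (rule index3_less[OF r(1-3)], rule index3_less[OF r(4) n2 r(6)])
  have "(Z * K) $$ (?i, ?j) = (\<Sum>a<n1. \<Sum>b<n2. \<Sum>c<n3. Z $$ (?i, (a * n2 + b) * n3 + c) * K $$ ((a * n2 + b) * n3 + c, ?j))"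
    using Z Kc ij by (intro mult_index_sum3)
  also have "\<dots> = (\<Sum>a<n1. \<Sum>b<n2. \<Sum>c<n3. if c = z' then (if b = y' then (if a = x' then Z $$ (?i, (a * n2 + b) * n3 + c) else 0) else 0) else 0)"
    unfolding K_def using r n2 Ec by (intro sum.cong refl, subst kron3_index) (auto simp: E_def matrix_unit_index)
  also have "\<dots> = Z $$ (?i, (x' * n2 + y') * n3 + z')" using r by simp
  finally have 1: "(Z * K) $$ (?i, ?j) = Z $$ (?i, (x' * n2 + y') * n3 + z')" .
  have "(K * Z) $$ (?i, ?j) = (\<Sum>a<n1. \<Sum>b<n2. \<Sum>c<n3. K $$ (?i, (a * n2 + b) * n3 + c) * Z $$ ((a * n2 + b) * n3 + c, ?j))"
    using Z Kc ij by (intro mult_index_sum3)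
  also have "\<dots> = (\<Sum>a<n1. \<Sum>b<n2. \<Sum>c<n3. if c = z then (if b = 0 then (if a = x then (if y = y' then Z $$ ((a * n2 + b) * n3 + c, ?j) else 0) else 0) else 0) else 0)"
    unfolding K_def using r n2 Ec by (intro sum.cong refl, subst kron3_index) (auto simp: E_def matrix_unit_index)
  also have "\<dots> = (if y = y' then Z $$ ((x * n2 + 0) * n3 + z, ?j) else 0)" using r n2 by simp
  finally show ?thesis using 1 comm[OF r(5) n2] unfolding E_def K_def by simp
qed

lemma kron_one_left_inject:
  assumes "A \<in> carrier_mat m l" "B \<in> carrier_mat m l" "0 < n" "kron (1\<^sub>m n) A = kron (1\<^sub>m n) B"
  shows "A = B"
proof (rule eq_matI)
  fix i j assume ij: "i < dim_row B" "j < dim_col B"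
  have "kron (1\<^sub>m n) A $$ (0 * m + i, 0 * l + j) = kron (1\<^sub>m n) B $$ (0 * m + i, 0 * l + j)" using assms by simp
  thus "A $$ (i, j) = B $$ (i, j)"
    using ij assms(1-3) by (simp add: kron_index[OF one_carrier_mat, of _ m l, where i = 0 and j = 0, simplified])
qed (use assms in auto)

lemma kron_add_left:
  assumes "A \<in> carrier_mat n m" "B \<in> carrier_mat n m" "C \<in> carrier_mat n' m'"
  shows "kron (A + B) C = kron A C + kron B C"
proof (rule mat_eq_blockI[of _ n n' m m'])
  fix i j k l assume r: "i < n" "k < n'" "j < m" "l < m'"
  note b = index_less_mult[OF r(1,2)] index_less_mult[OF r(3,4)]
  show "kron (A + B) C $$ (i * n' + k, j * m' + l) = (kron A C + kron B C) $$ (i * n' + k, j * m' + l)"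
    using assms r b by (simp add: kron_index[of _ n m _ n' m'] distrib_right)
qed (use assms in auto)

lemma kron_add_right:
  assumes "A \<in> carrier_mat n m" "B \<in> carrier_mat n' m'" "C \<in> carrier_mat n' m'"
  shows "kron A (B + C) = kron A B + kron A C"
proof (rule mat_eq_blockI[of _ n n' m m'])
  fix i j k l assume r: "i < n" "k < n'" "j < m" "l < m'"
  note b = index_less_mult[OF r(1,2)] index_less_mult[OF r(3,4)]
  show "kron A (B + C) $$ (i * n' + k, j * m' + l) = (kron A B + kron A C) $$ (i * n' + k, j * m' + l)"
    using assms r b by (simp add: kron_index[of _ n m _ n' m'] distrib_left)
qed (use assms in auto)

text \<open>For \<open>X = mat_adjoint V1 * V2\<close>, inserting the resolution of the identity
  between the factors gives \<open>X = X + X\<close>.\<close>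

lemma isometries_orthogonal:
  assumes "V1 \<in> carrier_mat n k" "V2 \<in> carrier_mat n l" "is_isometry V1" "is_isometry V2"
    "V1 * mat_adjoint V1 + V2 * mat_adjoint V2 = 1\<^sub>m n"
  shows "mat_adjoint V1 * V2 = 0\<^sub>m k l"
proof -
  have i: "mat_adjoint V1 * V1 = 1\<^sub>m k" "mat_adjoint V2 * V2 = 1\<^sub>m l"
    using assms by (auto simp: is_isometry_def)
  define X where "X = mat_adjoint V1 * V2"
  have Xc: "X \<in> carrier_mat k l" using assms by (auto simp: X_def)
  have "X = mat_adjoint V1 * ((V1 * mat_adjoint V1 + V2 * mat_adjoint V2) * V2)"
    unfolding assms(5) using assms(1,2) by (simp add: X_def)
  also have "(V1 * mat_adjoint V1 + V2 * mat_adjoint V2) * V2 = V1 * X + V2"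
  proof -
    have "(V1 * mat_adjoint V1 + V2 * mat_adjoint V2) * V2 = V1 * mat_adjoint V1 * V2 + V2 * mat_adjoint V2 * V2"
      using assms(1,2) by (intro add_mult_distrib_mat[of _ n n]) auto
    also have "\<dots> = V1 * X + V2 * (mat_adjoint V2 * V2)" using assms(1,2) by (simp add: X_def mult_assoc_dim)
    finally show ?thesis using assms(2) by (simp add: i)
  qed
  also have "mat_adjoint V1 * (V1 * X + V2) = mat_adjoint V1 * (V1 * X) + X"
    unfolding X_def using assms(1,2) by (intro mult_add_distrib_mat[of _ k n _ l]) auto
  also have "mat_adjoint V1 * (V1 * X) = mat_adjoint V1 * V1 * X" using assms(1) Xc by (simp add: mult_assoc_dim)
  finally have XX: "X = X + X" using Xc by (simp add: i)
  show ?thesis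
  proof (rule eq_matI)
    fix r c assume "r < dim_row (0\<^sub>m k l :: complex mat)" "c < dim_col (0\<^sub>m k l :: complex mat)"
    hence rc: "r < k" "c < l" by auto
    have "X $$ (r, c) = (X + X) $$ (r, c)" using XX by simp
    also have "\<dots> = X $$ (r, c) + X $$ (r, c)" using rc Xc by simp
    finally show "(mat_adjoint V1 * V2) $$ (r, c) = 0\<^sub>m k l $$ (r, c)" using rc by (simp add: X_def)
  qed (use assms in auto)
qed

context two_slot
begin

text \<open>Conjugating the lifted projection by \<open>U\<close> gives a projection that commutes
  with all operators on \<open>A_I\<close> and on \<open>B_I\<close>, hence acts on F only; an
  orthonormal basis of its range is \<open>VF\<close>. The last conclusion records this projection
  so that the F-parts of the two sectors can be added up.\<close>

lemma sector:
  assumes V: "V \<in> carrier_mat dP k" "is_isometry V"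
    and cA: "\<And>a a' t t'. a < dAI \<Longrightarrow> a' < dAI \<Longrightarrow> t < dBO \<Longrightarrow> t' < dBO \<Longrightarrow> V * mat_adjoint V * sliceA a a' t t' = sliceA a a' t t' * (V * mat_adjoint V)"
    and cB: "\<And>b b' s s'. b < dBI \<Longrightarrow> b' < dBI \<Longrightarrow> s < dAO \<Longrightarrow> s' < dAO \<Longrightarrow> V * mat_adjoint V * sliceB b b' s s' = sliceB b b' s s' * (V * mat_adjoint V)"
  shows "\<exists>f. \<exists>VF\<in>carrier_mat dF f. \<exists>U1\<in>carrier_mat (dAI * dBI * f) (k * dAO * dBO). is_isometry VF \<and> is_unitary U1
    \<and> U * kron (kron V (1\<^sub>m dAO)) (1\<^sub>m dBO) = kron (kron (1\<^sub>m dAI) (1\<^sub>m dBI)) VF * U1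
    \<and> kron (1\<^sub>m (dAI * dBI)) (VF * mat_adjoint VF) = U * (kron (kron (V * mat_adjoint V) (1\<^sub>m dAO)) (1\<^sub>m dBO) * mat_adjoint U)"
proof -
  define R where "R = V * mat_adjoint V"
  have Rc: "R \<in> carrier_mat dP dP" using V by (auto simp: R_def)
  define L where "L = kron (kron R (1\<^sub>m dAO)) (1\<^sub>m dBO)"
  have Lc: "L \<in> carrier_mat (dP * dAO * dBO) (dP * dAO * dBO)" using Rc by (auto simp: L_def)
  have LA: "L * HA a a' = HA a a' * L" if a: "a < dAI" "a' < dAI" for a a'
    unfolding L_def
  proof (rule lift_commute[OF Rc H_carrier(1)])
    fix s s' t t' assume r: "s < dAO" "s' < dAO" "t < dBO" "t' < dBO"
    show "\<exists>X\<in>carrier_mat dP dP. R * X = X * R \<and> (\<forall>p<dP. \<forall>p'<dP. HA a a' $$ ((p' * dAO + s') * dBO + t', (p * dAO + s) * dBO + t) = X $$ (p', p))"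
    proof (cases "s = s'")
      case True
      thus ?thesis using cA[OF a r(3,4)] a r by (intro bexI[of _ "sliceA a a' t t'"]) (auto simp: HA_index R_def)
    next
      case False
      thus ?thesis using a r Rc by (intro bexI[of _ "0\<^sub>m dP dP"]) (auto simp: HA_index)
    qed
  qed
  have LB: "L * HB b b' = HB b b' * L" if b: "b < dBI" "b' < dBI" for b b'
    unfolding L_def
  proof (rule lift_commute[OF Rc H_carrier(2)])
    fix s s' t t' assume r: "s < dAO" "s' < dAO" "t < dBO" "t' < dBO"
    show "\<exists>X\<in>carrier_mat dP dP. R * X = X * R \<and> (\<forall>p<dP. \<forall>p'<dP. HB b b' $$ ((p' * dAO + s') * dBO + t', (p * dAO + s) * dBO + t) = X $$ (p', p))"
    proof (cases "t = t'")
      case True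
      thus ?thesis using cB[OF b r(1,2)] b r by (intro bexI[of _ "sliceB b b' s s'"]) (auto simp: HB_index R_def)
    next
      case False
      thus ?thesis using b r Rc by (intro bexI[of _ "0\<^sub>m dP dP"]) (auto simp: HB_index)
    qed
  qed
  define Z where "Z = U * (L * mat_adjoint U)"
  note Ud = carrier_matD[OF U_carrier]
  have Zc: "Z \<in> carrier_mat (dAI * dBI * dF) (dAI * dBI * dF)" using Lc U_carrier by (auto simp: Z_def)
  \<comment> \<open>Conjugation by \<open>U\<close> carries the commutation of \<open>L\<close> with
    the evolution of \<open>K\<close> over to \<open>Z\<close> and \<open>K\<close>;
    \<open>U * mat_adjoint U\<close> is inserted to the right of \<open>K\<close>.\<close>
  have Zcomm: "Z * K = K * Z" if K: "K \<in> carrier_mat (dAI * dBI * dF) (dAI * dBI * dF)"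
    and H: "L * (mat_adjoint U * (K * U)) = mat_adjoint U * (K * U) * L" for K
  proof -
    have "Z * K = U * (L * (mat_adjoint U * K))"
      unfolding Z_def using K Lc Ud by (simp add: mult_assoc_dim)
    also have "\<dots> = U * (L * (mat_adjoint U * (K * (U * mat_adjoint U))))" using K by (simp add: UUa)
    also have "\<dots> = U * (L * (mat_adjoint U * (K * U)) * mat_adjoint U)"
      using K Lc Ud by (simp add: mult_assoc_dim)
    also have "\<dots> = (U * mat_adjoint U) * (K * (U * (L * mat_adjoint U)))"
      unfolding H using K Lc Ud by (simp add: mult_assoc_dim)
    also have "\<dots> = K * Z" unfolding UUa using K Zc by (simp add: Z_def[symmetric])
    finally show ?thesis .
  qed
  have ZA: "Z * kron (kron (matrix_unit dAI i j) (1\<^sub>m dBI)) (1\<^sub>m dF) = kron (kron (matrix_unit dAI i j) (1\<^sub>m dBI)) (1\<^sub>m dF) * Z"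
    if "i < dAI" "j < dAI" for i j
    using LA[OF that(2,1)] by (intro Zcomm) (auto simp: heisenberg_def)
  have ZB: "Z * kron (kron (1\<^sub>m dAI) (matrix_unit dBI i j)) (1\<^sub>m dF) = kron (kron (1\<^sub>m dAI) (matrix_unit dBI i j)) (1\<^sub>m dF) * Z"
    if "i < dBI" "j < dBI" for i j
    using LB[OF that(2,1)] by (intro Zcomm) (auto simp: heisenberg_def simp del: kron_one)
  \<comment> \<open>Indices below \<open>dF\<close> select the block at index 0 of both
    \<open>A_I\<close> and \<open>B_I\<close>; \<open>ZQ\<close> shows that every diagonal block
    equals it.\<close>
  define Q where "Q = mat dF dF (\<lambda>(f, f'). Z $$ (f, f'))"
  have Qc: "Q \<in> carrier_mat dF dF" by (simp add: Q_def)
  have ZQ: "Z = kron (1\<^sub>m (dAI * dBI)) Q"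
  proof (rule eq_matI)
    fix i j assume "i < dim_row (kron (1\<^sub>m (dAI * dBI)) Q)" "j < dim_col (kron (1\<^sub>m (dAI * dBI)) Q)"
    hence ij: "i < dAI * dBI * dF" "j < dAI * dBI * dF" using Qc by auto
    obtain x y z where i: "x < dAI" "y < dBI" "z < dF" "i = (x * dBI + y) * dF + z" using ij(1) by (rule index3_cases)
    obtain x' y' z' where j: "x' < dAI" "y' < dBI" "z' < dF" "j = (x' * dBI + y') * dF + z'" using ij(2) by (rule index3_cases)
    have "Z $$ (i, j) = (if x = x' then Z $$ ((0 * dBI + y) * dF + z, (0 * dBI + y') * dF + z') else 0)"
      unfolding i(4) j(4) by (rule commute_matrix_unit_first[OF Zc ZA i(1-3) j(1-3)])
    also have "Z $$ ((0 * dBI + y) * dF + z, (0 * dBI + y') * dF + z') = (if y = y' then Z $$ ((0 * dBI + 0) * dF + z, (0 * dBI + 0) * dF + z') else 0)"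
      by (rule commute_matrix_unit_second[OF Zc ZB dims(2) i(2,3) dims(2) j(2,3)])
    finally have "Z $$ (i, j) = (if x = x' \<and> y = y' then Q $$ (z, z') else 0)" using i j by (simp add: Q_def)
    also have "\<dots> = kron (kron (1\<^sub>m dAI) (1\<^sub>m dBI)) Q $$ (i, j)"
      unfolding i(4) j(4) using i j Qc by (subst kron3_index) auto
    finally show "Z $$ (i, j) = kron (1\<^sub>m (dAI * dBI)) Q $$ (i, j)" by simp
  qed (use Zc Qc in auto)
  have VV: "mat_adjoint V * V = 1\<^sub>m k" using V by (auto simp: is_isometry_def)
  define KP where "KP = kron (kron V (1\<^sub>m dAO)) (1\<^sub>m dBO)"
  have KPc: "KP \<in> carrier_mat (dP * dAO * dBO) (k * dAO * dBO)" using V by (auto simp: KP_def)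
  have KPa: "mat_adjoint KP = kron (kron (mat_adjoint V) (1\<^sub>m dAO)) (1\<^sub>m dBO)"
    unfolding KP_def using kron3_adjoint[OF V(1) one_carrier_mat one_carrier_mat] by simp
  have KP1: "KP * mat_adjoint KP = L"
    unfolding KPa unfolding KP_def L_def R_def
    using kron3_mult[OF V(1) one_carrier_mat one_carrier_mat mat_adjoint_carrier[OF V(1)] one_carrier_mat one_carrier_mat] by simp
  have KP2: "mat_adjoint KP * KP = 1\<^sub>m (k * dAO * dBO)"
    unfolding KPa unfolding KP_def
    using kron3_mult[OF mat_adjoint_carrier[OF V(1)] one_carrier_mat one_carrier_mat V(1) one_carrier_mat one_carrier_mat] by (simp add: VV)
  note KPd = carrier_matD[OF KPc]
  have La: "mat_adjoint L = L" unfolding KP1[symmetric] using KPc by (subst mat_adjoint_mult) auto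
  have LL: "L * L = L"
  proof -
    have "L * L = KP * (mat_adjoint KP * KP) * mat_adjoint KP"
      unfolding KP1[symmetric] using KPd by (simp add: mult_assoc_dim)
    thus ?thesis using KPc by (simp add: KP2 KP1)
  qed
  have Za: "mat_adjoint Z = Z"
  proof -
    have "mat_adjoint Z = mat_adjoint (L * mat_adjoint U) * mat_adjoint U"
      unfolding Z_def using U_carrier Lc by (intro mat_adjoint_mult) auto
    also have "mat_adjoint (L * mat_adjoint U) = U * L"
      using U_carrier Lc La by (subst mat_adjoint_mult) auto
    finally show ?thesis unfolding Z_def using Ud Lc by (simp add: mult_assoc_dim)
  qed
  have ZZ: "Z * Z = Z"
  proof -
    have "Z * Z = U * (L * (mat_adjoint U * U) * L * mat_adjoint U)"
      unfolding Z_def using Ud Lc by (simp add: mult_assoc_dim)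
    thus ?thesis unfolding UaU using Lc by (simp add: LL Z_def)
  qed
  have n: "0 < dAI * dBI" using dims by simp
  have "kron (1\<^sub>m (dAI * dBI)) (mat_adjoint Q) = kron (1\<^sub>m (dAI * dBI)) Q"
    using Za unfolding ZQ kron_adjoint[OF one_carrier_mat Qc] by simp
  hence Qa: "mat_adjoint Q = Q" by (rule kron_one_left_inject[OF mat_adjoint_carrier[OF Qc] Qc n])
  have "kron (1\<^sub>m (dAI * dBI)) (Q * Q) = kron (1\<^sub>m (dAI * dBI)) Q"
    using ZZ unfolding ZQ kron_mult[OF one_carrier_mat Qc one_carrier_mat Qc] by simp
  hence QQ: "Q * Q = Q" by (rule kron_one_left_inject[OF mult_carrier_mat[OF Qc Qc] Qc n])
  obtain f VF where VF: "VF \<in> carrier_mat dF f" "is_isometry VF" "VF * mat_adjoint VF = Q"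
    using projection_isometry[OF Qc Qa QQ] by blast
  have VFVF: "mat_adjoint VF * VF = 1\<^sub>m f" using VF by (auto simp: is_isometry_def)
  define KF where "KF = kron (1\<^sub>m (dAI * dBI)) VF"
  have KFc: "KF \<in> carrier_mat (dAI * dBI * dF) (dAI * dBI * f)" using VF by (auto simp: KF_def)
  note KFd = carrier_matD[OF KFc]
  have KFa: "mat_adjoint KF = kron (1\<^sub>m (dAI * dBI)) (mat_adjoint VF)"
    unfolding KF_def using kron_adjoint[OF one_carrier_mat VF(1)] by simp
  have KF1: "KF * mat_adjoint KF = Z"
    unfolding KFa unfolding KF_def ZQ
    using kron_mult[OF one_carrier_mat VF(1) one_carrier_mat mat_adjoint_carrier[OF VF(1)]] by (simp add: VF(3))
  have KF2: "mat_adjoint KF * KF = 1\<^sub>m (dAI * dBI * f)"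
    unfolding KFa unfolding KF_def
    using kron_mult[OF one_carrier_mat mat_adjoint_carrier[OF VF(1)] one_carrier_mat VF(1)] by (simp add: VFVF)
  \<comment> \<open>The compression of \<open>U\<close> to the two subspaces. Nothing is lost,
    because \<open>U\<close> maps the range of \<open>KP\<close> onto that of \<open>KF\<close>:
    their projections are \<open>L\<close> and \<open>Z\<close>, conjugate under
    \<open>U\<close>.\<close>
  define U1 where "U1 = mat_adjoint KF * (U * KP)"
  have U1c: "U1 \<in> carrier_mat (dAI * dBI * f) (k * dAO * dBO)" using KFc KPc U_carrier by (auto simp: U1_def)
  have inter: "KF * U1 = U * KP"
  proof -
    have "KF * U1 = (KF * mat_adjoint KF) * (U * KP)"
      unfolding U1_def using KFd KPd Ud by (simp add: mult_assoc_dim)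
    also have "\<dots> = U * (L * ((mat_adjoint U * U) * KP))"
      unfolding KF1 Z_def using KPd Ud Lc by (simp add: mult_assoc_dim)
    also have "\<dots> = U * (KP * (mat_adjoint KP * KP))"
      unfolding UaU using KPc by (simp add: KP1[symmetric] mult_assoc_dim)
    finally show ?thesis using KPc by (simp add: KP2)
  qed
  have U1a: "mat_adjoint U1 = mat_adjoint KP * (mat_adjoint U * KF)"
  proof -
    have "mat_adjoint U1 = mat_adjoint (U * KP) * KF"
      unfolding U1_def using KFc KPc U_carrier by (subst mat_adjoint_mult) auto
    also have "mat_adjoint (U * KP) = mat_adjoint KP * mat_adjoint U"
      using KPc U_carrier by (intro mat_adjoint_mult) auto
    finally show ?thesis using KFd KPd Ud by (simp add: mult_assoc_dim)
  qed
  have "is_unitary U1"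
    unfolding is_unitary_def
  proof
    have "mat_adjoint U1 * U1 = mat_adjoint KP * (mat_adjoint U * (KF * U1))"
      unfolding U1a using KFd KPd Ud carrier_matD[OF U1c] by (simp add: mult_assoc_dim)
    also have "\<dots> = mat_adjoint KP * ((mat_adjoint U * U) * KP)"
      unfolding inter using KPd Ud by (simp add: mult_assoc_dim)
    also have "\<dots> = 1\<^sub>m (k * dAO * dBO)" unfolding UaU using KPc by (simp add: KP2)
    finally show "mat_adjoint U1 * U1 = 1\<^sub>m (dim_col U1)" using U1c by simp
    \<comment> \<open>The middle factor is \<open>Z = KF * mat_adjoint KF\<close>, which the
      isometry \<open>KF\<close> absorbs from both sides.\<close>
    have "U1 * mat_adjoint U1 = mat_adjoint KF * (U * ((KP * mat_adjoint KP) * mat_adjoint U) * KF)"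
      unfolding U1a unfolding U1_def using KFd KPd Ud by (simp add: mult_assoc_dim)
    also have "\<dots> = (mat_adjoint KF * KF) * (mat_adjoint KF * KF)"
      unfolding KP1 Z_def[symmetric] KF1[symmetric] using KFd by (simp add: mult_assoc_dim)
    also have "\<dots> = 1\<^sub>m (dAI * dBI * f)" unfolding KF2 by simp
    finally show "U1 * mat_adjoint U1 = 1\<^sub>m (dim_row U1)" using U1c by simp
  qed
  moreover have "kron (1\<^sub>m (dAI * dBI)) (VF * mat_adjoint VF) = U * (kron (kron (V * mat_adjoint V) (1\<^sub>m dAO)) (1\<^sub>m dBO) * mat_adjoint U)"
    unfolding VF(3) ZQ[symmetric] Z_def L_def R_def ..
  moreover have "U * kron (kron V (1\<^sub>m dAO)) (1\<^sub>m dBO) = kron (kron (1\<^sub>m dAI) (1\<^sub>m dBI)) VF * U1"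
    using inter by (simp add: KP_def KF_def)
  ultimately show ?thesis using VF U1c
    by (intro exI[of _ f] bexI[of _ VF] bexI[of _ U1]) auto
qed

end

section \<open>Combs\<close>

lemma sandwich_index:
  fixes V M :: "complex mat"
  assumes "V \<in> carrier_mat n k" "M \<in> carrier_mat n n" "p < k" "p' < k"
  shows "(mat_adjoint V * (M * V)) $$ (p', p) = (\<Sum>q'<n. \<Sum>q<n. cnj (V $$ (q', p')) * (M $$ (q', q) * V $$ (q, p)))"
proof -
  have "(mat_adjoint V * (M * V)) $$ (p', p) = (\<Sum>q'<n. mat_adjoint V $$ (p', q') * (M * V) $$ (q', p))"
    using assms by (intro mult_index_sum[of _ k n _ k]) auto
  also have "\<dots> = (\<Sum>q'<n. \<Sum>q<n. cnj (V $$ (q', p')) * (M $$ (q', q) * V $$ (q, p)))"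
    unfolding sum_distrib_left[symmetric] using assms
    by (intro sum.cong refl arg_cong2[where f = "(*)"] mult_index_sum[of _ n n _ k]) auto
  finally show ?thesis .
qed

text \<open>This moves a partial trace, given entrywise, inside the compression by \<open>V\<close>
  without forming sums of matrices.\<close>

lemma sandwich_sum:
  fixes V N :: "complex mat" and M :: "nat \<Rightarrow> complex mat"
  assumes V: "V \<in> carrier_mat n k" and M: "\<And>y. y < d \<Longrightarrow> M y \<in> carrier_mat n n" and N: "N \<in> carrier_mat n n"
    and p: "p < k" "p' < k"
    and sum: "\<And>q q'. q < n \<Longrightarrow> q' < n \<Longrightarrow> (\<Sum>y<d. M y $$ (q', q)) = c * N $$ (q', q)"
  shows "(\<Sum>y<d. (mat_adjoint V * (M y * V)) $$ (p', p)) = c * (mat_adjoint V * (N * V)) $$ (p', p)"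
proof -
  have "(\<Sum>y<d. (mat_adjoint V * (M y * V)) $$ (p', p)) = (\<Sum>y<d. \<Sum>q'<n. \<Sum>q<n. cnj (V $$ (q', p')) * (M y $$ (q', q) * V $$ (q, p)))"
    using M by (intro sum.cong refl sandwich_index[OF V _ p]) auto
  also have "\<dots> = (\<Sum>q'<n. \<Sum>q<n. \<Sum>y<d. cnj (V $$ (q', p')) * (M y $$ (q', q) * V $$ (q, p)))"
    by ((rule trans[OF sum.swap], rule sum.cong[OF refl])+) simp
  also have "\<dots> = (\<Sum>q'<n. \<Sum>q<n. c * (cnj (V $$ (q', p')) * (N $$ (q', q) * V $$ (q, p))))"
    by (intro sum.cong refl) (simp add: sum flip: sum_distrib_left sum_distrib_right)
  finally show ?thesis unfolding sandwich_index[OF V N p] by (simp add: sum_distrib_left)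
qed

text \<open>One criterion for both orders. \<open>M\<close> holds the partial trace over F as
  matrices on the unrestricted P, and \<open>V\<close> restricts them; positivity is automatic for a
  rank-one operator. Condition \<open>c1\<close> has \<open>V\<close> on the right only, the form in
  which a vanishing signal delivers it.\<close>

lemma is_comb_funI:
  fixes g :: "nat list \<Rightarrow> complex" and V :: "complex mat"
  assumes w: "\<And>x y. list_all2 (<) x [k, dXI, dXO, dYI, dYO, dF] \<Longrightarrow> list_all2 (<) y [k, dXI, dXO, dYI, dYO, dF] \<Longrightarrow> w x y = g x * cnj (g y)"
    and V: "V \<in> carrier_mat n k" "is_isometry V"
    and M: "\<And>xi xi' xo xo' yi yi' yo yo'. M xi xi' xo xo' yi yi' yo yo' \<in> carrier_mat n n"
    and N: "\<And>xi xi'. N xi xi' \<in> carrier_mat n n"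
    and c0: "\<And>p p' xi xi' xo xo' yi yi' yo yo'. p < k \<Longrightarrow> p' < k \<Longrightarrow> xi < dXI \<Longrightarrow> xi' < dXI \<Longrightarrow> xo < dXO \<Longrightarrow> xo' < dXO \<Longrightarrow>
       yi < dYI \<Longrightarrow> yi' < dYI \<Longrightarrow> yo < dYO \<Longrightarrow> yo' < dYO \<Longrightarrow>
       (\<Sum>f<dF. g [p, xi, xo, yi, yo, f] * cnj (g [p', xi', xo', yi', yo', f])) = (mat_adjoint V * (M xi xi' xo xo' yi yi' yo yo' * V)) $$ (p', p)"
    and c1: "\<And>xi xi' xo xo' yi yi' yo yo'. xi < dXI \<Longrightarrow> xi' < dXI \<Longrightarrow> xo < dXO \<Longrightarrow> xo' < dXO \<Longrightarrow>
       yi < dYI \<Longrightarrow> yi' < dYI \<Longrightarrow> yo < dYO \<Longrightarrow> yo' < dYO \<Longrightarrow>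
       M xi xi' xo xo' yi yi' yo yo' * V = (if yo = yo' then 1 else 0) \<cdot>\<^sub>m (M xi xi' xo xo' yi yi' 0 0 * V)"
    and c2: "\<And>q q' xi xi' xo xo'. q < n \<Longrightarrow> q' < n \<Longrightarrow> xi < dXI \<Longrightarrow> xi' < dXI \<Longrightarrow> xo < dXO \<Longrightarrow> xo' < dXO \<Longrightarrow>
       (\<Sum>yi<dYI. M xi xi' xo xo' yi yi 0 0 $$ (q', q)) = (if xo = xo' then 1 else 0) * N xi xi' $$ (q', q)"
    and c3: "\<And>q q'. q < n \<Longrightarrow> q' < n \<Longrightarrow> (\<Sum>xi<dXI. N xi xi $$ (q', q)) = 1\<^sub>m n $$ (q', q)"
  shows "is_comb_fun k dXI dXO dYI dYO dF w"
proof -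
  define ds where "ds = [k, dXI, dXO, dYI, dYO, dF]"
  \<comment> \<open>The output of the later slot is set to the reference index 0, and the entry is
    read at \<open>(y ! 0, x ! 0)\<close> since the conjugated tuple labels rows.\<close>
  define R2 where "R2 x y = (mat_adjoint V * (M (x ! 1) (y ! 1) (x ! 2) (y ! 2) (x ! 3) (y ! 3) 0 0 * V)) $$ (y ! 0, x ! 0)" for x y :: "nat list"
  define R1 where "R1 x y = (mat_adjoint V * (N (x ! 1) (y ! 1) * V)) $$ (y ! 0, x ! 0)" for x y :: "nat list"
  have "mat (prod_list ds) (prod_list ds) (\<lambda>(r, c). w (dec ds r) (dec ds c))
      = mat (prod_list ds) (prod_list ds) (\<lambda>(r, c). g (dec ds r) * cnj (g (dec ds c)))"
    using dec_less_enc_dec w unfolding ds_def[symmetric] by (intro cong_mat) auto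
  hence psd: "psd (prod_list ds) (mat (prod_list ds) (prod_list ds) (\<lambda>(r, c). w (dec ds r) (dec ds c)))"
    by (simp only: psd_rank_one[where g = "\<lambda>r. g (dec ds r)"])
  have VV: "mat_adjoint V * V = 1\<^sub>m k" using V by (auto simp: is_isometry_def)
  have 1: "(\<Sum>f<dF. w [p, xi, xo, yi, yo, f] [p', xi', xo', yi', yo', f])
      = (if yo = yo' then R2 [p, xi, xo, yi] [p', xi', xo', yi'] else 0)"
    if r: "p < k" "p' < k" "xi < dXI" "xi' < dXI" "xo < dXO" "xo' < dXO" "yi < dYI" "yi' < dYI" "yo < dYO" "yo' < dYO"
    for p p' xi xi' xo xo' yi yi' yo yo'
  proof -
    have "(\<Sum>f<dF. w [p, xi, xo, yi, yo, f] [p', xi', xo', yi', yo', f])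
        = (\<Sum>f<dF. g [p, xi, xo, yi, yo, f] * cnj (g [p', xi', xo', yi', yo', f]))"
      using r by (intro sum.cong refl w) auto
    also have "\<dots> = (mat_adjoint V * (M xi xi' xo xo' yi yi' yo yo' * V)) $$ (p', p)" using r by (intro c0)
    also have "\<dots> = (mat_adjoint V * ((if yo = yo' then 1 else 0) \<cdot>\<^sub>m (M xi xi' xo xo' yi yi' 0 0 * V))) $$ (p', p)"
      using c1[OF r(3-10)] by simp
    also have "mat_adjoint V * ((if yo = yo' then 1 else 0) \<cdot>\<^sub>m (M xi xi' xo xo' yi yi' 0 0 * V))
       = (if yo = yo' then 1 else 0) \<cdot>\<^sub>m (mat_adjoint V * (M xi xi' xo xo' yi yi' 0 0 * V))"
      by (rule mult_smult_distrib[OF mat_adjoint_carrier[OF V(1)] mult_carrier_mat[OF M V(1)]])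
    also have "\<dots> $$ (p', p) = (if yo = yo' then 1 else 0) * (mat_adjoint V * (M xi xi' xo xo' yi yi' 0 0 * V)) $$ (p', p)"
      using r V(1) by (intro index_smult_mat(1)) auto
    finally show ?thesis by (simp add: R2_def)
  qed
  have 2: "(\<Sum>yi<dYI. R2 [p, xi, xo, yi] [p', xi', xo', yi]) = (if xo = xo' then R1 [p, xi] [p', xi'] else 0)"
    if r: "p < k" "p' < k" "xi < dXI" "xi' < dXI" "xo < dXO" "xo' < dXO" for p p' xi xi' xo xo'
    using sandwich_sum[OF V(1) M N r(1,2) c2[OF _ _ r(3-6)]] by (simp add: R2_def R1_def)
  have 3: "(\<Sum>xi<dXI. R1 [p, xi] [p', xi]) = (if p = p' then 1 else 0)" if r: "p < k" "p' < k" for p p'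
  proof -
    have "(\<Sum>xi<dXI. (mat_adjoint V * (N xi xi * V)) $$ (p', p)) = 1 * (mat_adjoint V * (1\<^sub>m n * V)) $$ (p', p)"
      by (rule sandwich_sum[OF V(1) N one_carrier_mat r]) (simp add: c3)
    thus ?thesis using V(1) VV r by (auto simp: R1_def)
  qed
  show ?thesis
    unfolding is_comb_fun_def Let_def ds_def[symmetric]
    by (intro conjI exI[of _ R2] exI[of _ R1] allI impI psd 1 2 3)
qed

lemma minus_zero_mat_imp_eq:
  fixes X Y :: "complex mat"
  assumes "X \<in> carrier_mat n m" "Y \<in> carrier_mat n m" "X - Y = 0\<^sub>m n m"
  shows "X = Y"
proof (rule eq_matI)
  fix i j assume ij: "i < dim_row Y" "j < dim_col Y"
  have "(X - Y) $$ (i, j) = 0" using assms ij by simp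
  thus "X $$ (i, j) = Y $$ (i, j)" using assms(1,2) ij by simp
qed (use assms in auto)

context two_slot
begin

text \<open>The intertwining relation makes the Heisenberg evolution under \<open>U1\<close> the
  compression by \<open>KP\<close> of the evolution under \<open>U\<close>; comparing entries
  compresses each block on P by \<open>V\<close>.\<close>

lemma reduced_choi_sector:
  assumes V: "V \<in> carrier_mat dP k" and VF: "VF \<in> carrier_mat dF f" "is_isometry VF"
    and U1: "U1 \<in> carrier_mat (dAI * dBI * f) (k * dAO * dBO)"
    and inter: "U * kron (kron V (1\<^sub>m dAO)) (1\<^sub>m dBO) = kron (kron (1\<^sub>m dAI) (1\<^sub>m dBI)) VF * U1"
    and p: "p < k" "p' < k" and r: "s < dAO" "s' < dAO" "t < dBO" "t' < dBO"
    and a: "a < dAI" "a' < dAI" and b: "b < dBI" "b' < dBI"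
  shows "reduced_choi dAO dBI dBO f U1 p p' a a' s s' b b' t t' = (mat_adjoint V * (reduced_choi_mat a a' s s' b b' t t' * V)) $$ (p', p)"
proof -
  define EA EB where "EA = matrix_unit dAI a' a" and "EB = matrix_unit dBI b' b"
  have Ec: "EA \<in> carrier_mat dAI dAI" "EB \<in> carrier_mat dBI dBI" by (auto simp: EA_def EB_def)
  define KP where "KP = kron (kron V (1\<^sub>m dAO)) (1\<^sub>m dBO)"
  have KPc: "KP \<in> carrier_mat (dP * dAO * dBO) (k * dAO * dBO)" using V by (auto simp: KP_def)
  have KPa: "mat_adjoint KP = kron (kron (mat_adjoint V) (1\<^sub>m dAO)) (1\<^sub>m dBO)"
    unfolding KP_def using kron3_adjoint[OF V one_carrier_mat one_carrier_mat] by simp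
  define KF where "KF = kron (kron (1\<^sub>m dAI) (1\<^sub>m dBI)) VF"
  have KFc: "KF \<in> carrier_mat (dAI * dBI * dF) (dAI * dBI * f)" using VF by (auto simp: KF_def)
  define G G' where "G = kron (kron EA EB) (1\<^sub>m dF)" and "G' = kron (kron EA EB) (1\<^sub>m f)"
  have Gc: "G \<in> carrier_mat (dAI * dBI * dF) (dAI * dBI * dF)" "G' \<in> carrier_mat (dAI * dBI * f) (dAI * dBI * f)"
    using Ec by (auto simp: G_def G'_def)
  note d = carrier_matD[OF KPc] carrier_matD[OF KFc] carrier_matD[OF Gc(1)] carrier_matD[OF Gc(2)]
    carrier_matD[OF U1] carrier_matD[OF U_carrier]
  have VFVF: "mat_adjoint VF * VF = 1\<^sub>m f" using VF by (auto simp: is_isometry_def)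
  \<comment> \<open>The observable is trivial on F, so the isometry \<open>VF\<close> only changes
    the size of the identity factor there.\<close>
  have GKF: "mat_adjoint KF * (G * KF) = G'"
  proof -
    have "mat_adjoint KF = kron (kron (1\<^sub>m dAI) (1\<^sub>m dBI)) (mat_adjoint VF)"
      unfolding KF_def using kron3_adjoint[OF one_carrier_mat one_carrier_mat VF(1)] by simp
    moreover have "G * KF = kron (kron EA EB) VF"
      unfolding G_def KF_def using kron3_mult[OF Ec one_carrier_mat one_carrier_mat one_carrier_mat VF(1)] Ec VF by simp
    moreover have "kron (kron (1\<^sub>m dAI) (1\<^sub>m dBI)) (mat_adjoint VF) * kron (kron EA EB) VF = G'"
      unfolding G'_def using kron3_mult[OF one_carrier_mat one_carrier_mat mat_adjoint_carrier[OF VF(1)] Ec VF(1)] Ec by (simp add: VFVF)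
    ultimately show ?thesis by simp
  qed
  have inter': "U * KP = KF * U1" unfolding KP_def KF_def by (rule inter)
  have "mat_adjoint (U * KP) = mat_adjoint KP * mat_adjoint U" using U_carrier KPc by (rule mat_adjoint_mult)
  moreover have "mat_adjoint (U * KP) = mat_adjoint U1 * mat_adjoint KF"
    unfolding inter' using KFc U1 by (rule mat_adjoint_mult)
  ultimately have adj: "mat_adjoint KP * mat_adjoint U = mat_adjoint U1 * mat_adjoint KF" by simp
  have H1: "heisenberg f U1 EA EB = mat_adjoint KP * (heisenberg dF U EA EB * KP)"
  proof -
    have "heisenberg f U1 EA EB = mat_adjoint U1 * ((mat_adjoint KF * (G * KF)) * U1)"
      unfolding heisenberg_def GKF G'_def ..
    also have "\<dots> = (mat_adjoint U1 * mat_adjoint KF) * (G * (KF * U1))"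
      using d by (simp add: mult_assoc_dim)
    also have "\<dots> = (mat_adjoint KP * mat_adjoint U) * (G * (U * KP))"
      by (simp only: adj inter')
    also have "\<dots> = mat_adjoint KP * (heisenberg dF U EA EB * KP)"
      unfolding heisenberg_def G_def[symmetric] using d by (simp add: mult_assoc_dim)
    finally show ?thesis .
  qed
  have Hc: "heisenberg dF U EA EB \<in> carrier_mat (dP * dAO * dBO) (dP * dAO * dBO)" using U_carrier Ec by (intro heisenberg_carrier)
  let ?i = "(p' * dAO + s') * dBO + t'" and ?j = "(p * dAO + s) * dBO + t"
  have j: "?j < k * dAO * dBO" using p r by (intro index3_less)
  have "reduced_choi dAO dBI dBO f U1 p p' a a' s s' b b' t t' = heisenberg f U1 EA EB $$ (?i, ?j)"
    unfolding EA_def EB_def using heisenberg_matrix_unit_index[OF U1 p r a b] by simp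
  also have "\<dots> = (\<Sum>q'<dP. mat_adjoint V $$ (p', q') * (heisenberg dF U EA EB * KP) $$ ((q' * dAO + s') * dBO + t', ?j))"
    unfolding H1 KPa using V Hc KPc r p j by (intro lift_mult_left_index) auto
  also have "\<dots> = (\<Sum>q'<dP. mat_adjoint V $$ (p', q') * (\<Sum>q<dP. \<tau> q q' a a' s s' b b' t t' * V $$ (q, p)))"
  proof (rule sum.cong[OF refl])
    fix q' assume q': "q' \<in> {..<dP}"
    have "(heisenberg dF U EA EB * KP) $$ ((q' * dAO + s') * dBO + t', ?j)
        = (\<Sum>q<dP. heisenberg dF U EA EB $$ ((q' * dAO + s') * dBO + t', (q * dAO + s) * dBO + t) * V $$ (q, p))"
      unfolding KP_def using V Hc r p q' by (intro lift_mult_right_index) (auto intro!: index3_less)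
    also have "\<dots> = (\<Sum>q<dP. \<tau> q q' a a' s s' b b' t t' * V $$ (q, p))"
      unfolding EA_def EB_def using heisenberg_matrix_unit_index[OF U_carrier] q' r a b by simp
    finally show "mat_adjoint V $$ (p', q') * (heisenberg dF U EA EB * KP) $$ ((q' * dAO + s') * dBO + t', ?j)
        = mat_adjoint V $$ (p', q') * (\<Sum>q<dP. \<tau> q q' a a' s s' b b' t t' * V $$ (q, p))" by simp
  qed
  also have "\<dots> = (mat_adjoint V * (reduced_choi_mat a a' s s' b b' t t' * V)) $$ (p', p)"
    unfolding sandwich_index[OF V slice_carrier(3) p] sum_distrib_left
    using V p by (intro sum.cong refl) (auto simp: reduced_choi_mat_def)
  finally show ?thesis .
qed

text \<open>The identity evolves to the identity. Its diagonal block at the reference outputs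
  supplies the normalisation of a comb.\<close>

lemma reduced_choi_trace:
  assumes p: "p < dP" "p' < dP"
  shows "(\<Sum>a<dAI. \<Sum>b<dBI. \<tau> p p' a a 0 0 b b 0 0) = 1\<^sub>m dP $$ (p', p)"
proof -
  have z: "(0::nat) < dAO" "(0::nat) < dBO" using dims by auto
  have h1: "heisenberg dF U (1\<^sub>m dAI) (1\<^sub>m dBI) = 1\<^sub>m (dP * dAO * dBO)"
    unfolding heisenberg_def using U_carrier by (simp add: UaU)
  have "heisenberg dF U (1\<^sub>m dAI) (1\<^sub>m dBI) $$ ((p' * dAO + 0) * dBO + 0, (p * dAO + 0) * dBO + 0)
     = (\<Sum>a'<dAI. \<Sum>b'<dBI. \<Sum>a<dAI. \<Sum>b<dBI. 1\<^sub>m dAI $$ (a', a) * 1\<^sub>m dBI $$ (b', b) * \<tau> p p' a a' 0 0 b b' 0 0)"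
    using p z by (intro heisenberg_index[OF U_carrier]) auto
  also have "\<dots> = (\<Sum>a'<dAI. \<Sum>b'<dBI. \<Sum>a<dAI. \<Sum>b<dBI. if b = b' then (if a = a' then \<tau> p p' a a' 0 0 b b' 0 0 else 0) else 0)"
    by (intro sum.cong refl) auto
  also have "\<dots> = (\<Sum>a<dAI. \<Sum>b<dBI. \<tau> p p' a a 0 0 b b 0 0)" by simp
  finally show ?thesis
    unfolding h1 using p z index3_less[OF p(1) z] index3_less[OF p(2) z] by simp
qed

lemma sector_comb_AB:
  assumes V: "V \<in> carrier_mat dP k" "is_isometry V" and VF: "VF \<in> carrier_mat dF f" "is_isometry VF"
    and U1: "U1 \<in> carrier_mat (dAI * dBI * f) (k * dAO * dBO)"
    and inter: "U * kron (kron V (1\<^sub>m dAO)) (1\<^sub>m dBO) = kron (kron (1\<^sub>m dAI) (1\<^sub>m dBI)) VF * U1"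
    and zero: "\<And>a a' t t'. a < dAI \<Longrightarrow> a' < dAI \<Longrightarrow> t < dBO \<Longrightarrow> t' < dBO \<Longrightarrow> signalA a a' t t' * V = 0\<^sub>m dP k"
  shows "is_comb_AB k dAI dAO dBI dBO f (supermap_choi k dAI dAO dBI dBO f U1)"
  unfolding is_comb_AB_def
proof (rule is_comb_funI[OF supermap_choi_index V, where M = reduced_choi_mat and N = "\<lambda>a a'. sliceA a a' 0 0"])
  fix p p' a a' s s' b b' t t'
  assume "p < k" "p' < k" "a < dAI" "a' < dAI" "s < dAO" "s' < dAO" "b < dBI" "b' < dBI" "t < dBO" "t' < dBO"
  thus "(\<Sum>z<f. U1 $$ (([p, a, s, b, t, z] ! 1 * dBI + [p, a, s, b, t, z] ! 3) * f + [p, a, s, b, t, z] ! 5,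
            ([p, a, s, b, t, z] ! 0 * dAO + [p, a, s, b, t, z] ! 2) * dBO + [p, a, s, b, t, z] ! 4)
      * cnj (U1 $$ (([p', a', s', b', t', z] ! 1 * dBI + [p', a', s', b', t', z] ! 3) * f + [p', a', s', b', t', z] ! 5,
            ([p', a', s', b', t', z] ! 0 * dAO + [p', a', s', b', t', z] ! 2) * dBO + [p', a', s', b', t', z] ! 4)))
      = (mat_adjoint V * (reduced_choi_mat a a' s s' b b' t t' * V)) $$ (p', p)"
    using reduced_choi_sector[OF V(1) VF U1 inter, of p p' s s' t t' a a' b b'] by (simp add: reduced_choi_def)
next
  fix a a' s s' b b' t t'
  assume r: "a < dAI" "a' < dAI" "s < dAO" "s' < dAO" "b < dBI" "b' < dBI" "t < dBO" "t' < dBO"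
  have "sliceA a a' t t' * V - (if t = t' then 1 else 0) \<cdot>\<^sub>m (sliceA a a' 0 0 * V) = 0\<^sub>m dP k"
    using zero[OF r(1,2,7,8)] signalA_mult_right[OF V(1)] by simp
  hence eq: "sliceA a a' t t' * V = (if t = t' then 1 else 0) \<cdot>\<^sub>m (sliceA a a' 0 0 * V)"
    by (rule minus_zero_mat_imp_eq[OF mult_carrier_mat[OF slice_carrier(1) V(1)]
          smult_carrier_mat[OF mult_carrier_mat[OF slice_carrier(1) V(1)]]])
  \<comment> \<open>Of the two orders in \<open>slice_mult\<close>, this one puts
    \<open>sliceA\<close> next to \<open>V\<close>, where the vanishing \<open>signalA\<close>
    applies.\<close>
  have "reduced_choi_mat a a' s s' b b' t t' * V = sliceB b b' s s' * (sliceA a a' t t' * V)"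
    unfolding slice_mult(2)[OF r(3,4,7,8,1,2,5,6), symmetric]
    by (rule assoc_mult_mat[OF slice_carrier(2) slice_carrier(1) V(1)])
  also have "\<dots> = (if t = t' then 1 else 0) \<cdot>\<^sub>m (sliceB b b' s s' * (sliceA a a' 0 0 * V))"
    unfolding eq by (rule mult_smult_distrib[OF slice_carrier(2) mult_carrier_mat[OF slice_carrier(1) V(1)]])
  also have "sliceB b b' s s' * (sliceA a a' 0 0 * V) = reduced_choi_mat a a' s s' b b' 0 0 * V"
    unfolding slice_mult(2)[OF r(3,4) dims(5) dims(5) r(1,2,5,6), symmetric]
    by (rule assoc_mult_mat[OF slice_carrier(2) slice_carrier(1) V(1), symmetric])
  finally show "reduced_choi_mat a a' s s' b b' t t' * V = (if t = t' then 1 else 0) \<cdot>\<^sub>m (reduced_choi_mat a a' s s' b b' 0 0 * V)" .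
next
  fix q q' a a' s s' assume r: "q < dP" "q' < dP" "a < dAI" "a' < dAI" "s < dAO" "s' < dAO"
  show "(\<Sum>b<dBI. reduced_choi_mat a a' s s' b b 0 0 $$ (q', q)) = (if s = s' then 1 else 0) * sliceA a a' 0 0 $$ (q', q)"
    using superchannel_no_loop(2)[OF super dims(2-5) r(1,2,5,6) dims(5) dims(5) r(3,4)] r by (simp add: reduced_choi_mat_def sliceA_def)
next
  fix q q' assume "q < dP" "q' < dP"
  thus "(\<Sum>a<dAI. sliceA a a 0 0 $$ (q', q)) = 1\<^sub>m dP $$ (q', q)"
    using reduced_choi_trace[of q q'] by (simp add: sliceA_def)
qed auto

lemma swapAB_valid:
  assumes "list_all2 (<) x [k, dBI, dBO, dAI, dAO, f]"
  shows "list_all2 (<) (swapAB x) [k, dAI, dAO, dBI, dBO, f]"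
  using assms by (auto simp: list_all2_Cons2 swapAB_def)

lemma sector_comb_BA:
  assumes V: "V \<in> carrier_mat dP k" "is_isometry V" and VF: "VF \<in> carrier_mat dF f" "is_isometry VF"
    and U1: "U1 \<in> carrier_mat (dAI * dBI * f) (k * dAO * dBO)"
    and inter: "U * kron (kron V (1\<^sub>m dAO)) (1\<^sub>m dBO) = kron (kron (1\<^sub>m dAI) (1\<^sub>m dBI)) VF * U1"
    and zero: "\<And>b b' s s'. b < dBI \<Longrightarrow> b' < dBI \<Longrightarrow> s < dAO \<Longrightarrow> s' < dAO \<Longrightarrow> signalB b b' s s' * V = 0\<^sub>m dP k"
  shows "is_comb_BA k dAI dAO dBI dBO f (supermap_choi k dAI dAO dBI dBO f U1)"
  unfolding is_comb_BA_def
\<comment> \<open>Tuples now list the B slot first, so \<open>M\<close> takes its arguments with the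
  slots exchanged.\<close>
proof (rule is_comb_funI[OF supermap_choi_index[OF swapAB_valid swapAB_valid] V,
      where M = "\<lambda>b b' t t' a a' s s'. reduced_choi_mat a a' s s' b b' t t'" and N = "\<lambda>b b'. sliceB b b' 0 0"])
  fix p p' b b' t t' a a' s s'
  assume "p < k" "p' < k" "b < dBI" "b' < dBI" "t < dBO" "t' < dBO" "a < dAI" "a' < dAI" "s < dAO" "s' < dAO"
  thus "(\<Sum>z<f. U1 $$ ((swapAB [p, b, t, a, s, z] ! 1 * dBI + swapAB [p, b, t, a, s, z] ! 3) * f + swapAB [p, b, t, a, s, z] ! 5,
            (swapAB [p, b, t, a, s, z] ! 0 * dAO + swapAB [p, b, t, a, s, z] ! 2) * dBO + swapAB [p, b, t, a, s, z] ! 4)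
      * cnj (U1 $$ ((swapAB [p', b', t', a', s', z] ! 1 * dBI + swapAB [p', b', t', a', s', z] ! 3) * f + swapAB [p', b', t', a', s', z] ! 5,
            (swapAB [p', b', t', a', s', z] ! 0 * dAO + swapAB [p', b', t', a', s', z] ! 2) * dBO + swapAB [p', b', t', a', s', z] ! 4)))
      = (mat_adjoint V * (reduced_choi_mat a a' s s' b b' t t' * V)) $$ (p', p)"
    using reduced_choi_sector[OF V(1) VF U1 inter, of p p' s s' t t' a a' b b'] by (simp add: reduced_choi_def swapAB_def)
next
  fix b b' t t' a a' s s'
  assume r: "b < dBI" "b' < dBI" "t < dBO" "t' < dBO" "a < dAI" "a' < dAI" "s < dAO" "s' < dAO"
  have "sliceB b b' s s' * V - (if s = s' then 1 else 0) \<cdot>\<^sub>m (sliceB b b' 0 0 * V) = 0\<^sub>m dP k"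
    using zero[OF r(1,2,7,8)] signalB_mult_right[OF V(1)] by simp
  hence eq: "sliceB b b' s s' * V = (if s = s' then 1 else 0) \<cdot>\<^sub>m (sliceB b b' 0 0 * V)"
    by (rule minus_zero_mat_imp_eq[OF mult_carrier_mat[OF slice_carrier(2) V(1)]
          smult_carrier_mat[OF mult_carrier_mat[OF slice_carrier(2) V(1)]]])
  \<comment> \<open>The mirror image: here \<open>sliceB\<close> has to stand next to
    \<open>V\<close>.\<close>
  have "reduced_choi_mat a a' s s' b b' t t' * V = sliceA a a' t t' * (sliceB b b' s s' * V)"
    unfolding slice_mult(1)[OF r(7,8,3,4,5,6,1,2), symmetric]
    by (rule assoc_mult_mat[OF slice_carrier(1) slice_carrier(2) V(1)])
  also have "\<dots> = (if s = s' then 1 else 0) \<cdot>\<^sub>m (sliceA a a' t t' * (sliceB b b' 0 0 * V))"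
    unfolding eq by (rule mult_smult_distrib[OF slice_carrier(1) mult_carrier_mat[OF slice_carrier(2) V(1)]])
  also have "sliceA a a' t t' * (sliceB b b' 0 0 * V) = reduced_choi_mat a a' 0 0 b b' t t' * V"
    unfolding slice_mult(1)[OF dims(3) dims(3) r(3,4,5,6,1,2), symmetric]
    by (rule assoc_mult_mat[OF slice_carrier(1) slice_carrier(2) V(1), symmetric])
  finally show "reduced_choi_mat a a' s s' b b' t t' * V = (if s = s' then 1 else 0) \<cdot>\<^sub>m (reduced_choi_mat a a' 0 0 b b' t t' * V)" .
next
  fix q q' b b' t t' assume r: "q < dP" "q' < dP" "b < dBI" "b' < dBI" "t < dBO" "t' < dBO"
  show "(\<Sum>a<dAI. reduced_choi_mat a a 0 0 b b' t t' $$ (q', q)) = (if t = t' then 1 else 0) * sliceB b b' 0 0 $$ (q', q)"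
    using superchannel_no_loop(3)[OF super dims(2-5) r(1,2) dims(3) dims(3) r(5,6,3,4)] r by (simp add: reduced_choi_mat_def sliceB_def)
next
  fix q q' assume "q < dP" "q' < dP"
  thus "(\<Sum>b<dBI. sliceB b b 0 0 $$ (q', q)) = 1\<^sub>m dP $$ (q', q)"
    using reduced_choi_trace[of q q'] by (simp add: sliceB_def sum.swap[of _ "{..<dBI}"])
qed auto

end

text \<open>Subspaces are given by isometries out of coordinate spaces, so the direct sum appears as
  two intertwining equations. A summand may be zero-dimensional, which covers supermaps with one
  definite order.\<close>

theorem theorem4:
  fixes dP dAI dAO dBI dBO dF :: nat and U :: "complex mat"
  assumes dims: "0 < dP" "0 < dAI" "0 < dAO" "0 < dBI" "0 < dBO" "0 < dF"
    and U_carrier: "U \<in> carrier_mat (dAI * dBI * dF) (dP * dAO * dBO)"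
    and U_unitary: "is_unitary U"
    and super: "is_superchannel dP dAI dAO dBI dBO dF (supermap_choi dP dAI dAO dBI dBO dF U)"
    and pure: "is_pure_supermap dP dAI dAO dBI dBO dF (supermap_choi dP dAI dAO dBI dBO dF U)"
  shows "\<exists>p1 p2 f1 f2 VP1 VP2 VF1 VF2 U1 U2.
     \<comment> \<open>P = range VP1 (+) range VP2 orthogonally, with VP1, VP2 isometries\<close>
     VP1 \<in> carrier_mat dP p1 \<and> VP2 \<in> carrier_mat dP p2 \<and>
     is_isometry VP1 \<and> is_isometry VP2 \<and> mat_adjoint VP1 * VP2 = 0\<^sub>m p1 p2 \<and>
     VP1 * mat_adjoint VP1 + VP2 * mat_adjoint VP2 = 1\<^sub>m dP \<and>
     \<comment> \<open>F = range VF1 (+) range VF2 orthogonally\<close>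
     VF1 \<in> carrier_mat dF f1 \<and> VF2 \<in> carrier_mat dF f2 \<and>
     is_isometry VF1 \<and> is_isometry VF2 \<and> mat_adjoint VF1 * VF2 = 0\<^sub>m f1 f2 \<and>
     VF1 * mat_adjoint VF1 + VF2 * mat_adjoint VF2 = 1\<^sub>m dF \<and>
     \<comment> \<open>U1 : P1 (x) A_O (x) B_O -> A_I (x) B_I (x) F1 unitary, a comb of A before B\<close>
     U1 \<in> carrier_mat (dAI * dBI * f1) (p1 * dAO * dBO) \<and> is_unitary U1 \<and>
     is_comb_AB p1 dAI dAO dBI dBO f1 (supermap_choi p1 dAI dAO dBI dBO f1 U1) \<and>
     \<comment> \<open>U2 : P2 (x) A_O (x) B_O -> A_I (x) B_I (x) F2 unitary, a comb of B before A\<close>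
     U2 \<in> carrier_mat (dAI * dBI * f2) (p2 * dAO * dBO) \<and> is_unitary U2 \<and>
     is_comb_BA p2 dAI dAO dBI dBO f2 (supermap_choi p2 dAI dAO dBI dBO f2 U2) \<and>
     \<comment> \<open>U = U1 (+) U2\<close>
     U * kron (kron VP1 (1\<^sub>m dAO)) (1\<^sub>m dBO) = kron (kron (1\<^sub>m dAI) (1\<^sub>m dBI)) VF1 * U1 \<and>
     U * kron (kron VP2 (1\<^sub>m dAO)) (1\<^sub>m dBO) = kron (kron (1\<^sub>m dAI) (1\<^sub>m dBI)) VF2 * U2"
proof -
  interpret two_slot dP dAI dAO dBI dBO dF U
    using dims U_carrier U_unitary super by unfold_locales
  obtain k l V1 V2 where V: "V1 \<in> carrier_mat dP k" "V2 \<in> carrier_mat dP l" "is_isometry V1" "is_isometry V2"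
     "V1 * mat_adjoint V1 + V2 * mat_adjoint V2 = 1\<^sub>m dP"
    and c1: "\<And>a a' t t'. a < dAI \<Longrightarrow> a' < dAI \<Longrightarrow> t < dBO \<Longrightarrow> t' < dBO \<Longrightarrow> V1 * mat_adjoint V1 * sliceA a a' t t' = sliceA a a' t t' * (V1 * mat_adjoint V1)"
      "\<And>b b' s s'. b < dBI \<Longrightarrow> b' < dBI \<Longrightarrow> s < dAO \<Longrightarrow> s' < dAO \<Longrightarrow> V1 * mat_adjoint V1 * sliceB b b' s s' = sliceB b b' s s' * (V1 * mat_adjoint V1)"
    and c2: "\<And>a a' t t'. a < dAI \<Longrightarrow> a' < dAI \<Longrightarrow> t < dBO \<Longrightarrow> t' < dBO \<Longrightarrow> V2 * mat_adjoint V2 * sliceA a a' t t' = sliceA a a' t t' * (V2 * mat_adjoint V2)"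
      "\<And>b b' s s'. b < dBI \<Longrightarrow> b' < dBI \<Longrightarrow> s < dAO \<Longrightarrow> s' < dAO \<Longrightarrow> V2 * mat_adjoint V2 * sliceB b b' s s' = sliceB b b' s s' * (V2 * mat_adjoint V2)"
    and z1: "\<And>a a' t t'. a < dAI \<Longrightarrow> a' < dAI \<Longrightarrow> t < dBO \<Longrightarrow> t' < dBO \<Longrightarrow> signalA a a' t t' * V1 = 0\<^sub>m dP k"
    and z2: "\<And>b b' s s'. b < dBI \<Longrightarrow> b' < dBI \<Longrightarrow> s < dAO \<Longrightarrow> s' < dAO \<Longrightarrow> signalB b b' s s' * V2 = 0\<^sub>m dP l"
    using P_decomposition by auto
  let ?L = "\<lambda>R. kron (kron R (1\<^sub>m dAO)) (1\<^sub>m dBO)"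
  obtain f1 VF1 U1 where s1: "VF1 \<in> carrier_mat dF f1" "U1 \<in> carrier_mat (dAI * dBI * f1) (k * dAO * dBO)"
    "is_isometry VF1" "is_unitary U1" "U * ?L V1 = kron (kron (1\<^sub>m dAI) (1\<^sub>m dBI)) VF1 * U1"
    "kron (1\<^sub>m (dAI * dBI)) (VF1 * mat_adjoint VF1) = U * (?L (V1 * mat_adjoint V1) * mat_adjoint U)"
    using sector[OF V(1,3) c1] by blast
  obtain f2 VF2 U2 where s2: "VF2 \<in> carrier_mat dF f2" "U2 \<in> carrier_mat (dAI * dBI * f2) (l * dAO * dBO)"
    "is_isometry VF2" "is_unitary U2" "U * ?L V2 = kron (kron (1\<^sub>m dAI) (1\<^sub>m dBI)) VF2 * U2"
    "kron (1\<^sub>m (dAI * dBI)) (VF2 * mat_adjoint VF2) = U * (?L (V2 * mat_adjoint V2) * mat_adjoint U)"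
    using sector[OF V(2,4) c2] by blast
  define R1 R2 where "R1 = V1 * mat_adjoint V1" and "R2 = V2 * mat_adjoint V2"
  have Rc: "R1 \<in> carrier_mat dP dP" "R2 \<in> carrier_mat dP dP" using V by (auto simp: R1_def R2_def)
  define Q1 Q2 where "Q1 = VF1 * mat_adjoint VF1" and "Q2 = VF2 * mat_adjoint VF2"
  have Qc: "Q1 \<in> carrier_mat dF dF" "Q2 \<in> carrier_mat dF dF" using s1 s2 by (auto simp: Q1_def Q2_def)
  have Lc: "?L R1 \<in> carrier_mat (dP * dAO * dBO) (dP * dAO * dBO)" "?L R2 \<in> carrier_mat (dP * dAO * dBO) (dP * dAO * dBO)"
    using Rc by auto
  have Lsum: "?L R1 + ?L R2 = 1\<^sub>m (dP * dAO * dBO)"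
  proof -
    have "kron (R1 + R2) (1\<^sub>m dAO) = kron R1 (1\<^sub>m dAO) + kron R2 (1\<^sub>m dAO)"
      using Rc by (intro kron_add_left) auto
    moreover have "kron (kron R1 (1\<^sub>m dAO) + kron R2 (1\<^sub>m dAO)) (1\<^sub>m dBO) = ?L R1 + ?L R2"
      using Rc by (intro kron_add_left) auto
    ultimately have "?L R1 + ?L R2 = ?L (R1 + R2)" by simp
    thus ?thesis using V(5) by (simp add: R1_def R2_def)
  qed
  \<comment> \<open>\<open>U\<close> transports the resolution of the identity on P to one on the
    output side; stripping the factor on \<open>A_I\<close> and \<open>B_I\<close> leaves the
    resolution of the identity on F.\<close>
  have "kron (1\<^sub>m (dAI * dBI)) (Q1 + Q2) = U * (?L R1 * mat_adjoint U) + U * (?L R2 * mat_adjoint U)"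
    unfolding kron_add_right[OF one_carrier_mat Qc] unfolding Q1_def Q2_def R1_def R2_def s1(6) s2(6) ..
  also have "\<dots> = U * (?L R1 * mat_adjoint U + ?L R2 * mat_adjoint U)"
    using Lc[THEN mult_carrier_mat, OF mat_adjoint_carrier[OF U_carrier]]
    by (rule mult_add_distrib_mat[symmetric, OF U_carrier])
  also have "?L R1 * mat_adjoint U + ?L R2 * mat_adjoint U = (?L R1 + ?L R2) * mat_adjoint U"
    using Lc mat_adjoint_carrier[OF U_carrier] by (rule add_mult_distrib_mat[symmetric])
  also have "U * ((?L R1 + ?L R2) * mat_adjoint U) = U * mat_adjoint U"
    unfolding Lsum using U_carrier by simp
  also have "\<dots> = kron (1\<^sub>m (dAI * dBI)) (1\<^sub>m dF)" by (simp add: UUa)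
  finally have "kron (1\<^sub>m (dAI * dBI)) (Q1 + Q2) = kron (1\<^sub>m (dAI * dBI)) (1\<^sub>m dF)" .
  moreover have "0 < dAI * dBI" using dims by simp
  ultimately have "Q1 + Q2 = 1\<^sub>m dF"
    using kron_one_left_inject[OF add_carrier_mat[OF Qc(2)] one_carrier_mat] by blast
  hence VFsum: "VF1 * mat_adjoint VF1 + VF2 * mat_adjoint VF2 = 1\<^sub>m dF" by (simp add: Q1_def Q2_def)
  have AB: "is_comb_AB k dAI dAO dBI dBO f1 (supermap_choi k dAI dAO dBI dBO f1 U1)"
    by (rule sector_comb_AB[OF V(1,3) s1(1,3,2,5) z1])
  have BA: "is_comb_BA l dAI dAO dBI dBO f2 (supermap_choi l dAI dAO dBI dBO f2 U2)"
    by (rule sector_comb_BA[OF V(2,4) s2(1,3,2,5) z2])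
  note orth = isometries_orthogonal[OF V] isometries_orthogonal[OF s1(1) s2(1) s1(3) s2(3) VFsum]
  show ?thesis
    by (rule exI[of _ k], rule exI[of _ l], rule exI[of _ f1], rule exI[of _ f2], rule exI[of _ V1], rule exI[of _ V2],
        rule exI[of _ VF1], rule exI[of _ VF2], rule exI[of _ U1], rule exI[of _ U2])
       (intro conjI V s1(1-5) s2(1-5) AB BA VFsum orth)
qed

end
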